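(* Let $K$ be a commutative ring, $A,B$ two $K$-algebras and $M,N$ two $A\otimes B^o$-modules, all projective as $K$-modules. There is a long exact sequence $$\cdots\to HH^{*-1}\begin{pmatrix}A&N\\0&B\end{pmatrix}\xrightarrow{d^{*-1}_{N,M}}\mathrm{Ext}^{*-1}_{A\otimes B^o}(N,M)\times\mathrm{Ext}^{*-1}_{A\otimes B^o}(M,M)\times\mathrm{Ext}^{*-1}_{A\otimes B^o}(M,N)\xrightarrow{l^*_{N,M}}HH^*\begin{pmatrix}A&M\oplus N\\0&B\end{pmatrix}\xrightarrow{r^*_{N,M}}HH^*\begin{pmatrix}A&N\\0&B\end{pmatrix}\to\cdots$$ where $l^*_{N,M}$ is induced by $l^*_{M\oplus N}$ (it is the restriction of $l^*_{M\oplus N}$ to the indicated submodule of $\mathrm{Ext}^{*-1}_{A\otimes B^o}(M\oplus N,M\oplus N)$), and $r^*_{N,M}$ is the morphism defined in the context. Moreover $r^*_{L,N}\circ r^*_{N\oplus L,M}=r^*_{L,N\oplus M}$ for all $K$-projective $A\otimes B^o$-modules $L,M,N$.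
   Context: Conventions. $K$ is a commutative ring, $\otimes=\otimes_K$. Algebras are associative unital $K$-algebras; modules over an algebra are unital left modules; $T^o$ is the opposite algebra of $T$. For algebras $A,B$ and an $A\otimes B^o$-module $M$, $\begin{pmatrix}A&M\\0&B\end{pmatrix}$ is the triangular matrix algebra with product $\begin{pmatrix}a&m\\0&b\end{pmatrix}\begin{pmatrix}a'&m'\\0&b'\end{pmatrix}=\begin{pmatrix}aa'&am'+mb'\\0&bb'\end{pmatrix}$. $HH^*T=H^*(T,T)$ is Hochschild cohomology. $\mathrm{Ext}^{-1}=0$. All algebras $A,B$ and all $A\otimes B^o$-modules considered are $K$-projective. Bar complex. For an algebra $T$, $C^T_n=T^{\otimes(n+2)}$ ($n\ge 0$) with differential $a_0\otimes\cdots\otimes a_{n+1}\mapsto\sum_{i=0}^n(-1)^i a_0\otimes\cdots\otimes a_ia_{i+1}\otimes\cdots\otimes a_{n+1}$; $C^{T+}_*$ is its augmentation, with $C^{T+}_{-1}=T$. For a $T\otimes T^o$-module $\Lambda$, $C^*(T,\Lambda)=\mathrm{Hom}_{T\otimes T^o}(C^T_*,\Lambda)$ and $C^*(T)=C^*(T,T)$. Triangular complex. $C^{A,B^o}_*$ is the complex whose part of degree $n\ge 0$ is $\bigoplus_{p+q=n-1;\ p,q\ge -1}C^{A+}_p\otimes C^{B^o+}_q$, with differential $d\otimes 1+(-1)^{p+1}1\otimes d$ (the summand $p=q=-1$, of degree $-1$, is discarded). For an $A\otimes B^o$-module $M$ put $C^{A,B^o}_*M=C^{A,B^o}_*\otimes_{A\otimes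 B^o}M$; the summands with $q=-1$ form the subcomplex $C^A_*M=C^A_*\otimes_AM$ and those with $p=-1$ the subcomplex $C^{B^o}_*M=M\otimes_BC^B_*$. Put $C^*_{tri}(M,N)=\mathrm{Hom}_{A\otimes B^o}(C^{A,B^o}_*M,N)$. Restriction to the two subcomplexes and adjunction give $i^{A*}_{M,N}:C^*_{tri}(M,N)\to C^*(A,\mathrm{Hom}_{B^o}(M,N))$ and $i^{B^o*}_{M,N}:C^*_{tri}(M,N)\to C^*(B,\mathrm{Hom}_A(M,N))$; $i^*_{M,N}=(i^{A*}_{M,N},i^{B^o*}_{M,N})$. The structure maps $A\to\mathrm{End}_{B^o}M$, $B\to(\mathrm{End}_AM)^o$ induce $\alpha^*_M:C^*(A)\to C^*(A,\mathrm{End}_{B^o}M)$ and $\beta^*_M:C^*(B)\to C^*(B,\mathrm{End}_AM)$. Cones. The cone of $f:X^*\to Y^*$ has degree $n$ part $X^n\oplus Y^{n-1}$ and differential $(x,y)\mapsto(dx,f(x)-dy)$. Put $\Sigma^*_{M,N}=\mathrm{cone}(i^*_{M,N})$; its cohomology is $\mathrm{Ext}^{*-1}_{A\otimes B^o}(M,N)$. Let $\mathcal C^*\{M\}$ be the cone of $\lambda^*_M:C^*(A)\times C^*_{tri}(M,M)\times C^*(B)\to C^*(A,\mathrm{End}_{B^o}M)\times C^*(B,\mathrm{End}_AM)$ whose only possibly nonzero components are $\alpha^*_M,\beta^*_M,i^{A*}_{M,M},i^{B^o*}_{M,M}$. By a known theorem (Bendiffalah–Guin, 2004), $\mathcal C^*\{M\}$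 is homotopy equivalent to $C^*\begin{pmatrix}A&M\\0&B\end{pmatrix}$, and $HH^*\begin{pmatrix}A&M\\0&B\end{pmatrix}$ is identified with $H^*(\mathcal C^*\{M\})$. Morphisms. $l^*_M:\mathrm{Ext}^{*-1}_{A\otimes B^o}(M,M)\to HH^*\begin{pmatrix}A&M\\0&B\end{pmatrix}$ is induced by the inclusion $\Sigma^*_{M,M}\subset\mathcal C^*\{M\}$. For $A\otimes B^o$-modules $M,N$, $r^*_{N,M}:HH^*\begin{pmatrix}A&M\oplus N\\0&B\end{pmatrix}\to HH^*\begin{pmatrix}A&N\\0&B\end{pmatrix}$ is induced by the projection $\mathcal C^*\{M\oplus N\}\to\mathcal C^*\{N\}$ which is the identity on $C^*(A),C^*(B)$ and projects each of $C^*_{tri}(M\oplus N,M\oplus N)$, $C^*(A,\mathrm{End}_{B^o}(M\oplus N))$, $C^*(B,\mathrm{End}_A(M\oplus N))$ onto its component attached to $(N,N)$. *)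

theory Defs
  imports
    "HOL-Algebra.Coset"
    "HOL-Library.Function_Algebras"
    "HOL-Library.Product_Plus"
begin

text \<open>
  The ground ring \<open>K\<close> is a type of sort \<open>{comm_ring, monoid_mult}\<close>, i.e. a commutative unital ring
  in which \<open>0 = 1\<close> is allowed (class \<open>comm_ring_1\<close> would exclude the zero ring).
  Algebras and modules live on types of class \<open>ab_group_add\<close>; their structure maps are kept in
  records, because the triangular algebra and direct sums depend on the given structures.
\<close>

section \<open>Algebras and bimodules over a commutative ring\<close>

definition kmodule :: "('k::{comm_ring,monoid_mult} \<Rightarrow> 'v::ab_group_add \<Rightarrow> 'v) \<Rightarrow> bool" where
  "kmodule s \<longleftrightarrow>
     (\<forall>k x y. s k (x + y) = s k x + s k y) \<and>
     (\<forall>k l x. s (k + l) x = s k x + s l x) \<and>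
     (\<forall>k l x. s (k * l) x = s k (s l x)) \<and>
     (\<forall>x. s 1 x = x)"

text \<open>
  Projectivity: the canonical epimorphism from the free module on the underlying set of the module
  splits. The value \<open>\<sigma> x i\<close> is the coefficient of \<open>\<sigma> x\<close> at the basis element \<open>i\<close>.
\<close>

definition kprojective :: "('k::{comm_ring,monoid_mult} \<Rightarrow> 'v::ab_group_add \<Rightarrow> 'v) \<Rightarrow> bool" where
  "kprojective s \<longleftrightarrow>
     (\<exists>\<sigma> :: 'v \<Rightarrow> 'v \<Rightarrow> 'k.
        (\<forall>x. finite {i. \<sigma> x i \<noteq> 0}) \<and>
        (\<forall>x y i. \<sigma> (x + y) i = \<sigma> x i + \<sigma> y i) \<and>
        (\<forall>k x i. \<sigma> (s k x) i = k * \<sigma> x i) \<and>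
        (\<forall>x. (\<Sum>i\<in>{i. \<sigma> x i \<noteq> 0}. s (\<sigma> x i) i) = x))"

record ('k, 'a) alg =
  amul :: "'a \<Rightarrow> 'a \<Rightarrow> 'a"
  aone :: "'a"
  ascal :: "'k \<Rightarrow> 'a \<Rightarrow> 'a"

definition kalgebra :: "('k::{comm_ring,monoid_mult}, 'a::ab_group_add) alg \<Rightarrow> bool" where
  "kalgebra A \<longleftrightarrow>
     kmodule (ascal A) \<and>
     (\<forall>x y z. amul A (amul A x y) z = amul A x (amul A y z)) \<and>
     (\<forall>x. amul A (aone A) x = x \<and> amul A x (aone A) = x) \<and>
     (\<forall>x y z. amul A (x + y) z = amul A x z + amul A y z) \<and>
     (\<forall>x y z. amul A x (y + z) = amul A x y + amul A x z) \<and>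
     (\<forall>k x y. amul A (ascal A k x) y = ascal A k (amul A x y)) \<and>
     (\<forall>k x y. amul A x (ascal A k y) = ascal A k (amul A x y))"

definition opp :: "('k, 'a) alg \<Rightarrow> ('k, 'a) alg" where
  "opp A = \<lparr>amul = (\<lambda>x y. amul A y x), aone = aone A, ascal = ascal A\<rparr>"

text \<open>
  A left module over the tensor product of \<open>A\<close> and the opposite of \<open>B\<close> is the same as an
  abelian group with a left \<open>A\<close>-action and a commuting right \<open>B\<close>-action which induce the same
  \<open>K\<close>-module structure; the element \<open>a \<otimes> b\<close> acts by \<open>m \<mapsto> a m b\<close>.
\<close>

record ('k, 'a, 'b, 'm) bimod =
  lact :: "'a \<Rightarrow> 'm \<Rightarrow> 'm"
  ract :: "'m \<Rightarrow> 'b \<Rightarrow> 'm"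
  mscal :: "'k \<Rightarrow> 'm \<Rightarrow> 'm"

definition bimodule ::
  "('k::{comm_ring,monoid_mult}, 'a::ab_group_add) alg \<Rightarrow> ('k, 'b::ab_group_add) alg
     \<Rightarrow> ('k, 'a, 'b, 'm::ab_group_add) bimod \<Rightarrow> bool" where
  "bimodule A B M \<longleftrightarrow>
     kmodule (mscal M) \<and>
     (\<forall>a x y. lact M a (x + y) = lact M a x + lact M a y) \<and>
     (\<forall>a a' x. lact M (a + a') x = lact M a x + lact M a' x) \<and>
     (\<forall>a a' x. lact M (amul A a a') x = lact M a (lact M a' x)) \<and>
     (\<forall>x. lact M (aone A) x = x) \<and>
     (\<forall>k a x. lact M (ascal A k a) x = mscal M k (lact M a x)) \<and>
     (\<forall>k a x. lact M a (mscal M k x) = mscal M k (lact M a x)) \<and>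
     (\<forall>b x y. ract M (x + y) b = ract M x b + ract M y b) \<and>
     (\<forall>b b' x. ract M x (b + b') = ract M x b + ract M x b') \<and>
     (\<forall>b b' x. ract M x (amul B b b') = ract M (ract M x b) b') \<and>
     (\<forall>x. ract M x (aone B) = x) \<and>
     (\<forall>k b x. ract M x (ascal B k b) = mscal M k (ract M x b)) \<and>
     (\<forall>k b x. ract M (mscal M k x) b = mscal M k (ract M x b)) \<and>
     (\<forall>a b x. ract M (lact M a x) b = lact M a (ract M x b))"

definition dsum ::
  "('k, 'a, 'b, 'm) bimod \<Rightarrow> ('k, 'a, 'b, 'n) bimod \<Rightarrow> ('k, 'a, 'b, 'm \<times> 'n) bimod"
    (infixr \<open>\<oplus>\<^sub>m\<close> 65) where
  "M \<oplus>\<^sub>m N = \<lparr>lact = (\<lambda>a (x, y). (lact M a x, lact N a y)),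
              ract = (\<lambda>(x, y) b. (ract M x b, ract N y b)),
              mscal = (\<lambda>k (x, y). (mscal M k x, mscal N k y))\<rparr>"

text \<open>The triangular matrix with diagonal \<open>a\<close>, \<open>b\<close> and corner \<open>m\<close> is the triple \<open>(a, m, b)\<close>.\<close>

definition triang ::
  "('k, 'a) alg \<Rightarrow> ('k, 'a, 'b, 'm::ab_group_add) bimod \<Rightarrow> ('k, 'b) alg
     \<Rightarrow> ('k, 'a \<times> 'm \<times> 'b::ab_group_add) alg" where
  "triang A M B =
     \<lparr>amul = (\<lambda>(a, m, b) (a', m', b').
                (amul A a a', lact M a m' + ract M m b', amul B b b')),
      aone = (aone A, 0, aone B),
      ascal = (\<lambda>k (a, m, b). (ascal A k a, mscal M k m, ascal B k b))\<rparr>"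

lemma bimodule_dsum: "bimodule A B M \<Longrightarrow> bimodule A B N \<Longrightarrow> bimodule A B (M \<oplus>\<^sub>m N)"
  unfolding bimodule_def kmodule_def dsum_def by (simp add: split_beta)

lemma kalgebra_triang:
  "kalgebra A \<Longrightarrow> kalgebra B \<Longrightarrow> bimodule A B M \<Longrightarrow> kalgebra (triang A M B)"
  unfolding kalgebra_def bimodule_def kmodule_def triang_def
  by (simp add: split_beta algebra_simps zero_prod_def) (metis add_cancel_right_right)

definition regular :: "('k, 'a) alg \<Rightarrow> ('k, 'a, 'a, 'a) bimod" where
  "regular T = \<lparr>lact = amul T, ract = amul T, mscal = ascal T\<rparr>"

text \<open>The homomorphisms of right \<open>B\<close>-modules form an \<open>A\<close>-bimodule, those of left \<open>A\<close>-modules a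
  \<open>B\<close>-bimodule. Both are given by a carrier inside the function type and by their actions.\<close>

definition homR :: "('k, 'a, 'b, 'm::ab_group_add) bimod \<Rightarrow> ('k, 'a, 'b, 'n::ab_group_add) bimod
    \<Rightarrow> ('m \<Rightarrow> 'n) set" where
  "homR M N = {h. (\<forall>x y. h (x + y) = h x + h y) \<and> (\<forall>x b. h (ract M x b) = ract N (h x) b)}"

definition homR_bimod :: "('k, 'a, 'b, 'm) bimod \<Rightarrow> ('k, 'a, 'b, 'n) bimod
    \<Rightarrow> ('k, 'a, 'a, 'm \<Rightarrow> 'n) bimod" where
  "homR_bimod M N = \<lparr>lact = (\<lambda>a h x. lact N a (h x)), ract = (\<lambda>h a x. h (lact M a x)),
                     mscal = (\<lambda>k h x. mscal N k (h x))\<rparr>"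

definition homL :: "('k, 'a, 'b, 'm::ab_group_add) bimod \<Rightarrow> ('k, 'a, 'b, 'n::ab_group_add) bimod
    \<Rightarrow> ('m \<Rightarrow> 'n) set" where
  "homL M N = {h. (\<forall>x y. h (x + y) = h x + h y) \<and> (\<forall>x a. h (lact M a x) = lact N a (h x))}"

definition homL_bimod :: "('k, 'a, 'b, 'm) bimod \<Rightarrow> ('k, 'a, 'b, 'n) bimod
    \<Rightarrow> ('k, 'b, 'b, 'm \<Rightarrow> 'n) bimod" where
  "homL_bimod M N = \<lparr>lact = (\<lambda>b h x. h (ract M x b)), ract = (\<lambda>h b x. ract N (h x) b),
                     mscal = (\<lambda>k h x. mscal N k (h x))\<rparr>"

section \<open>Cochain complexes of \<open>K\<close>-modules, cones and cohomology\<close>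

text \<open>
  In every complex used below, the components of different degrees are subgroups of one
  and the same group which meet only in \<open>0\<close> (cochains of different degrees are supported on
  lists of different lengths). Hence one function can serve as the differential, or as a
  morphism, in all degrees at once.
\<close>

record ('k, 'x) complex =
  cochains :: "int \<Rightarrow> 'x set"
  diff :: "'x \<Rightarrow> 'x"
  cscal :: "'k \<Rightarrow> 'x \<Rightarrow> 'x"

definition cocycles :: "('k, 'x::ab_group_add) complex \<Rightarrow> int \<Rightarrow> 'x monoid" where
  "cocycles X n = \<lparr>carrier = {x \<in> cochains X n. diff X x = 0}, mult = (+), one = 0\<rparr>"

definition coboundaries :: "('k, 'x) complex \<Rightarrow> int \<Rightarrow> 'x set" where
  "coboundaries X n = diff X ` cochains X (n - 1)"

definition coh :: "('k, 'x::ab_group_add) complex \<Rightarrow> int \<Rightarrow> 'x set monoid" where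
  "coh X n = cocycles X n Mod coboundaries X n"

definition coh_class :: "('k, 'x::ab_group_add) complex \<Rightarrow> int \<Rightarrow> 'x \<Rightarrow> 'x set" where
  "coh_class X n x = coboundaries X n #>\<^bsub>cocycles X n\<^esub> x"

text \<open>
  The map on cohomology induced by a map \<open>F\<close> of cochains with values in \<open>Y\<close>, into degree \<open>n\<close>:
  the union is over the representatives, all of which yield the same class.
\<close>

definition coh_map :: "('k, 'y::ab_group_add) complex \<Rightarrow> int \<Rightarrow> ('x \<Rightarrow> 'y) \<Rightarrow> 'x set \<Rightarrow> 'y set" where
  "coh_map Y n F c = (\<Union>x\<in>c. coh_class Y n (F x))"

definition coh_scal :: "('k, 'x::ab_group_add) complex \<Rightarrow> int \<Rightarrow> 'k \<Rightarrow> 'x set \<Rightarrow> 'x set" where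
  "coh_scal X n k = coh_map X n (cscal X k)"

definition klinear_hom ::
  "('k \<Rightarrow> 'g \<Rightarrow> 'g) \<Rightarrow> 'g monoid \<Rightarrow> ('k \<Rightarrow> 'h \<Rightarrow> 'h) \<Rightarrow> 'h monoid \<Rightarrow> ('g \<Rightarrow> 'h) \<Rightarrow> bool" where
  "klinear_hom sG G sH H f \<longleftrightarrow>
     f \<in> hom G H \<and> (\<forall>k. \<forall>x\<in>carrier G. f (sG k x) = sH k (f x))"

definition graded_map ::
  "('k, 'x::ab_group_add) complex \<Rightarrow> ('k, 'y::ab_group_add) complex \<Rightarrow> int \<Rightarrow> ('x \<Rightarrow> 'y) \<Rightarrow> bool" where
  "graded_map X Y e F \<longleftrightarrow>
     (\<forall>n. F ` cochains X n \<subseteq> cochains Y (n + e)) \<and>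
     (\<forall>n. \<forall>x\<in>cochains X n. \<forall>x'\<in>cochains X n. F (x + x') = F x + F x') \<and>
     (\<forall>n k. \<forall>x\<in>cochains X n. F (cscal X k x) = cscal Y k (F x))"

definition chain_map ::
  "('k, 'x::ab_group_add) complex \<Rightarrow> ('k, 'y::ab_group_add) complex \<Rightarrow> ('x \<Rightarrow> 'y) \<Rightarrow> bool" where
  "chain_map X Y F \<longleftrightarrow>
     graded_map X Y 0 F \<and> (\<forall>n. \<forall>x\<in>cochains X n. F (diff X x) = diff Y (F x))"

definition homotopic ::
  "('k, 'x::ab_group_add) complex \<Rightarrow> ('k, 'y::ab_group_add) complex
     \<Rightarrow> ('x \<Rightarrow> 'y) \<Rightarrow> ('x \<Rightarrow> 'y) \<Rightarrow> bool" where
  "homotopic X Y F G \<longleftrightarrow>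
     (\<exists>h. graded_map X Y (-1) h \<and>
        (\<forall>n. \<forall>x\<in>cochains X n. F x - G x = diff Y (h x) + h (diff X x)))"

definition homotopy_equiv ::
  "('k, 'x::ab_group_add) complex \<Rightarrow> ('k, 'y::ab_group_add) complex \<Rightarrow> ('x \<Rightarrow> 'y) \<Rightarrow> bool" where
  "homotopy_equiv X Y F \<longleftrightarrow>
     chain_map X Y F \<and>
     (\<exists>G. chain_map Y X G \<and> homotopic X X (G \<circ> F) id \<and> homotopic Y Y (F \<circ> G) id)"

definition cprod :: "('k, 'x) complex \<Rightarrow> ('k, 'y) complex \<Rightarrow> ('k, 'x \<times> 'y) complex"
    (infixr \<open>\<times>\<^sub>c\<close> 80) where
  "X \<times>\<^sub>c Y = \<lparr>cochains = (\<lambda>n. cochains X n \<times> cochains Y n),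
              diff = (\<lambda>(x, y). (diff X x, diff Y y)),
              cscal = (\<lambda>k (x, y). (cscal X k x, cscal Y k y))\<rparr>"

definition cone ::
  "('k, 'x) complex \<Rightarrow> ('k, 'y::ab_group_add) complex \<Rightarrow> ('x \<Rightarrow> 'y) \<Rightarrow> ('k, 'x \<times> 'y) complex" where
  "cone X Y f = \<lparr>cochains = (\<lambda>n. cochains X n \<times> cochains Y (n - 1)),
                 diff = (\<lambda>(x, y). (diff X x, f x - diff Y y)),
                 cscal = (\<lambda>k (x, y). (cscal X k x, cscal Y k y))\<rparr>"

section \<open>Hochschild cochains\<close>

definition altsign :: "nat \<Rightarrow> 'v::ab_group_add \<Rightarrow> 'v" where
  "altsign i v = (if even i then v else - v)"

definition merge :: "('a \<Rightarrow> 'a \<Rightarrow> 'a) \<Rightarrow> nat \<Rightarrow> 'a list \<Rightarrow> 'a list" where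
  "merge m i xs = take i xs @ [m (xs ! i) (xs ! Suc i)] @ drop (i + 2) xs"

definition multilinear ::
  "('k \<Rightarrow> 'a::ab_group_add \<Rightarrow> 'a) \<Rightarrow> ('k \<Rightarrow> 'v::ab_group_add \<Rightarrow> 'v) \<Rightarrow> ('a list \<Rightarrow> 'v) \<Rightarrow> bool" where
  "multilinear s sv f \<longleftrightarrow>
     (\<forall>xs i x y. i < length xs \<longrightarrow> f (xs[i := x + y]) = f (xs[i := x]) + f (xs[i := y])) \<and>
     (\<forall>xs i k x. i < length xs \<longrightarrow> f (xs[i := s k x]) = sv k (f (xs[i := x])))"

text \<open>
  A homomorphism of \<open>T\<close>-bimodules from the \<open>(n + 2)\<close>-fold tensor power of \<open>T\<close> to \<open>L\<close>, with values
  in the carrier \<open>V\<close>, is given through the universal property of the tensor product: it is a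
  \<open>K\<close>-multilinear function of \<open>n + 2\<close> arguments (the list \<open>[a\<^sub>0, \<dots>, a\<^sub>n\<^sub>+\<^sub>1]\<close>) which is left
  \<open>T\<close>-linear in the first and right \<open>T\<close>-linear in the last argument; it is extended by \<open>0\<close> to
  lists of other lengths. The differential is composition with the differential of
  the bar complex.
\<close>

definition bar_diff :: "('k, 't) alg \<Rightarrow> ('t list \<Rightarrow> 'v::ab_group_add) \<Rightarrow> 't list \<Rightarrow> 'v" where
  "bar_diff T f xs = (\<Sum>i<length xs - 1. altsign i (f (merge (amul T) i xs)))"

definition hoch_cochains ::
  "('k, 't::ab_group_add) alg \<Rightarrow> 'v::ab_group_add set \<Rightarrow> ('k, 't, 't, 'v) bimod \<Rightarrow> int
     \<Rightarrow> ('t list \<Rightarrow> 'v) set" where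
  "hoch_cochains T V L n =
     {f. (\<forall>xs. \<not> (0 \<le> n \<and> int (length xs) = n + 2) \<longrightarrow> f xs = 0) \<and>
         (\<forall>xs. f xs \<in> V) \<and>
         multilinear (ascal T) (mscal L) f \<and>
         (\<forall>t x xs. f (amul T t x # xs) = lact L t (f (x # xs))) \<and>
         (\<forall>t x xs. f (xs @ [amul T x t]) = ract L (f (xs @ [x])) t)}"

definition hochschild ::
  "('k, 't::ab_group_add) alg \<Rightarrow> 'v::ab_group_add set \<Rightarrow> ('k, 't, 't, 'v) bimod
     \<Rightarrow> ('k, 't list \<Rightarrow> 'v) complex" where
  "hochschild T V L = \<lparr>cochains = hoch_cochains T V L,
                       diff = bar_diff T,
                       cscal = (\<lambda>k f xs. mscal L k (f xs))\<rparr>"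

abbreviation hochschild_self ::
  "('k, 't::ab_group_add) alg \<Rightarrow> ('k, 't list \<Rightarrow> 't) complex" where
  "hochschild_self T \<equiv> hochschild T UNIV (regular T)"

definition HH :: "('k, 't::ab_group_add) alg \<Rightarrow> int \<Rightarrow> ('t list \<Rightarrow> 't) set monoid" where
  "HH T n = coh (hochschild_self T) n"

section \<open>The triangular complex and \<open>Ext\<close>\<close>

text \<open>
  A homomorphism of \<open>A\<close>-\<open>B\<close>-bimodules to \<open>N\<close> from the tensor product of bar complexes of \<open>A\<close> and of
  the opposite of \<open>B\<close>, tensored over both algebras with \<open>M\<close>, is again given through the universal
  property: it is a function of \<open>xs = [a\<^sub>0, \<dots>, a\<^sub>p\<^sub>+\<^sub>1]\<close>, \<open>ys = [b\<^sub>0, \<dots>, b\<^sub>q\<^sub>+\<^sub>1]\<close> and \<open>m\<close> which is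
  multilinear, linear over the algebras in \<open>a\<^sub>0\<close> and \<open>b\<^sub>0\<close>, and balanced between
  \<open>a\<^sub>p\<^sub>+\<^sub>1\<close>, \<open>b\<^sub>q\<^sub>+\<^sub>1\<close> and \<open>m\<close>. The entries of \<open>ys\<close> are multiplied in the opposite of \<open>B\<close>. Degree
  \<open>-1\<close> of an augmented bar complex corresponds to lists of length 1.
\<close>

definition tri_maps ::
  "('k, 'a::ab_group_add) alg \<Rightarrow> ('k, 'b::ab_group_add) alg \<Rightarrow> ('k, 'a, 'b, 'm::ab_group_add) bimod
     \<Rightarrow> ('k, 'a, 'b, 'n::ab_group_add) bimod \<Rightarrow> ('a list \<Rightarrow> 'b list \<Rightarrow> 'm \<Rightarrow> 'n) set" where
  "tri_maps A B M N =
     {c. (\<forall>ys m. multilinear (ascal A) (mscal N) (\<lambda>xs. c xs ys m)) \<and>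
         (\<forall>xs m. multilinear (ascal B) (mscal N) (\<lambda>ys. c xs ys m)) \<and>
         (\<forall>xs ys m m'. c xs ys (m + m') = c xs ys m + c xs ys m') \<and>
         (\<forall>xs ys k m. c xs ys (mscal M k m) = mscal N k (c xs ys m)) \<and>
         (\<forall>a x xs ys m. c (amul A a x # xs) ys m = lact N a (c (x # xs) ys m)) \<and>
         (\<forall>b xs y ys m. c xs (amul (opp B) b y # ys) m = ract N (c xs (y # ys) m) b) \<and>
         (\<forall>a xs x ys m. c (xs @ [amul A x a]) ys m = c (xs @ [x]) ys (lact M a m)) \<and>
         (\<forall>b xs ys y m. c xs (ys @ [amul (opp B) y b]) m = c xs (ys @ [y]) (ract M m b))}"

text \<open>Composition with \<open>d \<otimes> 1 + (-1)\<^bsup>p+1\<^esup> 1 \<otimes> d\<close>, where \<open>p + 2 = length xs\<close>.\<close>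

definition tri_diff ::
  "('k, 'a) alg \<Rightarrow> ('k, 'b) alg \<Rightarrow> ('a list \<Rightarrow> 'b list \<Rightarrow> 'm \<Rightarrow> 'n::ab_group_add)
     \<Rightarrow> 'a list \<Rightarrow> 'b list \<Rightarrow> 'm \<Rightarrow> 'n" where
  "tri_diff A B c xs ys m =
     bar_diff A (\<lambda>xs'. c xs' ys m) xs
     + altsign (length xs + 1) (bar_diff (opp B) (\<lambda>ys'. c xs ys' m) ys)"

text \<open>Degree \<open>n\<close> is the sum over \<open>p + q = n - 1\<close>, \<open>p, q \<ge> -1\<close>, without the summand of degree \<open>-1\<close>.\<close>

definition tri_complex ::
  "('k, 'a::ab_group_add) alg \<Rightarrow> ('k, 'b::ab_group_add) alg \<Rightarrow> ('k, 'a, 'b, 'm::ab_group_add) bimod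
     \<Rightarrow> ('k, 'a, 'b, 'n::ab_group_add) bimod \<Rightarrow> ('k, 'a list \<Rightarrow> 'b list \<Rightarrow> 'm \<Rightarrow> 'n) complex" where
  "tri_complex A B M N =
     \<lparr>cochains = (\<lambda>n. {c \<in> tri_maps A B M N. \<forall>xs ys.
         \<not> (0 \<le> n \<and> 1 \<le> length xs \<and> 1 \<le> length ys \<and> int (length xs) + int (length ys) = n + 3)
           \<longrightarrow> c xs ys = 0}),
      diff = tri_diff A B,
      cscal = (\<lambda>k c xs ys m. mscal N k (c xs ys m))\<rparr>"

text \<open>
  The total complex of the tensor product of the bar resolutions of \<open>A\<close> and of the opposite of \<open>B\<close>,
  tensored with \<open>M\<close>, is a resolution of \<open>M\<close>; it is projective because \<open>A\<close>, \<open>B\<close> and \<open>M\<close>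
  are \<open>K\<close>-projective, and \<open>Ext\<close> is computed with it. Its degree \<open>n\<close> is the sum over \<open>p + q = n\<close>,
  \<open>p, q \<ge> 0\<close>; the differential of the second factor carries the sign which it has in the
  triangular complex. It vanishes in negative degrees, so that \<open>Ext\<^bsup>-1\<^esup> = 0\<close>.
\<close>

definition ext_complex ::
  "('k, 'a::ab_group_add) alg \<Rightarrow> ('k, 'b::ab_group_add) alg \<Rightarrow> ('k, 'a, 'b, 'm::ab_group_add) bimod
     \<Rightarrow> ('k, 'a, 'b, 'n::ab_group_add) bimod \<Rightarrow> ('k, 'a list \<Rightarrow> 'b list \<Rightarrow> 'm \<Rightarrow> 'n) complex" where
  "ext_complex A B M N =
     \<lparr>cochains = (\<lambda>n. {c \<in> tri_maps A B M N. \<forall>xs ys.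
         \<not> (2 \<le> length xs \<and> 2 \<le> length ys \<and> int (length xs) + int (length ys) = n + 4)
           \<longrightarrow> c xs ys = 0}),
      diff = tri_diff A B,
      cscal = (\<lambda>k c xs ys m. mscal N k (c xs ys m))\<rparr>"

definition Ext ::
  "('k, 'a::ab_group_add) alg \<Rightarrow> ('k, 'b::ab_group_add) alg \<Rightarrow> ('k, 'a, 'b, 'm::ab_group_add) bimod
     \<Rightarrow> ('k, 'a, 'b, 'n::ab_group_add) bimod \<Rightarrow> int
     \<Rightarrow> ('a list \<Rightarrow> 'b list \<Rightarrow> 'm \<Rightarrow> 'n) set monoid" where
  "Ext A B M N n = coh (ext_complex A B M N) n"

text \<open>Functoriality in both modules, for bimodule maps \<open>f : M' \<rightarrow> M\<close> and \<open>g : N \<rightarrow> N'\<close>.\<close>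

definition tri_funct ::
  "('m' \<Rightarrow> 'm) \<Rightarrow> ('n \<Rightarrow> 'n') \<Rightarrow> ('a list \<Rightarrow> 'b list \<Rightarrow> 'm \<Rightarrow> 'n)
     \<Rightarrow> 'a list \<Rightarrow> 'b list \<Rightarrow> 'm' \<Rightarrow> 'n'" where
  "tri_funct f g c xs ys = g \<circ> c xs ys \<circ> f"

section \<open>The cones \<open>\<Sigma>\<close> and \<open>\<C>{M}\<close>\<close>

definition iA :: "('k, 'b) alg \<Rightarrow> ('a list \<Rightarrow> 'b list \<Rightarrow> 'm \<Rightarrow> 'n) \<Rightarrow> 'a list \<Rightarrow> 'm \<Rightarrow> 'n" where
  "iA B c xs = c xs [aone B]"

text \<open>
  The bar complex of the opposite of \<open>B\<close> is identified with that of \<open>B\<close> by reversing the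
  tensor factors. In degree \<open>n\<close> the reversal must carry the sign \<open>(-1)\<^bsup>n(n+1)/2\<^esup>\<close> in order to
  commute with the differentials.
\<close>

definition iB ::
  "('k, 'a) alg \<Rightarrow> ('a list \<Rightarrow> 'b list \<Rightarrow> 'm \<Rightarrow> 'n::ab_group_add) \<Rightarrow> 'b list \<Rightarrow> 'm \<Rightarrow> 'n" where
  "iB A c bs m =
     altsign ((length bs - 2) * (length bs - 1) div 2) (c [aone A] (rev bs) m)"

definition alphaM :: "('k, 'a, 'b, 'm) bimod \<Rightarrow> ('a list \<Rightarrow> 'a) \<Rightarrow> 'a list \<Rightarrow> 'm \<Rightarrow> 'm" where
  "alphaM M f xs m = lact M (f xs) m"

definition betaM :: "('k, 'a, 'b, 'm) bimod \<Rightarrow> ('b list \<Rightarrow> 'b) \<Rightarrow> 'b list \<Rightarrow> 'm \<Rightarrow> 'm" where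
  "betaM M g ys m = ract M m (g ys)"

abbreviation hom_complexes ::
  "('k, 'a::ab_group_add) alg \<Rightarrow> ('k, 'b::ab_group_add) alg \<Rightarrow> ('k, 'a, 'b, 'm::ab_group_add) bimod
     \<Rightarrow> ('k, 'a, 'b, 'n::ab_group_add) bimod
     \<Rightarrow> ('k, ('a list \<Rightarrow> 'm \<Rightarrow> 'n) \<times> ('b list \<Rightarrow> 'm \<Rightarrow> 'n)) complex" where
  "hom_complexes A B M N \<equiv>
     hochschild A (homR M N) (homR_bimod M N) \<times>\<^sub>c hochschild B (homL M N) (homL_bimod M N)"

definition Sigma_complex ::
  "('k, 'a::ab_group_add) alg \<Rightarrow> ('k, 'b::ab_group_add) alg \<Rightarrow> ('k, 'a, 'b, 'm::ab_group_add) bimod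
     \<Rightarrow> ('k, 'a, 'b, 'n::ab_group_add) bimod
     \<Rightarrow> ('k, ('a list \<Rightarrow> 'b list \<Rightarrow> 'm \<Rightarrow> 'n) \<times>
              (('a list \<Rightarrow> 'm \<Rightarrow> 'n) \<times> ('b list \<Rightarrow> 'm \<Rightarrow> 'n))) complex" where
  "Sigma_complex A B M N =
     cone (tri_complex A B M N) (hom_complexes A B M N) (\<lambda>c. (iA B c, iB A c))"

type_synonym ('a, 'b, 'm) C_cochain =
  "(('a list \<Rightarrow> 'a) \<times> ('a list \<Rightarrow> 'b list \<Rightarrow> 'm \<Rightarrow> 'm) \<times> ('b list \<Rightarrow> 'b)) \<times>
   (('a list \<Rightarrow> 'm \<Rightarrow> 'm) \<times> ('b list \<Rightarrow> 'm \<Rightarrow> 'm))"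

definition C_complex ::
  "('k, 'a::ab_group_add) alg \<Rightarrow> ('k, 'b::ab_group_add) alg \<Rightarrow> ('k, 'a, 'b, 'm::ab_group_add) bimod
     \<Rightarrow> ('k, ('a, 'b, 'm) C_cochain) complex" where
  "C_complex A B M =
     cone (hochschild_self A \<times>\<^sub>c tri_complex A B M M \<times>\<^sub>c hochschild_self B)
          (hom_complexes A B M M)
          (\<lambda>(f, c, g). (alphaM M f + iA B c, betaM M g + iB A c))"

text \<open>
  By a theorem of Bendiffalah and Guin, \<open>\<C>{M}\<close> is homotopy equivalent to the Hochschild complex of
  the triangular algebra. A homotopy equivalence is fixed here, and the cohomologies are identified
  along it; nothing else is assumed about the choice.
\<close>

definition BG_equiv ::
  "('k, 'a::ab_group_add) alg \<Rightarrow> ('k, 'b::ab_group_add) alg \<Rightarrow> ('k, 'a, 'b, 'm::ab_group_add) bimod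
     \<Rightarrow> ('a, 'b, 'm) C_cochain \<Rightarrow> ('a \<times> 'm \<times> 'b) list \<Rightarrow> 'a \<times> 'm \<times> 'b" where
  "BG_equiv A B M =
     (SOME \<Phi>. homotopy_equiv (C_complex A B M) (hochschild_self (triang A M B)) \<Phi>)"

definition BG_ident ::
  "('k, 'a::ab_group_add) alg \<Rightarrow> ('k, 'b::ab_group_add) alg \<Rightarrow> ('k, 'a, 'b, 'm::ab_group_add) bimod
     \<Rightarrow> int \<Rightarrow> ('a, 'b, 'm) C_cochain set \<Rightarrow> (('a \<times> 'm \<times> 'b) list \<Rightarrow> 'a \<times> 'm \<times> 'b) set" where
  "BG_ident A B M n = coh_map (hochschild_self (triang A M B)) n (BG_equiv A B M)"

section \<open>The morphisms \<open>l\<close> and \<open>r\<close>\<close>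

text \<open>
  The map \<open>i\<close> is surjective, and its kernel in degree \<open>n\<close> consists of the degree \<open>n - 1\<close> cochains of
  the complex computing \<open>Ext\<close>. The identification of \<open>Ext\<close> in degree \<open>n - 1\<close> with the cohomology of
  \<open>\<Sigma>\<close> in degree \<open>n\<close> is therefore induced by \<open>c \<mapsto> (c, 0)\<close>.
\<close>

definition ext_ident ::
  "('k, 'a::ab_group_add) alg \<Rightarrow> ('k, 'b::ab_group_add) alg \<Rightarrow> ('k, 'a, 'b, 'm::ab_group_add) bimod
     \<Rightarrow> ('k, 'a, 'b, 'n::ab_group_add) bimod \<Rightarrow> int
     \<Rightarrow> ('a list \<Rightarrow> 'b list \<Rightarrow> 'm \<Rightarrow> 'n) set
     \<Rightarrow> (('a list \<Rightarrow> 'b list \<Rightarrow> 'm \<Rightarrow> 'n) \<times>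
         (('a list \<Rightarrow> 'm \<Rightarrow> 'n) \<times> ('b list \<Rightarrow> 'm \<Rightarrow> 'n))) set" where
  "ext_ident A B M N n = coh_map (Sigma_complex A B M N) n (\<lambda>c. (c, 0))"

definition Sigma_incl ::
  "('a list \<Rightarrow> 'b list \<Rightarrow> 'm \<Rightarrow> 'm) \<times> (('a list \<Rightarrow> 'm \<Rightarrow> 'm) \<times> ('b list \<Rightarrow> 'm \<Rightarrow> 'm))
     \<Rightarrow> ('a::ab_group_add, 'b::ab_group_add, 'm) C_cochain" where
  "Sigma_incl = (\<lambda>(c, w). ((0, c, 0), w))"

text \<open>The value at degree \<open>n\<close> is a map from \<open>Ext\<close> in degree \<open>n - 1\<close>.\<close>

definition l_one ::
  "('k, 'a::ab_group_add) alg \<Rightarrow> ('k, 'b::ab_group_add) alg \<Rightarrow> ('k, 'a, 'b, 'm::ab_group_add) bimod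
     \<Rightarrow> int \<Rightarrow> ('a list \<Rightarrow> 'b list \<Rightarrow> 'm \<Rightarrow> 'm) set
     \<Rightarrow> (('a \<times> 'm \<times> 'b) list \<Rightarrow> 'a \<times> 'm \<times> 'b) set" where
  "l_one A B M n c =
     BG_ident A B M n (coh_map (C_complex A B M) n Sigma_incl (ext_ident A B M M n c))"

definition Ext3 ::
  "('k, 'a::ab_group_add) alg \<Rightarrow> ('k, 'b::ab_group_add) alg \<Rightarrow> ('k, 'a, 'b, 'm::ab_group_add) bimod
     \<Rightarrow> ('k, 'a, 'b, 'n::ab_group_add) bimod \<Rightarrow> int
     \<Rightarrow> (('a list \<Rightarrow> 'b list \<Rightarrow> 'n \<Rightarrow> 'm) set \<times> ('a list \<Rightarrow> 'b list \<Rightarrow> 'm \<Rightarrow> 'm) set \<times>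
         ('a list \<Rightarrow> 'b list \<Rightarrow> 'm \<Rightarrow> 'n) set) monoid" where
  "Ext3 A B M N n = Ext A B N M n \<times>\<times> Ext A B M M n \<times>\<times> Ext A B M N n"

definition Ext3_scal ::
  "('k, 'a::ab_group_add) alg \<Rightarrow> ('k, 'b::ab_group_add) alg \<Rightarrow> ('k, 'a, 'b, 'm::ab_group_add) bimod
     \<Rightarrow> ('k, 'a, 'b, 'n::ab_group_add) bimod \<Rightarrow> int \<Rightarrow> 'k
     \<Rightarrow> ('a list \<Rightarrow> 'b list \<Rightarrow> 'n \<Rightarrow> 'm) set \<times> ('a list \<Rightarrow> 'b list \<Rightarrow> 'm \<Rightarrow> 'm) set \<times>
        ('a list \<Rightarrow> 'b list \<Rightarrow> 'm \<Rightarrow> 'n) set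
     \<Rightarrow> ('a list \<Rightarrow> 'b list \<Rightarrow> 'n \<Rightarrow> 'm) set \<times> ('a list \<Rightarrow> 'b list \<Rightarrow> 'm \<Rightarrow> 'm) set \<times>
        ('a list \<Rightarrow> 'b list \<Rightarrow> 'm \<Rightarrow> 'n) set" where
  "Ext3_scal A B M N n k = (\<lambda>(u, v, w).
     (coh_scal (ext_complex A B N M) n k u, coh_scal (ext_complex A B M M) n k v,
      coh_scal (ext_complex A B M N) n k w))"

definition Ext3_incl ::
  "('k, 'a::ab_group_add) alg \<Rightarrow> ('k, 'b::ab_group_add) alg \<Rightarrow> ('k, 'a, 'b, 'm::ab_group_add) bimod
     \<Rightarrow> ('k, 'a, 'b, 'n::ab_group_add) bimod \<Rightarrow> int
     \<Rightarrow> ('a list \<Rightarrow> 'b list \<Rightarrow> 'n \<Rightarrow> 'm) set \<times> ('a list \<Rightarrow> 'b list \<Rightarrow> 'm \<Rightarrow> 'm) set \<times>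
        ('a list \<Rightarrow> 'b list \<Rightarrow> 'm \<Rightarrow> 'n) set
     \<Rightarrow> ('a list \<Rightarrow> 'b list \<Rightarrow> 'm \<times> 'n \<Rightarrow> 'm \<times> 'n) set" where
  "Ext3_incl A B M N n = (\<lambda>(u, v, w).
     let S = M \<oplus>\<^sub>m N; E = ext_complex A B S S in
       coh_map E n (tri_funct snd (\<lambda>x. (x, 0))) u
       \<otimes>\<^bsub>Ext A B S S n\<^esub> coh_map E n (tri_funct fst (\<lambda>x. (x, 0))) v
       \<otimes>\<^bsub>Ext A B S S n\<^esub> coh_map E n (tri_funct fst (\<lambda>y. (0, y))) w)"

definition l_map ::
  "('k, 'a::ab_group_add) alg \<Rightarrow> ('k, 'b::ab_group_add) alg \<Rightarrow> ('k, 'a, 'b, 'n::ab_group_add) bimod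
     \<Rightarrow> ('k, 'a, 'b, 'm::ab_group_add) bimod \<Rightarrow> int
     \<Rightarrow> ('a list \<Rightarrow> 'b list \<Rightarrow> 'n \<Rightarrow> 'm) set \<times> ('a list \<Rightarrow> 'b list \<Rightarrow> 'm \<Rightarrow> 'm) set \<times>
        ('a list \<Rightarrow> 'b list \<Rightarrow> 'm \<Rightarrow> 'n) set
     \<Rightarrow> (('a \<times> ('m \<times> 'n) \<times> 'b) list \<Rightarrow> 'a \<times> ('m \<times> 'n) \<times> 'b) set" where
  "l_map A B N M n e = l_one A B (M \<oplus>\<^sub>m N) n (Ext3_incl A B M N (n - 1) e)"

text \<open>
  For bimodule maps \<open>\<pi> : X \<rightarrow> Y\<close> and \<open>\<iota> : Y \<rightarrow> X\<close> with \<open>\<pi> \<circ> \<iota> = id\<close>: the morphism which is the identity on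
  the Hochschild cochains of \<open>A\<close> and \<open>B\<close> and sends a homomorphism \<open>h\<close> on \<open>X\<close> to \<open>\<pi> \<circ> h \<circ> \<iota>\<close>. If \<open>Y\<close> is
  a summand of \<open>X\<close>, this is the projection onto the \<open>(Y, Y)\<close>-component.
\<close>

definition C_compress ::
  "('x \<Rightarrow> 'y) \<Rightarrow> ('y \<Rightarrow> 'x) \<Rightarrow> ('a, 'b, 'x) C_cochain \<Rightarrow> ('a, 'b, 'y) C_cochain" where
  "C_compress \<pi> \<iota> = (\<lambda>((f, c, g), (u, v)).
     ((f, tri_funct \<iota> \<pi> c, g), (\<lambda>xs. \<pi> \<circ> u xs \<circ> \<iota>, \<lambda>ys. \<pi> \<circ> v ys \<circ> \<iota>)))"

definition HH_compress ::
  "('k, 'a::ab_group_add) alg \<Rightarrow> ('k, 'b::ab_group_add) alg \<Rightarrow> ('k, 'a, 'b, 'x::ab_group_add) bimod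
     \<Rightarrow> ('k, 'a, 'b, 'y::ab_group_add) bimod \<Rightarrow> ('x \<Rightarrow> 'y) \<Rightarrow> ('y \<Rightarrow> 'x) \<Rightarrow> int
     \<Rightarrow> (('a \<times> 'x \<times> 'b) list \<Rightarrow> 'a \<times> 'x \<times> 'b) set
     \<Rightarrow> (('a \<times> 'y \<times> 'b) list \<Rightarrow> 'a \<times> 'y \<times> 'b) set" where
  "HH_compress A B X Y \<pi> \<iota> n z =
     BG_ident A B Y n (coh_map (C_complex A B Y) n (C_compress \<pi> \<iota>)
       (inv_into (carrier (coh (C_complex A B X) n)) (BG_ident A B X n) z))"

definition r_map ::
  "('k, 'a::ab_group_add) alg \<Rightarrow> ('k, 'b::ab_group_add) alg \<Rightarrow> ('k, 'a, 'b, 'n::ab_group_add) bimod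
     \<Rightarrow> ('k, 'a, 'b, 'm::ab_group_add) bimod \<Rightarrow> int
     \<Rightarrow> (('a \<times> ('m \<times> 'n) \<times> 'b) list \<Rightarrow> 'a \<times> ('m \<times> 'n) \<times> 'b) set
     \<Rightarrow> (('a \<times> 'n \<times> 'b) list \<Rightarrow> 'a \<times> 'n \<times> 'b) set" where
  "r_map A B N M = HH_compress A B (M \<oplus>\<^sub>m N) N snd (\<lambda>y. (0, y))"

text \<open>The identification along the canonical isomorphism of \<open>M \<oplus> (N \<oplus> L)\<close> with \<open>(N \<oplus> M) \<oplus> L\<close>.\<close>

definition HH_reassoc ::
  "('k, 'a::ab_group_add) alg \<Rightarrow> ('k, 'b::ab_group_add) alg \<Rightarrow> ('k, 'a, 'b, 'm::ab_group_add) bimod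
     \<Rightarrow> ('k, 'a, 'b, 'n::ab_group_add) bimod \<Rightarrow> ('k, 'a, 'b, 'l::ab_group_add) bimod \<Rightarrow> int
     \<Rightarrow> (('a \<times> ('m \<times> 'n \<times> 'l) \<times> 'b) list \<Rightarrow> 'a \<times> ('m \<times> 'n \<times> 'l) \<times> 'b) set
     \<Rightarrow> (('a \<times> (('n \<times> 'm) \<times> 'l) \<times> 'b) list \<Rightarrow> 'a \<times> (('n \<times> 'm) \<times> 'l) \<times> 'b) set" where
  "HH_reassoc A B M N L =
     HH_compress A B (M \<oplus>\<^sub>m N \<oplus>\<^sub>m L) ((N \<oplus>\<^sub>m M) \<oplus>\<^sub>m L)
       (\<lambda>(x, y, z). ((y, x), z)) (\<lambda>((y, x), z). (x, y, z))"

end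

theory Submission
  imports Defs
begin

text \<open>
  The map whose cone is \<open>\<C>{M}\<close> is surjective with a section in each degree, so the cone is homotopy
  equivalent to the kernel. A kernel element consists of a Hochschild cochain of \<open>A\<close>, one of \<open>B\<close>, and
  multilinear maps of \<open>a\<^sub>0, \<dots>, m, \<dots>, b\<^sub>0\<close>: it is a cochain of the Hochschild complex of the triangular
  algebra relative to the subalgebra spanned by the two diagonal idempotents. That subalgebra is
  separable, so its relative complex is homotopy equivalent to the full one, by an explicit homotopy
  that inserts \<open>e \<otimes> e + f \<otimes> f\<close>.

  The projection \<open>\<C>{M \<oplus> N} \<rightarrow> \<C>{N}\<close> splits in each degree (not as complexes, since the action of \<open>A\<close> and
  \<open>B\<close> on \<open>M\<close> is lost), and its kernel retracts onto the three \<open>Ext\<close> complexes by the same retraction of the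
  cone; the connecting morphism is the retraction applied to the differential of the splitting.
\<close>

section \<open>Cochain complexes and their cohomology\<close>

text \<open>\<open>BG_equiv\<close> is an unspecified choice, so all that can be known of it is that
  it is a homotopy equivalence, and this requires exhibiting one. \<open>r_map\<close> starts with
  the inverse of \<open>BG_ident\<close>, and \<open>l_map\<close> and \<open>r_map\<close> end with
  \<open>BG_ident\<close>; on classes presented as images of \<open>BG_ident\<close> these cancel,
  so exactness is proved for the cones and transported. The surjectivity of i rests on the discarded
  summand p = q = -1: the edges p = -1 and q = -1 meet only there, so a pair of edge cochains can be
  lifted edge by edge. The lift does not commute with the differentials, whence the correction terms
  in the retraction. The splitting of the projection extends cochains on \<open>N\<close> by zero to
  the sum. The cone differential contains the action of a Hochschild cochain f of \<open>A\<close>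
  on the whole sum, while an extension by zero has no block on \<open>M\<close>; the connecting
  morphism measures the missing block \<open>alphaM M f\<close>, and likewise
  \<open>betaM M g\<close>. The signs have one source: reversing a list of m entries multiplies the
  bar differential by (-1)^m. \<open>iB\<close> compensates this by a sign depending on the length,
  and the restriction from the triangular algebra has to repeat it.\<close>

locale cochain_complex =
  fixes X :: "('k, 'x::ab_group_add) complex"
  assumes zero_cochain: "\<And>n. 0 \<in> cochains X n"
    and add_cochain: "\<And>n x y. x \<in> cochains X n \<Longrightarrow> y \<in> cochains X n \<Longrightarrow> x + y \<in> cochains X n"
    and minus_cochain: "\<And>n x. x \<in> cochains X n \<Longrightarrow> - x \<in> cochains X n"
    and diff_cochain: "\<And>n x. x \<in> cochains X n \<Longrightarrow> diff X x \<in> cochains X (n + 1)"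
    and diff_add: "\<And>n x y. x \<in> cochains X n \<Longrightarrow> y \<in> cochains X n \<Longrightarrow>
      diff X (x + y) = diff X x + diff X y"
    and diff_diff: "\<And>n x. x \<in> cochains X n \<Longrightarrow> diff X (diff X x) = 0"
    and scal_cochain: "\<And>n k x. x \<in> cochains X n \<Longrightarrow> cscal X k x \<in> cochains X n"
    and scal_add: "\<And>n k x y. x \<in> cochains X n \<Longrightarrow> y \<in> cochains X n \<Longrightarrow>
      cscal X k (x + y) = cscal X k x + cscal X k y"
    and diff_scal: "\<And>n k x. x \<in> cochains X n \<Longrightarrow> diff X (cscal X k x) = cscal X k (diff X x)"
begin

lemma sub_cochain: "x \<in> cochains X n \<Longrightarrow> y \<in> cochains X n \<Longrightarrow> x - y \<in> cochains X n"
  using add_cochain[of x n "- y"] minus_cochain by simp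

lemma additive_zero:
  assumes "\<And>x y. x \<in> cochains X n \<Longrightarrow> y \<in> cochains X n \<Longrightarrow> F (x + y) = F x + (F y :: 'y::ab_group_add)"
  shows "F 0 = 0"
  using assms[of 0 0] zero_cochain[of n] by simp

lemma additive_minus:
  assumes F: "\<And>x y. x \<in> cochains X n \<Longrightarrow> y \<in> cochains X n \<Longrightarrow> F (x + y) = F x + (F y :: 'y::ab_group_add)"
    and x: "x \<in> cochains X n"
  shows "F (- x) = - F x"
proof -
  have "F x + F (- x) = F 0"
    using F[OF x minus_cochain[OF x]] by simp
  then show ?thesis
    using additive_zero[of n F] F by (simp add: minus_unique)
qed

lemma additive_diff:
  assumes F: "\<And>x y. x \<in> cochains X n \<Longrightarrow> y \<in> cochains X n \<Longrightarrow> F (x + y) = F x + (F y :: 'y::ab_group_add)"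
    and x: "x \<in> cochains X n" and y: "y \<in> cochains X n"
  shows "F (x - y) = F x - F y"
  using F[OF x minus_cochain[OF y]] additive_minus[of n F, OF F y] by simp

lemma diff_zero: "diff X 0 = 0"
  using additive_zero[of 0 "diff X"] diff_add by blast

lemma diff_minus: "x \<in> cochains X n \<Longrightarrow> diff X (- x) = - diff X x"
  by (rule additive_minus[of n]) (auto intro: diff_add)

lemma diff_sub: "x \<in> cochains X n \<Longrightarrow> y \<in> cochains X n \<Longrightarrow> diff X (x - y) = diff X x - diff X y"
  by (rule additive_diff[of n]) (auto intro: diff_add)

lemma scal_zero: "cscal X k 0 = 0"
  using additive_zero[of 0 "cscal X k"] scal_add by blast

lemma zero_coboundary: "0 \<in> coboundaries X n"
  using zero_cochain[of "n - 1"] diff_zero unfolding coboundaries_def by force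

lemma add_coboundary:
  "x \<in> coboundaries X n \<Longrightarrow> y \<in> coboundaries X n \<Longrightarrow> x + y \<in> coboundaries X n"
  unfolding coboundaries_def
  by (clarsimp simp: image_iff) (metis add_cochain diff_add)

lemma minus_coboundary: "x \<in> coboundaries X n \<Longrightarrow> - x \<in> coboundaries X n"
  unfolding coboundaries_def
  by (clarsimp simp: image_iff) (metis minus_cochain diff_minus)

lemma sub_coboundary:
  "x \<in> coboundaries X n \<Longrightarrow> y \<in> coboundaries X n \<Longrightarrow> x - y \<in> coboundaries X n"
  using add_coboundary[of x n "- y"] minus_coboundary by simp

lemma carrier_cocycles: "carrier (cocycles X n) = {x \<in> cochains X n. diff X x = 0}"
  by (simp add: cocycles_def)

lemma coboundary_cocycle: "x \<in> coboundaries X n \<Longrightarrow> x \<in> cochains X n \<and> diff X x = 0"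
  unfolding coboundaries_def using diff_cochain[of _ "n - 1"] diff_diff by auto

lemma comm_group_cocycles: "comm_group (cocycles X n)"
proof (rule comm_groupI)
  fix x assume "x \<in> carrier (cocycles X n)"
  then have "- x \<in> carrier (cocycles X n)"
    by (auto simp: carrier_cocycles diff_minus minus_cochain)
  then show "\<exists>y\<in>carrier (cocycles X n). y \<otimes>\<^bsub>cocycles X n\<^esub> x = \<one>\<^bsub>cocycles X n\<^esub>"
    by (intro bexI[of _ "- x"]) (simp_all add: cocycles_def)
qed (auto simp: cocycles_def zero_cochain diff_zero add_cochain diff_add add.assoc add.commute)

lemma subgroup_coboundaries: "subgroup (coboundaries X n) (cocycles X n)"
proof -
  interpret comm_group "cocycles X n" by (rule comm_group_cocycles)
  have inv: "inv\<^bsub>cocycles X n\<^esub> x = - x" if "x \<in> carrier (cocycles X n)" for x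
    by (rule inv_equality) (use that in \<open>auto simp: cocycles_def minus_cochain diff_minus\<close>)
  show ?thesis
  proof (rule subgroupI)
    show "coboundaries X n \<noteq> {}"
      using zero_coboundary by blast
    show "coboundaries X n \<subseteq> carrier (cocycles X n)"
      using coboundary_cocycle by (auto simp: carrier_cocycles)
    then show "inv\<^bsub>cocycles X n\<^esub> x \<in> coboundaries X n" if "x \<in> coboundaries X n" for x
      using that inv minus_coboundary by auto
    show "x \<otimes>\<^bsub>cocycles X n\<^esub> y \<in> coboundaries X n" if "x \<in> coboundaries X n" "y \<in> coboundaries X n" for x y
      using that by (simp add: cocycles_def add_coboundary)
  qed
qed

lemma group_coh: "group (coh X n)"
  unfolding coh_def
  using comm_group_cocycles subgroup_coboundaries
  by (simp add: normal.factorgroup_is_group comm_group.normal_iff_subgroup)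

lemma mem_coh_class: "y \<in> coh_class X n x \<longleftrightarrow> y - x \<in> coboundaries X n"
proof -
  have "y \<in> coh_class X n x \<longleftrightarrow> (\<exists>b\<in>coboundaries X n. y = b + x)"
    by (auto simp: coh_class_def r_coset_def cocycles_def)
  also have "\<dots> \<longleftrightarrow> y - x \<in> coboundaries X n"
    by (metis diff_add_cancel add_diff_cancel)
  finally show ?thesis .
qed

lemma coh_class_eq_iff: "coh_class X n x = coh_class X n y \<longleftrightarrow> x - y \<in> coboundaries X n"
proof
  assume "coh_class X n x = coh_class X n y"
  then show "x - y \<in> coboundaries X n"
    using mem_coh_class[of x n x] mem_coh_class[of x n y] zero_coboundary by simp
next
  assume *: "x - y \<in> coboundaries X n"
  have "z - x \<in> coboundaries X n \<longleftrightarrow> z - y \<in> coboundaries X n" for z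
    using add_coboundary[OF _ *, of "z - x"] sub_coboundary[OF _ *, of "z - y"] by auto
  then show "coh_class X n x = coh_class X n y"
    by (auto simp: mem_coh_class)
qed

lemma coh_class_self: "x \<in> coh_class X n x"
  by (simp add: mem_coh_class zero_coboundary)

lemma carrier_coh: "carrier (coh X n) = coh_class X n ` {x \<in> cochains X n. diff X x = 0}"
  unfolding coh_def FactGroup_def RCOSETS_def coh_class_def by (auto simp: cocycles_def)

lemma cohE:
  assumes "c \<in> carrier (coh X n)"
  obtains x where "x \<in> cochains X n" "diff X x = 0" "c = coh_class X n x"
  using assms by (auto simp: carrier_coh)

lemma coh_class_carrier: "x \<in> cochains X n \<Longrightarrow> diff X x = 0 \<Longrightarrow> coh_class X n x \<in> carrier (coh X n)"
  by (simp add: carrier_coh)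

lemma one_coh: "\<one>\<^bsub>coh X n\<^esub> = coh_class X n 0"
  by (auto simp: coh_def FactGroup_def mem_coh_class)

lemma coh_class_eq_one: "coh_class X n x = \<one>\<^bsub>coh X n\<^esub> \<longleftrightarrow> x \<in> coboundaries X n"
  by (simp add: one_coh coh_class_eq_iff)

lemma mult_coh: "coh_class X n x \<otimes>\<^bsub>coh X n\<^esub> coh_class X n y = coh_class X n (x + y)"

proof (rule Set.set_eqI)
  fix z
  have "z \<in> coh_class X n x \<otimes>\<^bsub>coh X n\<^esub> coh_class X n y \<longleftrightarrow>
      (\<exists>a b. a - x \<in> coboundaries X n \<and> b - y \<in> coboundaries X n \<and> z = a + b)"
    unfolding mem_coh_class[symmetric] by (auto simp: coh_def FactGroup_def set_mult_def cocycles_def)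
  also have "\<dots> \<longleftrightarrow> z - (x + y) \<in> coboundaries X n"
  proof
    assume "\<exists>a b. a - x \<in> coboundaries X n \<and> b - y \<in> coboundaries X n \<and> z = a + b"
    then obtain a b where "a - x \<in> coboundaries X n" "b - y \<in> coboundaries X n" "z = a + b"
      by blast
    then show "z - (x + y) \<in> coboundaries X n"
      using add_coboundary[of "a - x" n "b - y"] by (simp add: algebra_simps)
  next
    \<comment> \<open>The whole coboundary is put into the first summand; the second is
      \<open>y\<close> itself.\<close>
    assume "z - (x + y) \<in> coboundaries X n"
    then show "\<exists>a b. a - x \<in> coboundaries X n \<and> b - y \<in> coboundaries X n \<and> z = a + b"
      by (intro exI[of _ "z - y"] exI[of _ y]) (simp add: algebra_simps zero_coboundary)
  qed
  finally show "z \<in> coh_class X n x \<otimes>\<^bsub>coh X n\<^esub> coh_class X n y \<longleftrightarrow> z \<in> coh_class X n (x + y)"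
    by (simp add: mem_coh_class)
qed

end

text \<open>Weaker than a chain map: additivity is asked on cocycles only, and coboundaries need
  only go to coboundaries. This fits the connecting morphism, which is not given as a chain map. Two
  degrees occur because the map from \<open>Ext\<close> raises the degree by one.\<close>

definition induces_coh_map ::
  "('k, 'x::ab_group_add) complex \<Rightarrow> int \<Rightarrow> ('k, 'y::ab_group_add) complex \<Rightarrow> int \<Rightarrow> ('x \<Rightarrow> 'y) \<Rightarrow> bool" where
  "induces_coh_map X m Y n F \<longleftrightarrow>
     (\<forall>x\<in>cochains X m. diff X x = 0 \<longrightarrow> F x \<in> cochains Y n \<and> diff Y (F x) = 0) \<and>
     (\<forall>x\<in>cochains X m. \<forall>y\<in>cochains X m. diff X x = 0 \<longrightarrow> diff X y = 0 \<longrightarrow> F (x + y) = F x + F y) \<and>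
     (\<forall>x\<in>cochains X (m - 1). F (diff X x) \<in> coboundaries Y n)"

text \<open>Two representatives differ by a coboundary, whose image is a coboundary, so all members
  of the union in \<open>coh_map\<close> are the same class; the union is nonempty because
  \<open>x\<close> represents its own class. From here on, maps on cohomology are computed on
  representatives.\<close>

lemma coh_map_class:
  assumes "cochain_complex X" "cochain_complex Y" "induces_coh_map X m Y n F"
    and x: "x \<in> cochains X m" "diff X x = 0"
  shows "coh_map Y n F (coh_class X m x) = coh_class Y n (F x)"
proof -
  interpret X: cochain_complex X by fact
  interpret Y: cochain_complex Y by fact
  have "coh_class Y n (F y) = coh_class Y n (F x)" if "y \<in> coh_class X m x" for y
  proof -
    have b: "y - x \<in> coboundaries X m"
      using that by (simp add: X.mem_coh_class)
    then have c: "y - x \<in> cochains X m" "diff X (y - x) = 0"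
      using X.coboundary_cocycle by auto
    have "F y = F ((y - x) + x)" by simp
    also have "\<dots> = F (y - x) + F x"
      using assms(3) c x unfolding induces_coh_map_def by blast
    finally have "F y - F x = F (y - x)" by simp
    also have "\<dots> \<in> coboundaries Y n"
      using assms(3) b unfolding induces_coh_map_def coboundaries_def[of X] by auto
    finally show ?thesis by (simp add: Y.coh_class_eq_iff)
  qed
  then show ?thesis
    using X.coh_class_self[of x m] unfolding coh_map_def by blast
qed

lemma graded_map_induces:
  assumes X: "cochain_complex X" and Y: "cochain_complex Y" and F: "graded_map X Y e F"
    and d: "\<And>n x. x \<in> cochains X n \<Longrightarrow> F (diff X x) = diff Y (F x)" and n: "n = m + e"
  shows "induces_coh_map X m Y n F"
proof -
  interpret X: cochain_complex X by fact
  interpret Y: cochain_complex Y by fact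
  have F0: "F 0 = 0"
    using X.additive_zero[of 0 F] F unfolding graded_map_def by blast
  have 1: "F x \<in> cochains Y n" if "x \<in> cochains X m" for x
    using F that unfolding graded_map_def n by blast
  have 2: "F (diff X x) \<in> coboundaries Y n" if "x \<in> cochains X (m - 1)" for x
  proof -
    have "F x \<in> cochains Y (m - 1 + e)"
      using F that unfolding graded_map_def by blast
    then show ?thesis
      using d[OF that] unfolding coboundaries_def n by (simp add: algebra_simps)
  qed
  show ?thesis
    unfolding induces_coh_map_def
    using 1 2 d[of _ m] F0 F[unfolded graded_map_def] by force
qed

lemma chain_map_induces:
  "cochain_complex X \<Longrightarrow> cochain_complex Y \<Longrightarrow> chain_map X Y F \<Longrightarrow> induces_coh_map X n Y n F"
  by (rule graded_map_induces[of X Y 0 F]) (auto simp: chain_map_def)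

lemma coh_scal_class:
  assumes "cochain_complex X" "x \<in> cochains X n" "diff X x = 0"
  shows "coh_scal X n k (coh_class X n x) = coh_class X n (cscal X k x)"
proof -
  interpret cochain_complex X by fact
  have "induces_coh_map X n X n (cscal X k)"
    unfolding induces_coh_map_def coboundaries_def
    using scal_cochain diff_scal[symmetric] scal_zero scal_add[of _ n]
    by (auto simp: diff_scal[of _ n])
  then show ?thesis
    unfolding coh_scal_def using coh_map_class[OF assms(1,1)] assms(2,3) by blast
qed

lemma klinear_coh_map:
  assumes X: "cochain_complex X" and Y: "cochain_complex Y" and F: "induces_coh_map X m Y n F"
    and s: "\<And>k x. x \<in> cochains X m \<Longrightarrow> diff X x = 0 \<Longrightarrow> F (cscal X k x) = cscal Y k (F x)"
  shows "klinear_hom (coh_scal X m) (coh X m) (coh_scal Y n) (coh Y n) (coh_map Y n F)"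
proof -
  interpret X: cochain_complex X by fact
  interpret Y: cochain_complex Y by fact
  note cl = coh_map_class[OF X Y F]
  have Fx: "F x \<in> cochains Y n" "diff Y (F x) = 0" if "x \<in> cochains X m" "diff X x = 0" for x
    using F that unfolding induces_coh_map_def by auto
  have Fa: "F (x + y) = F x + F y" if "x \<in> cochains X m" "diff X x = 0" "y \<in> cochains X m" "diff X y = 0" for x y
    using F that unfolding induces_coh_map_def by auto
  show ?thesis
    unfolding klinear_hom_def hom_def
    by (auto simp: X.carrier_coh Y.carrier_coh cl Fx X.mult_coh Y.mult_coh X.add_cochain X.diff_add[where n=m]
        Fa coh_scal_class[OF X] coh_scal_class[OF Y] X.scal_cochain X.diff_scal X.scal_zero s)
qed

definition klinear_iso ::
  "('k \<Rightarrow> 'g \<Rightarrow> 'g) \<Rightarrow> 'g monoid \<Rightarrow> ('k \<Rightarrow> 'h \<Rightarrow> 'h) \<Rightarrow> 'h monoid \<Rightarrow> ('g \<Rightarrow> 'h) \<Rightarrow> bool" where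
  "klinear_iso sG G sH H f \<longleftrightarrow> klinear_hom sG G sH H f \<and> bij_betw f (carrier G) (carrier H)"

lemma klinear_iso_one:
  assumes "klinear_iso sG G sH H f" "group G" "group H" "x \<in> carrier G"
  shows "f x = \<one>\<^bsub>H\<^esub> \<longleftrightarrow> x = \<one>\<^bsub>G\<^esub>"
proof -
  have "f \<in> hom G H" and i: "inj_on f (carrier G)"
    using assms(1) unfolding klinear_iso_def klinear_hom_def bij_betw_def by auto
  then have "f \<one>\<^bsub>G\<^esub> = \<one>\<^bsub>H\<^esub>"
    using hom_one assms(2,3) by blast
  then show ?thesis
    using inj_on_eq_iff[OF i assms(4), of "\<one>\<^bsub>G\<^esub>"] assms(2) by (auto simp: group.is_monoid)
qed

text \<open>Since \<open>\<alpha>\<close> is onto, \<open>f'\<close> is determined on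
  \<open>G'\<close> by its values at \<open>\<alpha> x\<close>. Closure of \<open>carrier G\<close>
  under scalars is asked separately because the scalar action is a bare function and
  \<open>f'\<close> is controlled only at images of carrier elements.\<close>

lemma klinear_hom_transport:
  assumes a: "klinear_iso sG G sG' G' \<alpha>" and b: "klinear_iso sH H sH' H' \<beta>"
    and f: "klinear_hom sG G sH H f" and G: "group G"
    and s: "\<And>k x. x \<in> carrier G \<Longrightarrow> sG k x \<in> carrier G"
    and f': "\<And>x. x \<in> carrier G \<Longrightarrow> f' (\<alpha> x) = \<beta> (f x)"
  shows "klinear_hom sG' G' sH' H' f'"
proof -
  interpret G: group G by fact
  have A: "carrier G' = \<alpha> ` carrier G" "\<And>x y. x \<in> carrier G \<Longrightarrow> y \<in> carrier G \<Longrightarrow> \<alpha> x \<otimes>\<^bsub>G'\<^esub> \<alpha> y = \<alpha> (x \<otimes>\<^bsub>G\<^esub> y)"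
    "\<And>k x. x \<in> carrier G \<Longrightarrow> sG' k (\<alpha> x) = \<alpha> (sG k x)"
    using a by (auto simp: klinear_iso_def klinear_hom_def hom_def bij_betw_def)
  have B: "\<And>x. x \<in> carrier H \<Longrightarrow> \<beta> x \<in> carrier H'"
    "\<And>x y. x \<in> carrier H \<Longrightarrow> y \<in> carrier H \<Longrightarrow> \<beta> (x \<otimes>\<^bsub>H\<^esub> y) = \<beta> x \<otimes>\<^bsub>H'\<^esub> \<beta> y"
    "\<And>k x. x \<in> carrier H \<Longrightarrow> \<beta> (sH k x) = sH' k (\<beta> x)"
    using b by (auto simp: klinear_iso_def klinear_hom_def hom_def)
  have F: "\<And>x. x \<in> carrier G \<Longrightarrow> f x \<in> carrier H"
    "\<And>x y. x \<in> carrier G \<Longrightarrow> y \<in> carrier G \<Longrightarrow> f (x \<otimes>\<^bsub>G\<^esub> y) = f x \<otimes>\<^bsub>H\<^esub> f y"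
    "\<And>k x. x \<in> carrier G \<Longrightarrow> f (sG k x) = sH k (f x)"
    using f by (auto simp: klinear_hom_def hom_def)
  show ?thesis
    unfolding klinear_hom_def hom_def by (auto simp: A B F f' s)
qed

lemma klinear_iso_kernel:
  assumes "klinear_iso sG G sG' G' \<alpha>" "klinear_iso sH H sH' H' \<beta>" "group H" "group H'"
    and "f ` carrier G \<subseteq> carrier H"
    and "\<And>x. x \<in> carrier G \<Longrightarrow> f' (\<alpha> x) = \<beta> (f x)"
  shows "kernel G' H' f' = \<alpha> ` kernel G H f"
proof -
  have "carrier G' = \<alpha> ` carrier G"
    using assms(1) by (simp add: klinear_iso_def bij_betw_def)
  moreover have "f' (\<alpha> x) = \<one>\<^bsub>H'\<^esub> \<longleftrightarrow> f x = \<one>\<^bsub>H\<^esub>" if "x \<in> carrier G" for x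
    using klinear_iso_one[OF assms(2,3,4)] assms(5,6) that by auto
  ultimately show ?thesis by (auto simp: kernel_def)
qed

lemma coh_scal_closed:
  "cochain_complex X \<Longrightarrow> c \<in> carrier (coh X n) \<Longrightarrow> coh_scal X n k c \<in> carrier (coh X n)"
  by (auto simp: cochain_complex.carrier_coh coh_scal_class cochain_complex.scal_cochain
      cochain_complex.diff_scal cochain_complex.scal_zero)

lemma (in cochain_complex) homotopic_coh_class:
  assumes "homotopic X X F G" and x: "x \<in> cochains X n" "diff X x = 0"
  shows "coh_class X n (F x) = coh_class X n (G x)"
proof -
  obtain h where h: "graded_map X X (-1) h"
    and e: "\<And>n x. x \<in> cochains X n \<Longrightarrow> F x - G x = diff X (h x) + h (diff X x)"
    using assms(1) unfolding homotopic_def by auto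
  have "h 0 = 0"
    using additive_zero[of 0 h] h unfolding graded_map_def by blast
  moreover have "h x \<in> cochains X (n - 1)"
    using h x unfolding graded_map_def by fastforce
  ultimately show ?thesis
    using e[OF x(1)] x by (simp add: coh_class_eq_iff coboundaries_def)
qed

lemma homotopy_equiv_coh_iso:
  assumes X: "cochain_complex X" and Y: "cochain_complex Y" and F: "homotopy_equiv X Y F"
  shows "klinear_iso (coh_scal X n) (coh X n) (coh_scal Y n) (coh Y n) (coh_map Y n F)"
proof -
  interpret X: cochain_complex X by fact
  interpret Y: cochain_complex Y by fact
  obtain G where cF: "chain_map X Y F" and cG: "chain_map Y X G"
    and hX: "homotopic X X (G \<circ> F) id" and hY: "homotopic Y Y (F \<circ> G) id"
    using F unfolding homotopy_equiv_def by blast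
  have iF: "induces_coh_map X n Y n F" and iG: "induces_coh_map Y n X n G"
    using chain_map_induces X Y cF cG by blast+
  have hom: "klinear_hom (coh_scal X n) (coh X n) (coh_scal Y n) (coh Y n) (coh_map Y n F)"
    by (rule klinear_coh_map[OF X Y iF])
      (use cF in \<open>auto simp: chain_map_def graded_map_def\<close>)
  have cl: "coh_map Y n F (coh_class X n x) = coh_class Y n (F x)"
      "F x \<in> cochains Y n" "diff Y (F x) = 0" if "x \<in> cochains X n" "diff X x = 0" for x
    using coh_map_class[OF X Y iF] iF that unfolding induces_coh_map_def by auto
  have cl': "coh_map X n G (coh_class Y n x) = coh_class X n (G x)"
      "G x \<in> cochains X n" "diff X (G x) = 0" if "x \<in> cochains Y n" "diff Y x = 0" for x
    using coh_map_class[OF Y X iG] iG that unfolding induces_coh_map_def by auto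
  have GF: "coh_class X n (G (F x)) = coh_class X n x" if "x \<in> cochains X n" "diff X x = 0" for x
    using X.homotopic_coh_class[OF hX that] by simp
  have FG: "coh_class Y n (F (G x)) = coh_class Y n x" if "x \<in> cochains Y n" "diff Y x = 0" for x
    using Y.homotopic_coh_class[OF hY that] by simp
  have "bij_betw (coh_map Y n F) (carrier (coh X n)) (carrier (coh Y n))"
    by (rule bij_betw_byWitness[where f' = "coh_map X n G"])
      (auto simp: X.carrier_coh Y.carrier_coh cl cl' GF FG)
  with hom show ?thesis by (simp add: klinear_iso_def)
qed

subsection \<open>Products and cones\<close>

lemma cochain_complex_cprod:
  assumes "cochain_complex X" "cochain_complex Y"
  shows "cochain_complex (X \<times>\<^sub>c Y)"
proof -
  interpret X: cochain_complex X by fact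
  interpret Y: cochain_complex Y by fact
  show ?thesis
    by unfold_locales
      (auto simp: cprod_def zero_prod_def X.zero_cochain Y.zero_cochain X.add_cochain Y.add_cochain
        X.minus_cochain Y.minus_cochain X.diff_cochain Y.diff_cochain X.diff_add Y.diff_add
        X.diff_diff Y.diff_diff X.scal_cochain Y.scal_cochain X.scal_add Y.scal_add X.diff_scal Y.diff_scal)
qed

lemma coboundaries_cprod: "coboundaries (X \<times>\<^sub>c Y) n = coboundaries X n \<times> coboundaries Y n"
  unfolding coboundaries_def cprod_def by (force simp: image_iff)

lemma cochain_complex_cone:
  assumes "cochain_complex X" "cochain_complex Y" and F: "chain_map X Y F"
  shows "cochain_complex (cone X Y F)"
proof -
  interpret X: cochain_complex X by fact
  interpret Y: cochain_complex Y by fact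
  have Fc: "F x \<in> cochains Y n" if "x \<in> cochains X n" for x n
    using F that by (auto simp: chain_map_def graded_map_def)
  have Fa: "F (x + x') = F x + F x'" if "x \<in> cochains X n" "x' \<in> cochains X n" for x x' n
    using F that by (auto simp: chain_map_def graded_map_def)
  have Fs: "F (cscal X k x) = cscal Y k (F x)" if "x \<in> cochains X n" for k x n
    using F that by (auto simp: chain_map_def graded_map_def)
  have Fd: "F (diff X x) = diff Y (F x)" if "x \<in> cochains X n" for x n
    using F that by (auto simp: chain_map_def)
  have dY: "diff Y x \<in> cochains Y n" if "x \<in> cochains Y (n - 1)" for x n
    using Y.diff_cochain[OF that] by simp
  show ?thesis
  proof
    fix n x assume "x \<in> cochains (cone X Y F) n"
    then show "diff (cone X Y F) (diff (cone X Y F) x) = 0"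
      by (auto simp: cone_def Fd X.diff_diff zero_prod_def Y.diff_sub[where n=n] Fc dY Y.diff_diff)
  next
    fix n x y assume "x \<in> cochains (cone X Y F) n" "y \<in> cochains (cone X Y F) n"
    then show "diff (cone X Y F) (x + y) = diff (cone X Y F) x + diff (cone X Y F) y"
      by (auto simp: cone_def X.diff_add Y.diff_add Fa algebra_simps)
  next
    fix n k x assume "x \<in> cochains (cone X Y F) n"
    then show "diff (cone X Y F) (cscal (cone X Y F) k x) = cscal (cone X Y F) k (diff (cone X Y F) x)"
      using Y.additive_diff[of n "cscal Y k"] Y.scal_add
      by (auto simp: cone_def X.diff_scal Y.diff_scal Fs Fc dY)
  qed (auto simp: cone_def zero_prod_def X.zero_cochain Y.zero_cochain X.add_cochain Y.add_cochain
        X.minus_cochain Y.minus_cochain X.diff_cochain Y.sub_cochain Fc dY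
        X.scal_cochain Y.scal_cochain X.scal_add Y.scal_add)
qed

text \<open>If \<open>F\<close> has a section \<open>\<sigma>\<close> in each degree, then \<open>(x, y) \<mapsto> (\<sigma> y, 0)\<close> is a homotopy from the
  identity of the cone to a projection onto the kernel of \<open>F\<close>.\<close>

definition cone_retract ::
  "('k, 'x::ab_group_add) complex \<Rightarrow> ('k, 'y::ab_group_add) complex \<Rightarrow> ('x \<Rightarrow> 'y) \<Rightarrow> ('y \<Rightarrow> 'x) \<Rightarrow> 'x \<times> 'y \<Rightarrow> 'x" where
  "cone_retract X Y F \<sigma> = (\<lambda>(x, y). x - \<sigma> (F x) - diff X (\<sigma> y) + \<sigma> (diff Y y))"

text \<open>The section is additive and linear but need not commute with the differentials: the last
  two terms of \<open>cone_retract\<close> are exactly its failure to do so.\<close>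

locale split_chain_map = X: cochain_complex X + Y: cochain_complex Y
  for X :: "('k, 'x::ab_group_add) complex" and Y :: "('k, 'y::ab_group_add) complex" +
  fixes F :: "'x \<Rightarrow> 'y" and \<sigma> :: "'y \<Rightarrow> 'x"
  assumes chain: "chain_map X Y F"
    and section_graded: "graded_map Y X 0 \<sigma>"
    and F_section: "\<And>n y. y \<in> cochains Y n \<Longrightarrow> F (\<sigma> y) = y"
begin

lemma F_cochain: "x \<in> cochains X n \<Longrightarrow> F x \<in> cochains Y n"
  and F_add: "x \<in> cochains X n \<Longrightarrow> x' \<in> cochains X n \<Longrightarrow> F (x + x') = F x + F x'"
  and F_scal: "x \<in> cochains X n \<Longrightarrow> F (cscal X k x) = cscal Y k (F x)"
  and F_diff: "x \<in> cochains X n \<Longrightarrow> F (diff X x) = diff Y (F x)"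
  using chain by (auto simp: chain_map_def graded_map_def)

lemma F_sub: "x \<in> cochains X n \<Longrightarrow> x' \<in> cochains X n \<Longrightarrow> F (x - x') = F x - F x'"
  by (rule X.additive_diff[of n]) (auto intro: F_add)

lemma s_cochain: "y \<in> cochains Y n \<Longrightarrow> \<sigma> y \<in> cochains X n"
  and s_add: "y \<in> cochains Y n \<Longrightarrow> y' \<in> cochains Y n \<Longrightarrow> \<sigma> (y + y') = \<sigma> y + \<sigma> y'"
  and s_scal: "y \<in> cochains Y n \<Longrightarrow> \<sigma> (cscal Y k y) = cscal X k (\<sigma> y)"
  using section_graded by (auto simp: graded_map_def)

lemma s_sub: "y \<in> cochains Y n \<Longrightarrow> y' \<in> cochains Y n \<Longrightarrow> \<sigma> (y - y') = \<sigma> y - \<sigma> y'"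
  by (rule Y.additive_diff[of n]) (auto intro: s_add)

lemma s_zero: "\<sigma> 0 = 0"
  by (rule Y.additive_zero[of 0]) (auto intro: s_add)

lemma diffX: "x \<in> cochains X (n - 1) \<Longrightarrow> diff X x \<in> cochains X n"
  using X.diff_cochain[of x "n - 1"] by simp

lemma diffY: "x \<in> cochains Y (n - 1) \<Longrightarrow> diff Y x \<in> cochains Y n"
  using Y.diff_cochain[of x "n - 1"] by simp

abbreviation "ret \<equiv> cone_retract X Y F \<sigma>"

lemma retract_cochain: "z \<in> cochains (cone X Y F) n \<Longrightarrow> ret z \<in> cochains X n"
  by (auto simp: cone_def cone_retract_def intro!: X.add_cochain X.sub_cochain s_cochain F_cochain diffX diffY)

lemma F_retract: "z \<in> cochains (cone X Y F) n \<Longrightarrow> F (ret z) = 0"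
  by (auto simp: cone_def cone_retract_def F_add[where n=n] F_sub[where n=n] F_diff[where n="n-1"]
      F_section[where n=n] F_section[where n="n-1"] X.sub_cochain s_cochain F_cochain diffX diffY)

text \<open>With D the differential of the cone and h the map
  \<open>(x, y) \<mapsto> (\<sigma> y, 0)\<close>, the retraction is the identity minus D h + h D,
  which commutes with D; this is checked here on the component that survives.\<close>

lemma retract_diff:
  assumes "z \<in> cochains (cone X Y F) n"
  shows "ret (diff (cone X Y F) z) = diff X (ret z)"
proof -
  obtain x y where z: "z = (x, y)" "x \<in> cochains X n" "y \<in> cochains Y (n - 1)"
    using assms by (auto simp: cone_def)
  have 1: "F (diff X x) = diff Y (F x)" using z F_diff by blast
  have 2: "\<sigma> (F x - diff Y y) = \<sigma> (F x) - \<sigma> (diff Y y)"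
    using s_sub[of "F x" n] F_cochain z diffY by blast
  have 3: "diff X (\<sigma> (F x) - \<sigma> (diff Y y)) = diff X (\<sigma> (F x)) - diff X (\<sigma> (diff Y y))"
    using X.diff_sub[of _ n] s_cochain F_cochain z diffY by blast
  have 4: "diff Y (F x - diff Y y) = diff Y (F x)"
    using Y.diff_sub[of "F x" n "diff Y y"] F_cochain z diffY Y.diff_diff by auto
  have m: "\<sigma> (F x) \<in> cochains X n" "\<sigma> (diff Y y) \<in> cochains X n" "diff X (\<sigma> y) \<in> cochains X n"
    using z s_cochain F_cochain diffX diffY by auto
  have 5: "diff X (x - \<sigma> (F x) - diff X (\<sigma> y) + \<sigma> (diff Y y)) =
     diff X x - diff X (\<sigma> (F x)) - diff X (diff X (\<sigma> y)) + diff X (\<sigma> (diff Y y))"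
    using m z by (simp add: X.diff_add[where n=n] X.diff_sub[where n=n] X.sub_cochain)
  have 6: "diff X (diff X (\<sigma> y)) = 0"
    using X.diff_diff s_cochain z by blast
  show ?thesis
    by (simp add: z cone_def cone_retract_def 1 2 3 4 5 6)
qed

lemma retract_homotopy:
  assumes "(x, y) \<in> cochains (cone X Y F) n"
  shows "(ret (x, y), 0) = (x, y) - diff (cone X Y F) (\<sigma> y, 0) - (\<sigma> (snd (diff (cone X Y F) (x, y))), 0)"
proof -
  have z: "x \<in> cochains X n" "y \<in> cochains Y (n - 1)"
    using assms by (auto simp: cone_def)
  have 2: "\<sigma> (F x - diff Y y) = \<sigma> (F x) - \<sigma> (diff Y y)"
    using s_sub[of "F x" n] F_cochain z diffY by blast
  show ?thesis
    using z by (simp add: cone_def cone_retract_def 2 F_section Y.diff_zero algebra_simps)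
qed

lemma retract_kernel: "F x = 0 \<Longrightarrow> ret (x, 0) = x"
  by (simp add: cone_retract_def s_zero X.diff_zero Y.diff_zero)

lemma retract_graded: "graded_map (cone X Y F) X 0 ret"
  unfolding graded_map_def
proof (intro conjI allI ballI)
  fix n show "ret ` cochains (cone X Y F) n \<subseteq> cochains X (n + 0)"
    using retract_cochain by auto
next
  fix n z w assume "z \<in> cochains (cone X Y F) n" "w \<in> cochains (cone X Y F) n"
  then show "ret (z + w) = ret z + ret w"
    by (auto simp: cone_def cone_retract_def F_add[where n=n] s_add[where n=n] s_add[where n="n-1"]
        F_cochain diffY Y.diff_add[where n="n-1"] X.diff_add[where n="n-1"] s_cochain algebra_simps)
next
  fix n k z assume "z \<in> cochains (cone X Y F) n"
  then obtain x y where z: "z = (x, y)" "x \<in> cochains X n" "y \<in> cochains Y (n - 1)"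
    by (auto simp: cone_def)
  have m: "\<sigma> (F x) \<in> cochains X n" "\<sigma> (diff Y y) \<in> cochains X n" "diff X (\<sigma> y) \<in> cochains X n"
    using z s_cochain F_cochain diffX diffY by auto
  have ss: "cscal X k (u - v) = cscal X k u - cscal X k v"
    if "u \<in> cochains X n" "v \<in> cochains X n" for u v
    by (rule X.additive_diff[of n]) (auto intro: X.scal_add that)
  have e1: "\<sigma> (F (cscal X k x)) = cscal X k (\<sigma> (F x))"
    using z(2) by (simp add: F_scal[where n=n] s_scal[where n=n] F_cochain)
  have e2: "diff X (\<sigma> (cscal Y k y)) = cscal X k (diff X (\<sigma> y))"
    using z(3) by (simp add: s_scal[where n="n-1"] X.diff_scal[where n="n-1"] s_cochain)
  have e3: "\<sigma> (diff Y (cscal Y k y)) = cscal X k (\<sigma> (diff Y y))"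
    using z(3) by (simp add: Y.diff_scal[where n="n-1"] s_scal[where n=n] diffY)
  show "ret (cscal (cone X Y F) k z) = cscal X k (ret z)"
    using m z by (simp add: cone_def cone_retract_def e1 e2 e3 ss X.scal_add[where n=n] X.sub_cochain)
qed

end

subsection \<open>The long exact sequence of a degreewise split sequence\<close>

text \<open>\<open>Z\<close> stands for a retract up to homotopy of the kernel of \<open>p\<close>,
  not for the kernel itself, and \<open>j\<close> raises the degree by one. So \<open>\<rho>\<close>
  commutes with differentials on the kernel only, while its additivity is needed everywhere because
  it is applied to differentials of arbitrary lifts. \<open>j_\<rho>\<close> is what the homotopy
  says about cocycles; its correction \<open>y\<close> lies in the kernel of \<open>p\<close>, so
  subtracting it from a lift leaves a lift.\<close>

locale split_sequence = Z: cochain_complex Z + X: cochain_complex X + Y: cochain_complex Y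
  for Z :: "('k, 'z::ab_group_add) complex" and X :: "('k, 'x::ab_group_add) complex"
    and Y :: "('k, 'y::ab_group_add) complex" +
  fixes j :: "'z \<Rightarrow> 'x" and p :: "'x \<Rightarrow> 'y" and s :: "'y \<Rightarrow> 'x" and \<rho> :: "'x \<Rightarrow> 'z"
  assumes p: "chain_map X Y p"
    and s: "graded_map Y X 0 s" and p_s: "\<And>n y. y \<in> cochains Y n \<Longrightarrow> p (s y) = y"
    and j: "graded_map Z X 1 j"
    and j_diff: "\<And>n z. z \<in> cochains Z n \<Longrightarrow> j (diff Z z) = diff X (j z)"
    and p_j: "\<And>n z. z \<in> cochains Z n \<Longrightarrow> p (j z) = 0"
    and \<rho>_cochain: "\<And>n x. x \<in> cochains X n \<Longrightarrow> p x = 0 \<Longrightarrow> \<rho> x \<in> cochains Z (n - 1)"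
    and \<rho>_add: "\<And>n x y. x \<in> cochains X n \<Longrightarrow> y \<in> cochains X n \<Longrightarrow> \<rho> (x + y) = \<rho> x + \<rho> y"
    and \<rho>_scal: "\<And>n k x. x \<in> cochains X n \<Longrightarrow> \<rho> (cscal X k x) = cscal Z k (\<rho> x)"
    and \<rho>_diff: "\<And>n x. x \<in> cochains X n \<Longrightarrow> p x = 0 \<Longrightarrow> \<rho> (diff X x) = diff Z (\<rho> x)"
    and \<rho>_j: "\<And>n z. z \<in> cochains Z n \<Longrightarrow> \<rho> (j z) = z"
    and j_\<rho>: "\<And>n x. x \<in> cochains X n \<Longrightarrow> p x = 0 \<Longrightarrow> diff X x = 0 \<Longrightarrow>
      \<exists>y\<in>cochains X (n - 1). p y = 0 \<and> x = j (\<rho> x) + diff X y"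
begin

definition \<delta> where "\<delta> y = \<rho> (diff X (s y))"

lemma p_cochain: "x \<in> cochains X n \<Longrightarrow> p x \<in> cochains Y n"
  and p_add: "x \<in> cochains X n \<Longrightarrow> x' \<in> cochains X n \<Longrightarrow> p (x + x') = p x + p x'"
  and p_scal: "x \<in> cochains X n \<Longrightarrow> p (cscal X k x) = cscal Y k (p x)"
  and p_diff: "x \<in> cochains X n \<Longrightarrow> p (diff X x) = diff Y (p x)"
  using p by (auto simp: chain_map_def graded_map_def)

lemma p_sub: "x \<in> cochains X n \<Longrightarrow> x' \<in> cochains X n \<Longrightarrow> p (x - x') = p x - p x'"
  by (rule X.additive_diff[of n]) (auto intro: p_add)

lemma s_cochain: "y \<in> cochains Y n \<Longrightarrow> s y \<in> cochains X n"
  and s_add: "y \<in> cochains Y n \<Longrightarrow> y' \<in> cochains Y n \<Longrightarrow> s (y + y') = s y + s y'"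
  and s_scal: "y \<in> cochains Y n \<Longrightarrow> s (cscal Y k y) = cscal X k (s y)"
  using s by (auto simp: graded_map_def)

lemma j_cochain: "z \<in> cochains Z (n - 1) \<Longrightarrow> j z \<in> cochains X n"
  using j unfolding graded_map_def by (metis diff_add_cancel image_subset_iff)

lemma \<rho>_sub: "x \<in> cochains X n \<Longrightarrow> x' \<in> cochains X n \<Longrightarrow> \<rho> (x - x') = \<rho> x - \<rho> x'"
  by (rule X.additive_diff[of n]) (auto intro: \<rho>_add)

lemma \<rho>_zero: "\<rho> 0 = 0"
  by (rule X.additive_zero[of 0]) (auto intro: \<rho>_add)

lemma diff_s: "y \<in> cochains Y n \<Longrightarrow> diff X (s y) \<in> cochains X (n + 1)"
  by (simp add: X.diff_cochain s_cochain)

lemma p_diff_s: "y \<in> cochains Y n \<Longrightarrow> diff Y y = 0 \<Longrightarrow> p (diff X (s y)) = 0"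
  by (simp add: p_diff[OF s_cochain] p_s)

lemma p_induces: "induces_coh_map X n Y n p"
  by (rule chain_map_induces[OF X.cochain_complex_axioms Y.cochain_complex_axioms p])

lemma j_induces: "induces_coh_map Z (n - 1) X n j"
  by (rule graded_map_induces[OF Z.cochain_complex_axioms X.cochain_complex_axioms j])
    (auto intro: j_diff)

lemma \<delta>_cocycle:
  assumes "y \<in> cochains Y n" "diff Y y = 0"
  shows "\<delta> y \<in> cochains Z n" "diff Z (\<delta> y) = 0"
  using \<rho>_cochain[OF diff_s p_diff_s, of y n] \<rho>_diff[OF diff_s p_diff_s, of y n] assms
    X.diff_diff[OF s_cochain, of y n]
  by (auto simp: \<delta>_def \<rho>_zero)

lemma \<rho>_diff_coboundary:
  assumes "x \<in> cochains X n" "p x = 0"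
  shows "\<rho> (diff X x) \<in> coboundaries Z n"
  using \<rho>_diff[OF assms] \<rho>_cochain[OF assms] by (auto simp: coboundaries_def)

text \<open>\<open>x\<close> and \<open>s (p x)\<close> lift the same cochain, so they differ by an
  element of the kernel of \<open>p\<close>, where \<open>\<rho>\<close> commutes with
  differentials: up to coboundaries any lift may replace \<open>s\<close>. This is used with
  \<open>x = diff X (s y)\<close> for well-definedness, with a cocycle \<open>x\<close> to see that
  the connecting morphism kills the image of \<open>p\<close>, and with
  \<open>diff X x = j z\<close> for exactness at \<open>Z\<close>.\<close>

lemma \<delta>_p:
  assumes x: "x \<in> cochains X n"
  shows "\<delta> (p x) - \<rho> (diff X x) \<in> coboundaries Z n"
proof -
  have m: "s (p x) \<in> cochains X n"
    using x by (simp add: s_cochain p_cochain)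
  have "p (s (p x) - x) = 0"
    using x m by (simp add: p_sub[OF m x] p_s[OF p_cochain])
  then have "\<rho> (diff X (s (p x) - x)) \<in> coboundaries Z n"
    using \<rho>_diff_coboundary X.sub_cochain[OF m x] by blast
  then show ?thesis
    using \<rho>_sub[OF X.diff_cochain[OF m] X.diff_cochain[OF x]] by (simp add: \<delta>_def X.diff_sub[OF m x])
qed

lemma \<delta>_induces: "induces_coh_map Y n Z n \<delta>"
proof -
  have "\<delta> (diff Y y) \<in> coboundaries Z n" if y: "y \<in> cochains Y (n - 1)" for y
  proof -
    have "diff X (s y) \<in> cochains X n"
      using diff_s[OF y] by simp
    from \<delta>_p[OF this] show ?thesis
      by (simp add: p_diff[OF s_cochain[OF y]] p_s[OF y] X.diff_diff[OF s_cochain[OF y]] \<rho>_zero)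
  qed
  then show ?thesis
    unfolding induces_coh_map_def
    by (auto simp: \<delta>_cocycle) (auto simp: \<delta>_def s_add[where n=n] X.diff_add[where n=n] s_cochain
        \<rho>_add[where n="n+1"] X.diff_cochain)
qed

abbreviation "l n \<equiv> coh_map X n j"
abbreviation "r n \<equiv> coh_map Y n p"
abbreviation "d n \<equiv> coh_map Z n \<delta>"

lemmas l_class = coh_map_class[OF Z.cochain_complex_axioms X.cochain_complex_axioms j_induces]
lemmas r_class = coh_map_class[OF X.cochain_complex_axioms Y.cochain_complex_axioms p_induces]
lemmas d_class = coh_map_class[OF Y.cochain_complex_axioms Z.cochain_complex_axioms \<delta>_induces]

lemma l_klinear: "klinear_hom (coh_scal Z (n - 1)) (coh Z (n - 1)) (coh_scal X n) (coh X n) (l n)"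
  by (rule klinear_coh_map[OF Z.cochain_complex_axioms X.cochain_complex_axioms j_induces])
    (use j in \<open>auto simp: graded_map_def\<close>)

lemma r_klinear: "klinear_hom (coh_scal X n) (coh X n) (coh_scal Y n) (coh Y n) (r n)"
  by (rule klinear_coh_map[OF X.cochain_complex_axioms Y.cochain_complex_axioms p_induces])
    (auto intro: p_scal)

lemma d_klinear: "klinear_hom (coh_scal Y n) (coh Y n) (coh_scal Z n) (coh Z n) (d n)"
  by (rule klinear_coh_map[OF Y.cochain_complex_axioms Z.cochain_complex_axioms \<delta>_induces])
    (simp add: \<delta>_def s_scal X.diff_scal[OF s_cochain] \<rho>_scal[OF diff_s])

lemma exact_X: "kernel (coh X n) (coh Y n) (r n) = l n ` carrier (coh Z (n - 1))"
proof (intro subset_antisym subsetI)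
  fix c assume "c \<in> kernel (coh X n) (coh Y n) (r n)"
  then obtain x where x: "x \<in> cochains X n" "diff X x = 0" "c = coh_class X n x"
    and b: "p x \<in> coboundaries Y n"
    by (auto simp: kernel_def X.carrier_coh r_class Y.coh_class_eq_one)
  then obtain y where y: "y \<in> cochains Y (n - 1)" "p x = diff Y y"
    by (auto simp: coboundaries_def)
  have m: "s y \<in> cochains X (n - 1)" "diff X (s y) \<in> cochains X n"
    using y s_cochain diff_s[of y "n - 1"] by auto
  \<comment> \<open>\<open>p x\<close> is the coboundary of \<open>y\<close>, and
    \<open>diff X (s y)\<close> has the same image under \<open>p\<close>; subtracting it moves
    \<open>x\<close> within its class into the kernel of \<open>p\<close>.\<close>
  have k: "x - diff X (s y) \<in> cochains X n" "p (x - diff X (s y)) = 0" "diff X (x - diff X (s y)) = 0"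
    using x m y by (auto simp: X.sub_cochain p_sub[OF x(1) m(2)] p_diff[OF m(1)] p_s X.diff_sub[OF x(1) m(2)]
        X.diff_diff[OF m(1)])
  obtain w where w: "w \<in> cochains X (n - 1)" "x - diff X (s y) = j (\<rho> (x - diff X (s y))) + diff X w"
    using j_\<rho>[OF k] by blast
  let ?z = "\<rho> (x - diff X (s y))"
  have z: "?z \<in> cochains Z (n - 1)" "diff Z ?z = 0"
    using \<rho>_cochain[OF k(1,2)] \<rho>_diff[OF k(1,2)] k(3) \<rho>_zero by auto
  have "x - j ?z = diff X (s y + w)"
    using w(2) unfolding X.diff_add[OF m(1) w(1)] by (simp add: algebra_simps)
  then have "coh_class X n x = coh_class X n (j ?z)"
    using X.add_cochain[OF m(1) w(1)] by (auto simp: X.coh_class_eq_iff coboundaries_def)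
  then show "c \<in> l n ` carrier (coh Z (n - 1))"
    using l_class[OF z] x(3) Z.coh_class_carrier[OF z] by force
next
  fix c assume "c \<in> l n ` carrier (coh Z (n - 1))"
  then obtain z where z: "z \<in> cochains Z (n - 1)" "diff Z z = 0" "c = coh_class X n (j z)"
    by (auto simp: Z.carrier_coh l_class)
  have jz: "j z \<in> cochains X n" "diff X (j z) = 0"
    using z j_induces[of n] by (auto simp: induces_coh_map_def)
  show "c \<in> kernel (coh X n) (coh Y n) (r n)"
    by (simp add: kernel_def z(3) X.coh_class_carrier jz r_class Y.coh_class_eq_one p_j[OF z(1)]
        Y.zero_coboundary)
qed

lemma exact_Y: "kernel (coh Y n) (coh Z n) (d n) = r n ` carrier (coh X n)"
proof (intro subset_antisym subsetI)
  fix c assume "c \<in> kernel (coh Y n) (coh Z n) (d n)"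
  then obtain y where y: "y \<in> cochains Y n" "diff Y y = 0" "c = coh_class Y n y"
    and b: "\<delta> y \<in> coboundaries Z n"
    by (auto simp: kernel_def Y.carrier_coh d_class Z.coh_class_eq_one)
  then obtain z where z: "z \<in> cochains Z (n - 1)" "\<delta> y = diff Z z"
    by (auto simp: coboundaries_def)
  have sy: "s y \<in> cochains X n" using y s_cochain by blast
  obtain w where w: "w \<in> cochains X n" "p w = 0" "diff X (s y) = j (\<rho> (diff X (s y))) + diff X w"
    using j_\<rho>[OF diff_s p_diff_s, of y n] y X.diff_diff[OF sy] by auto
  have jz: "j z \<in> cochains X n" by (rule j_cochain[OF z(1)])
  \<comment> \<open>\<open>s y\<close> lifts \<open>y\<close> but need not be closed: its
    differential is that of \<open>j z + w\<close>. Subtracting \<open>j z\<close> and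
    \<open>w\<close>, both killed by \<open>p\<close>, closes the lift without changing its
    image.\<close>
  let ?x = "s y - j z - w"
  have x: "?x \<in> cochains X n" using sy jz w X.sub_cochain by blast
  have "diff X (s y) = diff X (j z) + diff X w"
    using w(3) z by (simp add: \<delta>_def j_diff)
  then have dx: "diff X ?x = 0"
    by (simp add: X.diff_sub[OF X.sub_cochain[OF sy jz] w(1)] X.diff_sub[OF sy jz])
  have px: "p ?x = y"
    by (simp add: p_sub[OF X.sub_cochain[OF sy jz] w(1)] p_sub[OF sy jz] w(2) p_j[OF z(1)] p_s[OF y(1)])
  show "c \<in> r n ` carrier (coh X n)"
    using r_class[OF x dx] px y(3) X.coh_class_carrier[OF x dx] by force
next
  fix c assume "c \<in> r n ` carrier (coh X n)"
  then obtain x where x: "x \<in> cochains X n" "diff X x = 0" "c = coh_class Y n (p x)"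
    by (auto simp: X.carrier_coh r_class)
  have px: "p x \<in> cochains Y n" "diff Y (p x) = 0"
    using x p_induces[of n] by (auto simp: induces_coh_map_def)
  have "\<delta> (p x) \<in> coboundaries Z n"
    using \<delta>_p[OF x(1)] by (simp add: x(2) \<rho>_zero)
  then show "c \<in> kernel (coh Y n) (coh Z n) (d n)"
    by (simp add: kernel_def x(3) Y.coh_class_carrier px d_class Z.coh_class_eq_one)
qed

lemma exact_Z: "kernel (coh Z (n - 1)) (coh X n) (l n) = d (n - 1) ` carrier (coh Y (n - 1))"
proof (intro subset_antisym subsetI)
  fix c assume "c \<in> kernel (coh Z (n - 1)) (coh X n) (l n)"
  then obtain z where z: "z \<in> cochains Z (n - 1)" "diff Z z = 0" "c = coh_class Z (n - 1) z"
    and b: "j z \<in> coboundaries X n"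
    by (auto simp: kernel_def Z.carrier_coh l_class X.coh_class_eq_one)
  then obtain x where x: "x \<in> cochains X (n - 1)" "j z = diff X x"
    by (auto simp: coboundaries_def)
  have px: "p x \<in> cochains Y (n - 1)" "diff Y (p x) = 0"
    using p_cochain[OF x(1)] p_diff[OF x(1)] p_j[OF z(1)] x(2) by auto
  \<comment> \<open>Here \<open>diff X x\<close> equals \<open>j z\<close>, and
    \<open>\<rho>\<close> undoes \<open>j\<close>.\<close>
  have "\<delta> (p x) - z \<in> coboundaries Z (n - 1)"
    using \<delta>_p[OF x(1)] \<rho>_j[OF z(1)] x(2) by simp
  then have "coh_class Z (n - 1) (\<delta> (p x)) = c"
    using z(3) by (simp add: Z.coh_class_eq_iff)
  then show "c \<in> d (n - 1) ` carrier (coh Y (n - 1))"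
    using d_class[OF px] Y.coh_class_carrier[OF px] by force
next
  fix c assume "c \<in> d (n - 1) ` carrier (coh Y (n - 1))"
  then obtain y where y: "y \<in> cochains Y (n - 1)" "diff Y y = 0" "c = coh_class Z (n - 1) (\<delta> y)"
    by (auto simp: Y.carrier_coh d_class)
  have sy: "s y \<in> cochains X (n - 1)" using y s_cochain by blast
  have ds: "diff X (s y) \<in> cochains X n" using diff_s[OF y(1)] by simp
  obtain w where w: "w \<in> cochains X (n - 1)" "diff X (s y) = j (\<delta> y) + diff X w"
    using j_\<rho>[OF ds p_diff_s[OF y(1,2)]] X.diff_diff[OF sy] unfolding \<delta>_def by auto
  have "j (\<delta> y) = diff X (s y - w)"
    using w by (simp add: X.diff_sub[OF sy w(1)])
  then have "j (\<delta> y) \<in> coboundaries X n"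
    using X.sub_cochain[OF sy w(1)] by (auto simp: coboundaries_def)
  then show "c \<in> kernel (coh Z (n - 1)) (coh X n) (l n)"
    by (simp add: kernel_def y(3) Z.coh_class_carrier \<delta>_cocycle[OF y(1,2)] l_class X.coh_class_eq_one)
qed

end

section \<open>The bar differential\<close>

locale kalg =
  fixes A :: "('k::{comm_ring,monoid_mult}, 'a::ab_group_add) alg"
  assumes alg: "kalgebra A"
begin

lemma amul_assoc: "amul A (amul A x y) z = amul A x (amul A y z)"
  and amul_one: "amul A (aone A) x = x" "amul A x (aone A) = x"
  and amul_add_left: "amul A (x + y) z = amul A x z + amul A y z"
  and amul_add_right: "amul A x (y + z) = amul A x y + amul A x z"
  and amul_scal_left: "amul A (ascal A k x) y = ascal A k (amul A x y)"
  and amul_scal_right: "amul A x (ascal A k y) = ascal A k (amul A x y)"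
  using alg unfolding kalgebra_def by blast+

lemma ascal_add: "ascal A k (x + y) = ascal A k x + ascal A k y"
  and ascal_commute: "ascal A k (ascal A l x) = ascal A l (ascal A k x)"
  using alg unfolding kalgebra_def kmodule_def by (metis mult.commute)+

lemma amul_zero: "amul A 0 x = 0" "amul A x 0 = 0"
  using amul_add_left[of 0 0 x] amul_add_right[of x 0 0] by auto

lemma ascal_zero: "ascal A k 0 = 0"
  using ascal_add[of k 0 0] by auto

end

lemma altsign_Suc: "altsign (Suc n) v = - altsign n v"
  by (simp add: altsign_def)

lemma altsign_additive:
  fixes h :: "'v::ab_group_add \<Rightarrow> 'w::ab_group_add"
  assumes "\<And>x y. h (x + y) = h x + (h y :: 'w::ab_group_add)"
  shows "h (altsign n v) = altsign n (h v)"
proof -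
  have "h 0 = 0" using assms[of 0 0] by simp
  then have "h (- v) = - h v" using assms[of v "- v"] by (simp add: add_eq_0_iff)
  then show ?thesis by (simp add: altsign_def)
qed

lemma additive_zero:
  fixes h :: "'v::ab_group_add \<Rightarrow> 'w::ab_group_add"
  assumes "\<And>x y. h (x + y) = h x + (h y :: 'w::ab_group_add)"
  shows "h 0 = 0"
  using assms[of 0 0] by simp

lemma additive_uminus:
  fixes h :: "'v::ab_group_add \<Rightarrow> 'w::ab_group_add"
  assumes "\<And>x y. h (x + y) = h x + (h y :: 'w::ab_group_add)"
  shows "h (- v) = - h v"
  using assms[of v "- v"] additive_zero[of h, OF assms] by (simp add: add_eq_0_iff)

lemma additive_minus:
  fixes h :: "'v::ab_group_add \<Rightarrow> 'w::ab_group_add"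
  assumes "\<And>x y. h (x + y) = h x + (h y :: 'w::ab_group_add)"
  shows "h (v - w) = h v - h w"
  using assms[of v "- w"] additive_uminus[of h, OF assms] by simp

lemma bar_diff_Nil [simp]: "bar_diff T f [] = 0"
  and bar_diff_single [simp]: "bar_diff T f [t] = 0"
  by (simp_all add: bar_diff_def)

text \<open>Splitting off the merge of the first two entries shifts the remaining indices by one,
  whence the minus sign. The recursion takes the place of the alternating sum: identities for
  \<open>bar_diff\<close> become inductions on the list with \<open>f\<close> generalised.\<close>

lemma bar_diff_Cons [simp]:
  "bar_diff T f (t # t' # ts) = f (amul T t t' # ts) - bar_diff T (\<lambda>ys. f (t # ys)) (t' # ts)"
  unfolding bar_diff_def
  by (simp add: sum.lessThan_Suc_shift merge_def altsign_Suc sum_negf del: sum.lessThan_Suc)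
    (simp add: altsign_def)

lemma bar_diff_cong:
  assumes "\<And>ys. Suc (length ys) = length xs \<Longrightarrow> ys \<noteq> [] \<Longrightarrow> f ys = g ys"
  shows "bar_diff T f xs = bar_diff T g xs"
  using assms
proof (induction xs arbitrary: f g rule: induct_list012)
  case (3 x y zs)
  have "bar_diff T (\<lambda>ys. f (x # ys)) (y # zs) = bar_diff T (\<lambda>ys. g (x # ys)) (y # zs)"
    by (rule "3.IH"(2)) (simp add: "3.prems")
  then show ?case by (simp add: "3.prems")
qed auto

lemma bar_diff_add: "bar_diff T (\<lambda>xs. f xs + g xs) xs = bar_diff T f xs + bar_diff T g xs"
  by (induction xs arbitrary: f g rule: induct_list012) auto

lemma bar_diff_additive:
  fixes h :: "'v::ab_group_add \<Rightarrow> 'w::ab_group_add"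
  assumes h: "\<And>x y. h (x + y) = h x + (h y :: 'w::ab_group_add)"
  shows "bar_diff T (\<lambda>xs. h (f xs)) xs = h (bar_diff T f xs)"
  by (induction xs arbitrary: f rule: induct_list012)
    (auto simp: additive_zero[of h, OF h] additive_minus[of h, OF h])

lemma bar_diff_zero: "bar_diff T (\<lambda>xs. 0) xs = 0"
  by (induction xs rule: induct_list012) auto

lemma bar_diff_minus: "bar_diff T (\<lambda>xs. f xs - g xs) xs = bar_diff T f xs - bar_diff T g xs"
  by (induction xs arbitrary: f g rule: induct_list012) auto

lemma bar_diff_uminus: "bar_diff T (\<lambda>xs. - f xs) xs = - bar_diff T f xs"
  by (rule bar_diff_additive) simp

lemma bar_diff_altsign: "bar_diff T (\<lambda>xs. altsign n (f xs)) xs = altsign n (bar_diff T f xs)"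
  by (rule bar_diff_additive) (simp add: altsign_def)

lemma bar_diff_apply: "bar_diff T f xs m = bar_diff T (\<lambda>xs. f xs m) xs"
  by (rule bar_diff_additive[where h = "\<lambda>v. v m", symmetric]) simp

lemma bar_diff_commute:
  "bar_diff S (\<lambda>xs. bar_diff T (f xs) ys) xs = bar_diff T (\<lambda>ys. bar_diff S (\<lambda>xs. f xs ys) xs) ys"
proof (induction xs arbitrary: f rule: induct_list012)
  case (3 x y zs)
  then show ?case by (simp add: bar_diff_minus)
qed (auto simp: bar_diff_zero)

lemma bar_diff_bar_diff:
  assumes assoc: "\<And>x y z. amul T (amul T x y) z = amul T x (amul T y z)"
  shows "bar_diff T (bar_diff T f) xs = 0"
proof (induction xs arbitrary: f rule: induct_list012)
  case (3 t t' ts)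
  let ?m = "\<lambda>ys. f (amul T t (hd ys) # tl ys)"
  have "bar_diff T (\<lambda>ys. bar_diff T f (t # ys)) (t' # ts) =
      bar_diff T (\<lambda>ys. ?m ys - bar_diff T (\<lambda>ys. f (t # ys)) ys) (t' # ts)"
  proof (rule bar_diff_cong)
    fix ys :: "'a list" assume "ys \<noteq> []"
    then show "bar_diff T f (t # ys) = ?m ys - bar_diff T (\<lambda>ys. f (t # ys)) ys"
      by (cases ys) auto
  qed
  also have "\<dots> = bar_diff T ?m (t' # ts)"
    by (simp add: bar_diff_minus "3.IH")
  also have "\<dots> = bar_diff T f (amul T t t' # ts)"
    by (cases ts) (simp_all add: assoc)
  finally show ?case by simp
qed auto

text \<open>The entry \<open>w\<close> is an end of both parts, so each merge lies in exactly one of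
  them; those on the right are numbered after the \<open>length us\<close> merges on the left. Later
  this cuts a list at its corner entry.\<close>

lemma bar_diff_append:
  "bar_diff T f (us @ w # vs) =
     bar_diff T (\<lambda>zs. f (zs @ vs)) (us @ [w]) + altsign (length us) (bar_diff T (\<lambda>zs. f (us @ zs)) (w # vs))"
proof (induction us arbitrary: f)
  case Nil
  then show ?case by (simp add: altsign_def)
next
  case (Cons u us)
  show ?case
  proof (cases us)
    case Nil
    then show ?thesis by (simp add: altsign_def)
  next
    case (Cons u' us')
    then show ?thesis
      using Cons.IH[of "\<lambda>ys. f (u # ys)"] by (simp add: altsign_Suc)
  qed
qed

text \<open>In a list of length m, reversal exchanges merge i with merge m - 2 - i, so all signs
  change by the same factor (-1)^m.\<close>

lemma bar_diff_rev:
  "bar_diff (opp T) (\<lambda>xs. f (rev xs)) xs = altsign (length xs) (bar_diff T f (rev xs))"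
proof (induction xs arbitrary: f rule: induct_list012)
  case (3 x y zs)
  have "bar_diff (opp T) (\<lambda>ys. f (rev ys @ [x])) (y # zs) =
      altsign (Suc (length zs)) (bar_diff T (\<lambda>ys. f (ys @ [x])) (rev zs @ [y]))"
    using 3(2)[of "\<lambda>ys. f (ys @ [x])"] by simp
  moreover have "bar_diff T f (rev zs @ [y, x]) = bar_diff T (\<lambda>ys. f (ys @ [x])) (rev zs @ [y]) +
      altsign (length zs) (f (rev zs @ [amul T y x]))"
    using bar_diff_append[of T f "rev zs" y "[x]"] by simp
  ultimately show ?case
    by (simp add: opp_def altsign_def)
qed (auto simp: altsign_def)

section \<open>Multilinear functions\<close>

lemma multilinear_iff:
  "multilinear s sv f \<longleftrightarrow>
     (\<forall>us x y vs. f (us @ (x + y) # vs) = f (us @ x # vs) + f (us @ y # vs)) \<and>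
     (\<forall>us k x vs. f (us @ s k x # vs) = sv k (f (us @ x # vs)))" (is "?l \<longleftrightarrow> ?r")
proof
  assume l: ?l
  have "f (us @ (x + y) # vs) = f (us @ x # vs) + f (us @ y # vs)" for us x y vs
    using l[unfolded multilinear_def, THEN conjunct1, rule_format, of "length us" "us @ x # vs" x y] by simp
  moreover have "f (us @ s k x # vs) = sv k (f (us @ x # vs))" for us k x vs
    using l[unfolded multilinear_def, THEN conjunct2, rule_format, of "length us" "us @ x # vs" k x] by simp
  ultimately show ?r by blast
next
  assume ?r
  then show ?l unfolding multilinear_def by (simp add: upd_conv_take_nth_drop)
qed

text \<open>The scalar-free half of multilinearity. It suffices for the homotopy formula of the
  relative complex, and it passes to \<open>\<lambda>ys. f (x # ys)\<close>, as the inductions on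
  lists require.\<close>

definition multiadditive :: "('a::ab_group_add list \<Rightarrow> 'v::ab_group_add) \<Rightarrow> bool" where
  "multiadditive f \<longleftrightarrow> (\<forall>us x y vs. f (us @ (x + y) # vs) = f (us @ x # vs) + f (us @ y # vs))"

lemma multiadditiveD: "multiadditive f \<Longrightarrow> f (us @ (x + y) # vs) = f (us @ x # vs) + f (us @ y # vs)"
  by (auto simp: multiadditive_def)

lemma multiadditive_hd: "multiadditive f \<Longrightarrow> f ((x + y) # vs) = f (x # vs) + f (y # vs)"
  using multiadditiveD[of f "[]"] by simp

lemma multiadditive_append: "multiadditive f \<Longrightarrow> multiadditive (\<lambda>ys. f (xs @ ys))"
  unfolding multiadditive_def by (metis append.assoc)

lemma multiadditive_Cons: "multiadditive f \<Longrightarrow> multiadditive (\<lambda>ys. f (x # ys))"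
  using multiadditive_append[of f "[x]"] by simp

lemma multiadditive_zero:
  assumes "multiadditive f" shows "f (us @ 0 # vs) = 0"
  using multiadditiveD[OF assms, of us 0 0 vs] by simp

lemma multilinear_multiadditive: "multilinear s sv f \<Longrightarrow> multiadditive f"
  by (simp add: multilinear_iff multiadditive_def)

context kalg begin

lemma multiadditive_bar_diff:
  assumes "multiadditive f"
  shows "bar_diff A f (us @ (x + y) # vs) = bar_diff A f (us @ x # vs) + bar_diff A f (us @ y # vs)"
  using assms
proof (induction us arbitrary: f)
  case Nil
  have "bar_diff A (\<lambda>ys. f ((x + y) # ys)) vs = bar_diff A (\<lambda>ys. f (x # ys) + f (y # ys)) vs" for vs
    by (rule bar_diff_cong) (simp add: multiadditive_hd[OF Nil])
  then show ?case
    by (cases vs) (auto simp: amul_add_left bar_diff_add multiadditive_hd[OF Nil])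
next
  case (Cons u us)
  note IH = Cons.IH[OF multiadditive_Cons[OF Cons.prems, of u]]
  show ?case
  proof (cases us)
    case Nil
    then show ?thesis using IH by (simp add: amul_add_right multiadditive_hd[OF Cons.prems])
  next
    case (Cons u' us')
    then show ?thesis using IH multiadditiveD[OF Cons.prems, of "amul A u u' # us'"] by simp
  qed
qed

lemma scal_bar_diff:
  assumes "\<And>us x vs. f (us @ ascal A k x # vs) = h (f (us @ x # vs))"
    and h: "\<And>x y. h (x + y) = h x + (h y :: 'v::ab_group_add)"
  shows "bar_diff A f (us @ ascal A k x # vs) = h (bar_diff A f (us @ x # vs))"
  using assms(1)
proof (induction us arbitrary: f)
  case Nil
  have hd: "f (ascal A k x # vs) = h (f (x # vs))" for x vs
    using Nil[of "[]"] by simp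
  have "bar_diff A (\<lambda>ys. f (ascal A k x # ys)) vs = bar_diff A (\<lambda>ys. h (f (x # ys))) vs" for vs
    by (rule bar_diff_cong) (simp add: hd)
  then show ?case
    by (cases vs) (auto simp: amul_scal_left bar_diff_additive[of h, OF h] hd
        additive_zero[of h, OF h] additive_minus[of h, OF h])
next
  case (Cons u us)
  have IH: "bar_diff A (\<lambda>ys. f (u # ys)) (us @ ascal A k x # vs) = h (bar_diff A (\<lambda>ys. f (u # ys)) (us @ x # vs))"
    by (rule Cons.IH) (use Cons.prems[of "u # _"] in simp)
  show ?case
  proof (cases us)
    case Nil
    then show ?thesis using IH Cons.prems[of "[]"] by (simp add: amul_scal_right additive_minus[of h, OF h])
  next
    case (Cons u' us')
    then show ?thesis using IH Cons.prems[of "amul A u u' # us'"] by (simp add: additive_minus[of h, OF h])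
  qed
qed

lemma multilinear_bar_diff:
  assumes "multilinear (ascal A) sv f" and "\<And>k x y. sv k (x + y) = sv k x + (sv k y :: 'v::ab_group_add)"
  shows "multilinear (ascal A) sv (bar_diff A f)"
proof -
  have "bar_diff A f (us @ ascal A k x # vs) = sv k (bar_diff A f (us @ x # vs))" for us k x vs
    by (rule scal_bar_diff) (use assms in \<open>auto simp: multilinear_iff\<close>)
  then show ?thesis
    using multiadditive_bar_diff[OF multilinear_multiadditive[OF assms(1)]] by (simp add: multilinear_iff)
qed

text \<open>The action on the values enters as an arbitrary additive \<open>h\<close>. This lemma
  and the next then cover actions on values as well as, with functions as values, precomposition
  with an action.\<close>

lemma left_linear_bar_diff:
  assumes "\<And>x xs. f (amul A t x # xs) = h (f (x # xs))"
    and h: "\<And>x y. h (x + y) = h x + (h y :: 'v::ab_group_add)"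
  shows "bar_diff A f (amul A t x # xs) = h (bar_diff A f (x # xs))"
  by (cases xs) (simp_all add: amul_assoc assms(1) bar_diff_additive[of h, OF h]
      additive_zero[of h, OF h] additive_minus[of h, OF h])

lemma right_linear_bar_diff:
  assumes "\<And>x xs. f (xs @ [amul A x t]) = h (f (xs @ [x]))"
    and h: "\<And>x y. h (x + y) = h x + (h y :: 'v::ab_group_add)"
  shows "bar_diff A f (xs @ [amul A x t]) = h (bar_diff A f (xs @ [x]))"
  using assms(1)
proof (induction xs arbitrary: f)
  case (Cons u us)
  have IH: "bar_diff A (\<lambda>ys. f (u # ys)) (us @ [amul A x t]) = h (bar_diff A (\<lambda>ys. f (u # ys)) (us @ [x]))"
    by (rule Cons.IH) (use Cons.prems[where xs="u # _"] in simp)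
  show ?case
  proof (cases us)
    case Nil
    then show ?thesis using IH Cons.prems[where xs="[]"] by (simp add: amul_assoc[symmetric] additive_minus[of h, OF h])
  next
    case (Cons u' us')
    then show ?thesis using IH Cons.prems[where xs="amul A u u' # us'"] by (simp add: additive_minus[of h, OF h])
  qed
qed (simp add: additive_zero[of h, OF h])

lemma bar_diff_squared: "bar_diff A (bar_diff A f) xs = 0"
  by (rule bar_diff_bar_diff) (rule amul_assoc)

end

section \<open>Hochschild complexes\<close>

text \<open>\<open>V\<close> is a carrier inside a type because the coefficients include Hom groups
  inside function types. The identities for the actions hold for all functions and are stated on the
  whole type; only closure refers to \<open>V\<close>.\<close>

locale hoch_coeff = kalg T for T :: "('k::{comm_ring,monoid_mult}, 't::ab_group_add) alg" +
  fixes V :: "'v::ab_group_add set" and L :: "('k, 't, 't, 'v) bimod"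
  assumes zero_V: "0 \<in> V" and add_V: "\<And>v w. v \<in> V \<Longrightarrow> w \<in> V \<Longrightarrow> v + w \<in> V"
    and minus_V: "\<And>v. v \<in> V \<Longrightarrow> - v \<in> V"
    and scal_V: "\<And>k v. v \<in> V \<Longrightarrow> mscal L k v \<in> V"
    and lact_add: "\<And>t v w. lact L t (v + w) = lact L t v + lact L t w"
    and ract_add: "\<And>t v w. ract L (v + w) t = ract L v t + ract L w t"
    and scal_add: "\<And>k v w. mscal L k (v + w) = mscal L k v + mscal L k w"
    and scal_lact: "\<And>k t v. mscal L k (lact L t v) = lact L t (mscal L k v)"
    and scal_ract: "\<And>k t v. mscal L k (ract L v t) = ract L (mscal L k v) t"
    and scal_scal: "\<And>k l v. mscal L k (mscal L l v) = mscal L l (mscal L k v)"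
begin

lemma hoch_zero_coeff: "lact L t 0 = 0" "ract L 0 t = 0" "mscal L k 0 = 0"
  using additive_zero[of "lact L t", OF lact_add] additive_zero[of "\<lambda>v. ract L v t", OF ract_add]
    additive_zero[of "mscal L k", OF scal_add] by auto

lemma hoch_minus_coeff: "lact L t (- v) = - lact L t v" "ract L (- v) t = - ract L v t" "mscal L k (- v) = - mscal L k v"
  using additive_uminus[of "lact L t", OF lact_add] additive_uminus[of "\<lambda>v. ract L v t", OF ract_add]
    additive_uminus[of "mscal L k", OF scal_add] by auto

lemma bar_diff_V: "(\<And>xs. f xs \<in> V) \<Longrightarrow> bar_diff T f xs \<in> V"
  by (induction xs arbitrary: f rule: induct_list012) (auto simp: zero_V add_V minus_V diff_conv_add_uminus simp del: add_uminus_conv_diff)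

lemma cochain_complex_hochschild: "cochain_complex (hochschild T V L)"
proof
  fix n f assume f: "f \<in> cochains (hochschild T V L) n"
  then have F: "\<And>xs. \<not> (0 \<le> n \<and> int (length xs) = n + 2) \<Longrightarrow> f xs = 0" "\<And>xs. f xs \<in> V"
    "multilinear (ascal T) (mscal L) f" "\<And>t x xs. f (amul T t x # xs) = lact L t (f (x # xs))"
    "\<And>t x xs. f (xs @ [amul T x t]) = ract L (f (xs @ [x])) t"
    by (auto simp: hochschild_def hoch_cochains_def)
  have "bar_diff T f xs = 0" if "\<not> (0 \<le> n + 1 \<and> int (length xs) = n + 1 + 2)" for xs
    using bar_diff_cong[of xs f "\<lambda>_. 0" T] F(1) that by (force simp: bar_diff_zero)
  moreover have "bar_diff T f xs \<in> V" for xs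
    by (rule bar_diff_V) (rule F)
  moreover have "multilinear (ascal T) (mscal L) (bar_diff T f)"
    by (rule multilinear_bar_diff[OF F(3) scal_add])
  moreover have "bar_diff T f (amul T t x # xs) = lact L t (bar_diff T f (x # xs))" for t x xs
    by (rule left_linear_bar_diff) (rule F lact_add)+
  moreover have "bar_diff T f (xs @ [amul T x t]) = ract L (bar_diff T f (xs @ [x])) t" for t x xs
    by (rule right_linear_bar_diff) (rule F ract_add)+
  ultimately show "diff (hochschild T V L) f \<in> cochains (hochschild T V L) (n + 1)"
    by (auto simp: hochschild_def hoch_cochains_def)
  show "diff (hochschild T V L) (diff (hochschild T V L) f) = 0"
    by (auto simp: hochschild_def fun_eq_iff bar_diff_squared)
  show "diff (hochschild T V L) (cscal (hochschild T V L) k f) = cscal (hochschild T V L) k (diff (hochschild T V L) f)" for k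
    by (simp add: hochschild_def fun_eq_iff bar_diff_additive[of "mscal L k", OF scal_add])
  show "cscal (hochschild T V L) k f \<in> cochains (hochschild T V L) n" for k
    using F by (auto simp: hochschild_def hoch_cochains_def multilinear_iff scal_V hoch_zero_coeff scal_add
        scal_lact scal_ract scal_scal)
  show "- f \<in> cochains (hochschild T V L) n"
    using F by (auto simp: hochschild_def hoch_cochains_def multilinear_iff minus_V hoch_minus_coeff)
  fix g assume g: "g \<in> cochains (hochschild T V L) n"
  show "f + g \<in> cochains (hochschild T V L) n"
    using F g by (auto simp: hochschild_def hoch_cochains_def multilinear_iff add_V scal_add lact_add ract_add)
  show "diff (hochschild T V L) (f + g) = diff (hochschild T V L) f + diff (hochschild T V L) g"
    by (auto simp: hochschild_def fun_eq_iff bar_diff_add[symmetric] plus_fun_def)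
  show "cscal (hochschild T V L) k (f + g) = cscal (hochschild T V L) k f + cscal (hochschild T V L) k g" for k
    by (auto simp: hochschild_def fun_eq_iff scal_add)
qed (auto simp: hochschild_def hoch_cochains_def multilinear_iff zero_V hoch_zero_coeff)

end

section \<open>The relative bar complex\<close>

text \<open>
  For \<open>1 = e + f\<close> with idempotents \<open>e\<close>, \<open>f\<close>, the map inserting \<open>e \<otimes> e + f \<otimes> f\<close> between any two adjacent
  tensor factors is an endomorphism of the bar complex which is homotopic to the identity; its image
  is the bar complex relative to the subalgebra spanned by \<open>e\<close> and \<open>f\<close>. The argument \<open>x\<close> is the
  idempotent inserted to the left of the current entry.
\<close>

fun relative :: "('k, 'a) alg \<Rightarrow> 'a \<Rightarrow> 'a \<Rightarrow> 'a \<Rightarrow> ('a list \<Rightarrow> 'v::ab_group_add) \<Rightarrow> 'a list \<Rightarrow> 'v" where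
  "relative T e f x F [] = 0"
| "relative T e f x F [t] = F [amul T x t]"
| "relative T e f x F (t # t' # ts) =
     relative T e f e (\<lambda>ys. F (amul T (amul T x t) e # ys)) (t' # ts) +
     relative T e f f (\<lambda>ys. F (amul T (amul T x t) f # ys)) (t' # ts)"

text \<open>A doubled idempotent is inserted into one gap, its left copy absorbed by the neighbour
  and its right copy forming a new entry; the sum runs over the gaps with alternating signs. Gaps to
  the left are already filled as in \<open>relative\<close>, gaps to the right are untouched, so the
  sum interpolates between the identity and \<open>relative\<close>.\<close>

fun rel_homotopy :: "('k, 'a) alg \<Rightarrow> 'a \<Rightarrow> 'a \<Rightarrow> 'a \<Rightarrow> ('a list \<Rightarrow> 'v::ab_group_add) \<Rightarrow> 'a list \<Rightarrow> 'v" where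
  "rel_homotopy T e f x F [] = 0"
| "rel_homotopy T e f x F [t] = 0"
| "rel_homotopy T e f x F (t # t' # ts) =
     F (amul T (amul T x t) e # e # t' # ts) + F (amul T (amul T x t) f # f # t' # ts)
     - rel_homotopy T e f e (\<lambda>ys. F (amul T (amul T x t) e # ys)) (t' # ts)
     - rel_homotopy T e f f (\<lambda>ys. F (amul T (amul T x t) f # ys)) (t' # ts)"

lemma rel_homotopy_Cons:
  "ts \<noteq> [] \<Longrightarrow> rel_homotopy T e f x F (t # ts) =
     F (amul T (amul T x t) e # e # ts) + F (amul T (amul T x t) f # f # ts)
     - rel_homotopy T e f e (\<lambda>ys. F (amul T (amul T x t) e # ys)) ts
     - rel_homotopy T e f f (\<lambda>ys. F (amul T (amul T x t) f # ys)) ts"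
  by (cases ts) auto

lemma rel_homotopy_cong:
  assumes "\<And>ys. length ys = Suc (length ts) \<Longrightarrow> F ys = G ys"
  shows "rel_homotopy T e f x F ts = rel_homotopy T e f x G ts"
  using assms
proof (induction ts arbitrary: F G x rule: induct_list012)
  case (3 t t' ts)
  have "rel_homotopy T e f z (\<lambda>ys. F (s # ys)) (t' # ts) = rel_homotopy T e f z (\<lambda>ys. G (s # ys)) (t' # ts)" for z s
    by (rule "3.IH"(2)) (simp add: "3.prems")
  then show ?case by (simp add: "3.prems")
qed auto

lemma rel_homotopy_add:
  "rel_homotopy T e f x (\<lambda>ys. F ys + G ys) ts = rel_homotopy T e f x F ts + rel_homotopy T e f x G ts"
  by (induction ts arbitrary: F G x rule: induct_list012) (auto simp: algebra_simps)

lemma rel_homotopy_additive: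
  assumes h: "\<And>x y. h (x + y) = h x + (h y :: 'w::ab_group_add)"
  shows "rel_homotopy T e f x (\<lambda>ys. h (F ys)) ts = h (rel_homotopy T e f x F ts)"
  by (induction ts arbitrary: F x rule: induct_list012)
    (auto simp: additive_zero[of h, OF h] additive_minus[of h, OF h] h)

lemma rel_homotopy_uminus: "rel_homotopy T e f x (\<lambda>ys. - F ys) ts = - rel_homotopy T e f x F ts"
  by (rule rel_homotopy_additive) simp

lemma rel_homotopy_minus:
  "rel_homotopy T e f x (\<lambda>ys. F ys - G ys) ts = rel_homotopy T e f x F ts - rel_homotopy T e f x G ts"
  using rel_homotopy_add[of T e f x F "\<lambda>ys. - G ys" ts] by (simp add: rel_homotopy_uminus)

lemma rel_homotopy_zero: "rel_homotopy T e f x (\<lambda>ys. 0) ts = 0"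
  by (induction ts arbitrary: x rule: induct_list012) auto

context kalg begin

text \<open>Merging the two entries around a filled gap multiplies the two copies of the idempotent
  there; idempotency and \<open>e + f = aone A\<close> turn the sum over both choices into the
  product without insertion.\<close>

lemma rel_homotopy_merge:
  assumes F: "multiadditive F" and e: "amul A e e = e" "amul A f f = f" "e + f = aone A"
  shows "rel_homotopy A e f x F (amul A t t' # ts) =
    rel_homotopy A e f e (\<lambda>ys. F (amul A (amul A (amul A x t) e) (hd ys) # tl ys)) (t' # ts) +
    rel_homotopy A e f f (\<lambda>ys. F (amul A (amul A (amul A x t) f) (hd ys) # tl ys)) (t' # ts)"
proof (cases ts)
  case (Cons t'' r)
  have one: "amul A s e + amul A s f = s" for s
    by (simp add: amul_add_right[symmetric] e amul_one)
  have m: "amul A (amul A (amul A x t) y) (amul A (amul A y t') z) = amul A (amul A (amul A (amul A x t) y) t') z"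
    if "amul A y y = y" for y z
  proof -
    have "amul A y (amul A y w) = amul A y w" for w
      using that amul_assoc[of y y w] by simp
    then show ?thesis by (simp add: amul_assoc)
  qed
  have s: "F (amul A (amul A (amul A (amul A x t) e) t') z # ys) + F (amul A (amul A (amul A (amul A x t) f) t') z # ys)
      = F (amul A (amul A x (amul A t t')) z # ys)" for z ys
    by (subst multiadditive_hd[OF F, symmetric])
      (simp add: amul_assoc[symmetric] amul_add_left[symmetric] one)
  show ?thesis
    by (simp add: Cons m e s[symmetric] rel_homotopy_add)
qed simp

text \<open>Stated for general \<open>x\<close>, so that the tail with its inserted idempotent falls
  under the induction hypothesis. Merging the left copy of the first insertion with the right one
  and summing restores the entry \<open>amul A x t\<close> by \<open>e + f = aone A\<close>; merging
  the right copy into \<open>t'\<close> cancels the leading term of the induction hypothesis. The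
  rest cancels in pairs, except for the relative part of the tail.\<close>

lemma rel_homotopy_bar_diff:
  assumes F: "multiadditive F" and e: "amul A e e = e" "amul A f f = f" "e + f = aone A"
  shows "bar_diff A (rel_homotopy A e f x F) (t # ts) + rel_homotopy A e f x (bar_diff A F) (t # ts)
    = F (amul A x t # ts) - relative A e f x F (t # ts)"
  using F
proof (induction ts arbitrary: t x F)
  case (Cons t' ts)
  let ?e = "amul A (amul A x t) e" and ?f = "amul A (amul A x t) f"
  let ?H = "rel_homotopy A e f"
  have D1: "bar_diff A (\<lambda>ys. ?H x F (t # ys)) (t' # ts) =
      bar_diff A (\<lambda>ys. F (?e # e # ys)) (t' # ts) + bar_diff A (\<lambda>ys. F (?f # f # ys)) (t' # ts)
      - bar_diff A (?H e (\<lambda>ys. F (?e # ys))) (t' # ts) - bar_diff A (?H f (\<lambda>ys. F (?f # ys))) (t' # ts)"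
    by (subst bar_diff_cong[of "t' # ts" "\<lambda>ys. ?H x F (t # ys)", OF rel_homotopy_Cons])
      (simp_all add: bar_diff_add[symmetric] bar_diff_minus[symmetric])
  have D2: "?H z (\<lambda>ys. bar_diff A F (y # ys)) (t' # ts) =
      ?H z (\<lambda>ys. F (amul A y (hd ys) # tl ys)) (t' # ts) - ?H z (bar_diff A (\<lambda>ys. F (y # ys))) (t' # ts)" for y z
  proof -
    have "?H z (\<lambda>ys. bar_diff A F (y # ys)) (t' # ts) =
        ?H z (\<lambda>ys. F (amul A y (hd ys) # tl ys) - bar_diff A (\<lambda>ys. F (y # ys)) ys) (t' # ts)"
    proof (rule rel_homotopy_cong)
      fix ys :: "'a list" assume "length ys = Suc (length (t' # ts))"
      then show "bar_diff A F (y # ys) = F (amul A y (hd ys) # tl ys) - bar_diff A (\<lambda>ys. F (y # ys)) ys"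
        by (cases ys) auto
    qed
    then show ?thesis by (simp add: rel_homotopy_minus)
  qed
  have IH: "bar_diff A (?H z (\<lambda>ys. F (y # ys))) (t' # ts) = F (y # amul A z t' # ts)
      - relative A e f z (\<lambda>ys. F (y # ys)) (t' # ts) - ?H z (bar_diff A (\<lambda>ys. F (y # ys))) (t' # ts)" for y z
    using Cons.IH[OF multiadditive_Cons[OF Cons.prems, of y], of z t'] by (simp add: algebra_simps)
  have s: "F (?e # t' # ts) + F (?f # t' # ts) = F (amul A x t # t' # ts)"
    by (subst multiadditive_hd[OF Cons.prems, symmetric])
      (simp add: amul_add_right[symmetric] e amul_one)
  have m: "amul A ?e e = ?e" "amul A ?f f = ?f"
    by (simp_all add: amul_assoc e)
  show ?case
    unfolding bar_diff_Cons rel_homotopy.simps relative.simps D1 D2 IH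
      rel_homotopy_merge[OF Cons.prems e, of x t t' ts] s[symmetric] m
    by (simp add: algebra_simps)
qed (simp add: bar_diff_def)

lemma rel_homotopy_slot:
  assumes "multiadditive F"
  shows "rel_homotopy A e f x F (us @ (s + s') # vs) =
    rel_homotopy A e f x F (us @ s # vs) + rel_homotopy A e f x F (us @ s' # vs)"
  using assms
proof (induction us arbitrary: F x)
  case Nil
  then show ?case
    by (cases vs) (auto simp: amul_add_left amul_add_right multiadditive_hd[OF Nil] rel_homotopy_add)
next
  case (Cons u us)
  note IH = Cons.IH[OF multiadditive_Cons[OF Cons.prems]]
  show ?case
    using multiadditiveD[OF Cons.prems, of "_ # _ # us" s s' vs]
    by (simp add: rel_homotopy_Cons IH)
qed

lemma rel_homotopy_scal_slot:
  assumes "\<And>us x vs. F (us @ ascal A k x # vs) = h (F (us @ x # vs))"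
    and h: "\<And>x y. h (x + y) = h x + (h y :: 'v::ab_group_add)"
  shows "rel_homotopy A e f x F (us @ ascal A k s # vs) = h (rel_homotopy A e f x F (us @ s # vs))"
  using assms(1)
proof (induction us arbitrary: F x)
  case Nil
  have hd: "F (ascal A k x # vs) = h (F (x # vs))" for x vs
    using Nil[of "[]"] by simp
  show ?case
    by (cases vs) (auto simp: amul_scal_left amul_scal_right hd rel_homotopy_additive[of h, OF h]
      additive_zero[of h, OF h] additive_minus[of h, OF h] h)
next
  case (Cons u us)
  have IH: "rel_homotopy A e f x (\<lambda>ys. F (z # ys)) (us @ ascal A k s # vs) =
      h (rel_homotopy A e f x (\<lambda>ys. F (z # ys)) (us @ s # vs))" for x z
    by (rule Cons.IH) (use Cons.prems[of "z # _"] in simp)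
  show ?case
    using Cons.prems[of "_ # _ # us"]
    by (simp add: rel_homotopy_Cons IH additive_minus[of h, OF h] h)
qed

lemma rel_homotopy_right:
  assumes "\<And>x xs. F (xs @ [amul A x t]) = h (F (xs @ [x]))"
    and h: "\<And>x y. h (x + y) = h x + (h y :: 'v::ab_group_add)"
  shows "rel_homotopy A e f x F (us @ [amul A s t]) = h (rel_homotopy A e f x F (us @ [s]))"
  using assms(1)
proof (induction us arbitrary: F x)
  case (Cons u us)
  have IH: "rel_homotopy A e f x (\<lambda>ys. F (z # ys)) (us @ [amul A s t]) =
      h (rel_homotopy A e f x (\<lambda>ys. F (z # ys)) (us @ [s]))" for x z
    by (rule Cons.IH) (use Cons.prems[where xs="z # _"] in simp)
  show ?case
    using Cons.prems[where xs="_ # _ # us"]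
    by (simp add: rel_homotopy_Cons IH additive_minus[of h, OF h] h)
qed (simp add: additive_zero[of h, OF h])

lemma rel_homotopy_left:
  assumes F: "\<And>x xs. F (amul A t x # xs) = h (F (x # xs))"
    and h: "\<And>x y. h (x + y) = h x + (h y :: 'v::ab_group_add)"
  shows "rel_homotopy A e f (aone A) F (amul A t s # us) = h (rel_homotopy A e f (aone A) F (s # us))"
  by (cases us) (auto simp: amul_assoc amul_one F rel_homotopy_additive[of h, OF h]
      additive_zero[of h, OF h] additive_minus[of h, OF h] h)

end

lemma (in hoch_coeff) rel_homotopy_graded:
  "graded_map (hochschild T V L) (hochschild T V L) (-1) (rel_homotopy T e f (aone T))"
  unfolding graded_map_def
proof (intro conjI allI ballI)
  let ?H = "rel_homotopy T e f (aone T)"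
  fix n
  show "?H ` cochains (hochschild T V L) n \<subseteq> cochains (hochschild T V L) (n + -1)"
  proof (rule image_subsetI)
    fix F assume "F \<in> cochains (hochschild T V L) n"
    then have F: "\<And>xs. \<not> (0 \<le> n \<and> int (length xs) = n + 2) \<Longrightarrow> F xs = 0" "\<And>xs. F xs \<in> V"
      "multilinear (ascal T) (mscal L) F" "\<And>t x xs. F (amul T t x # xs) = lact L t (F (x # xs))"
      "\<And>t x xs. F (xs @ [amul T x t]) = ract L (F (xs @ [x])) t"
      by (auto simp: hochschild_def hoch_cochains_def)
    have "?H F ts = 0" if t: "\<not> (0 \<le> n + -1 \<and> int (length ts) = n + -1 + 2)" for ts
    \<comment> \<open>The one case not settled by the support of \<open>F\<close>: in degree 0 it
      lives on lists of length 2, and the homotopy would be supported on lists of length 1, where it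
      is 0 by definition.\<close>
    proof (cases "n = 0 \<and> length ts = 1")
      case True
      then obtain t where "ts = [t]" by (auto simp: length_Suc_conv)
      then show ?thesis by simp
    next
      case False
      then have "?H F ts = ?H (\<lambda>_. 0) ts"
        by (intro rel_homotopy_cong F) (use t in auto)
      then show ?thesis by (simp add: rel_homotopy_zero)
    qed
    moreover have "rel_homotopy T e f x F ts \<in> V" for ts x
      using F(2)
      by (induction ts arbitrary: F x rule: induct_list012)
        (auto simp: zero_V add_V minus_V diff_conv_add_uminus simp del: add_uminus_conv_diff)
    moreover have "multilinear (ascal T) (mscal L) (?H F)"
      using rel_homotopy_slot[of F, OF multilinear_multiadditive[OF F(3)]]
        rel_homotopy_scal_slot[of F _ "mscal L _", OF _ scal_add] F(3)
      unfolding multilinear_iff by simp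
    moreover have "?H F (amul T t x # xs) = lact L t (?H F (x # xs))" for t x xs
      by (rule rel_homotopy_left) (rule F lact_add)+
    moreover have "?H F (xs @ [amul T x t]) = ract L (?H F (xs @ [x])) t" for t x xs
      by (rule rel_homotopy_right) (rule F ract_add)+
    ultimately show "?H F \<in> cochains (hochschild T V L) (n + -1)"
      by (auto simp: hochschild_def hoch_cochains_def)
  qed
next
  fix F G :: "'t list \<Rightarrow> 'v"
  show "rel_homotopy T e f (aone T) (F + G) = rel_homotopy T e f (aone T) F + rel_homotopy T e f (aone T) G"
    by (simp add: fun_eq_iff rel_homotopy_add[symmetric] plus_fun_def)
next
  fix k and F :: "'t list \<Rightarrow> 'v"
  show "rel_homotopy T e f (aone T) (cscal (hochschild T V L) k F) = cscal (hochschild T V L) k (rel_homotopy T e f (aone T) F)"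
    by (simp add: fun_eq_iff hochschild_def rel_homotopy_additive[of "mscal L k", OF scal_add])
qed

section \<open>The triangular complex\<close>

lemma altsign_add: "altsign n (v + w) = altsign n v + altsign n w"
  and altsign_minus: "altsign n (- v) = - altsign n v"
  and altsign_zero [simp]: "altsign n 0 = 0"
  and altsign_twice: "altsign n (altsign n v) = v"
  by (simp_all add: altsign_def)

lemma altsign_two: "altsign (Suc (Suc 0)) v = v"
  by (simp add: altsign_def)

lemma amul_opp [simp]: "amul (opp B) x y = amul B y x"
  and aone_opp [simp]: "aone (opp B) = aone B"
  and ascal_opp [simp]: "ascal (opp B) = ascal B"
  by (simp_all add: opp_def)

lemma kalg_opp: "kalg B \<Longrightarrow> kalg (opp B)"
  by (simp add: kalg_def kalgebra_def opp_def)

locale bimod_over = A: kalg A + B: kalg B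
  for A :: "('k::{comm_ring,monoid_mult}, 'a::ab_group_add) alg"
    and B :: "('k, 'b::ab_group_add) alg" +
  fixes M :: "('k, 'a, 'b, 'm::ab_group_add) bimod"
  assumes bimod: "bimodule A B M"
begin

lemma lact_add: "lact M a (x + y) = lact M a x + lact M a y"
  and lact_add_left: "lact M (a + a') x = lact M a x + lact M a' x"
  and lact_mul: "lact M (amul A a a') x = lact M a (lact M a' x)"
  and lact_one: "lact M (aone A) x = x"
  and lact_scal_left: "lact M (ascal A k a) x = mscal M k (lact M a x)"
  and lact_scal: "lact M a (mscal M k x) = mscal M k (lact M a x)"
  and ract_add: "ract M (x + y) b = ract M x b + ract M y b"
  and ract_add_right: "ract M x (b + b') = ract M x b + ract M x b'"
  and ract_mul: "ract M x (amul B b b') = ract M (ract M x b) b'"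
  and ract_one: "ract M x (aone B) = x"
  and ract_scal_right: "ract M x (ascal B k b) = mscal M k (ract M x b)"
  and ract_scal: "ract M (mscal M k x) b = mscal M k (ract M x b)"
  and ract_lact: "ract M (lact M a x) b = lact M a (ract M x b)"
  using bimod unfolding bimodule_def by simp_all

lemma mscal_add: "mscal M k (x + y) = mscal M k x + mscal M k y"
  and mscal_commute: "mscal M k (mscal M l x) = mscal M l (mscal M k x)"
  using bimod unfolding bimodule_def kmodule_def by (metis mult.commute)+

lemma act_zero: "lact M a 0 = 0" "lact M 0 x = 0" "ract M 0 b = 0" "ract M x 0 = 0" "mscal M k 0 = 0"
  using lact_add[of a 0 0] lact_add_left[of 0 0 x] ract_add[of 0 0 b] ract_add_right[of x 0 0]
    mscal_add[of k 0 0] by auto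

lemma act_uminus: "lact M a (- x) = - lact M a x" "ract M (- x) b = - ract M x b" "mscal M k (- x) = - mscal M k x"
  using additive_uminus[of "lact M a", OF lact_add] additive_uminus[of "\<lambda>x. ract M x b", OF ract_add]
    additive_uminus[of "mscal M k", OF mscal_add] by auto

lemma act_altsign: "lact M a (altsign n x) = altsign n (lact M a x)" "ract M (altsign n x) b = altsign n (ract M x b)"
  "mscal M k (altsign n x) = altsign n (mscal M k x)"
  by (simp_all add: altsign_def act_uminus)

end

text \<open>The exponent of the sign in \<open>iB\<close>: n(n+1)/2 in degree n, written through the
  list length n + 2. Truncated subtraction makes it 0 on lists with fewer than two entries.\<close>

definition revsign :: "nat \<Rightarrow> nat" where
  "revsign n = (n - 2) * (n - 1) div 2"

lemma even_revsign_Suc: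
  assumes "1 \<le> n"
  shows "even (revsign (Suc n)) \<longleftrightarrow> (even (revsign n) \<longleftrightarrow> odd n)"
proof -
  obtain k where n: "n = Suc k" using assms by (cases n) auto
  have "revsign (Suc n) = revsign n + k"
  proof (cases k)
    case (Suc i)
    have "k * Suc k = (k - 1) * k + k * 2" by (simp add: Suc)
    then show ?thesis unfolding revsign_def n by (simp add: Suc)
  qed (simp add: n revsign_def)
  then show ?thesis by (simp add: n)
qed

lemma revsign_small [simp]: "revsign (Suc 0) = 0" "revsign 2 = 0"
  by (simp_all add: revsign_def)

text \<open>From length n to n + 1 the exponent grows by n - 1, which has the parity of n + 1, the
  sign that reversal costs the bar differential. This is why the sign in \<open>iB\<close> turns
  reversal into a chain map.\<close>

lemma altsign_revsign_Suc:
  assumes "1 \<le> n"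
  shows "altsign (revsign (Suc n)) (altsign (Suc n) v) = altsign (revsign n) v"
  using even_revsign_Suc[OF assms] by (auto simp: altsign_def)

locale bimod_pair = M: bimod_over A B M + N: bimod_over A B N
  for A :: "('k::{comm_ring,monoid_mult}, 'a::ab_group_add) alg"
    and B :: "('k, 'b::ab_group_add) alg"
    and M :: "('k, 'a, 'b, 'm::ab_group_add) bimod"
    and N :: "('k, 'a, 'b, 'n::ab_group_add) bimod"
begin

sublocale opp: kalg "opp B"
  by (rule kalg_opp) (rule M.B.kalg_axioms)

abbreviation "HR \<equiv> hochschild A (homR M N) (homR_bimod M N)"
abbreviation "HL \<equiv> hochschild B (homL M N) (homL_bimod M N)"
abbreviation "HC \<equiv> hom_complexes A B M N"
abbreviation "TC \<equiv> tri_complex A B M N"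

lemma tri_mapsD:
  assumes "c \<in> tri_maps A B M N"
  shows "c (us @ (x + x') # vs) ys m = c (us @ x # vs) ys m + c (us @ x' # vs) ys m"
    and "c (us @ ascal A k x # vs) ys m = mscal N k (c (us @ x # vs) ys m)"
    and "c xs (us' @ (y + y') # vs') m = c xs (us' @ y # vs') m + c xs (us' @ y' # vs') m"
    and "c xs (us' @ ascal B k y # vs') m = mscal N k (c xs (us' @ y # vs') m)"
    and "c xs ys (m + m') = c xs ys m + c xs ys m'"
    and "c xs ys (mscal M k m) = mscal N k (c xs ys m)"
    and "c (amul A a x # xs) ys m = lact N a (c (x # xs) ys m)"
    and "c xs (amul B y b # ys) m = ract N (c xs (y # ys) m) b"
    and "c (xs @ [amul A x a]) ys m = c (xs @ [x]) ys (lact M a m)"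
    and "c xs (ys @ [amul B b y]) m = c xs (ys @ [y]) (ract M m b)"
  using assms by (auto simp: tri_maps_def multilinear_iff)

lemma tri_mapsI:
  assumes "\<And>us x x' vs ys m. c (us @ (x + x') # vs) ys m = c (us @ x # vs) ys m + c (us @ x' # vs) ys m"
    and "\<And>us k x vs ys m. c (us @ ascal A k x # vs) ys m = mscal N k (c (us @ x # vs) ys m)"
    and "\<And>xs us y y' vs m. c xs (us @ (y + y') # vs) m = c xs (us @ y # vs) m + c xs (us @ y' # vs) m"
    and "\<And>xs us k y vs m. c xs (us @ ascal B k y # vs) m = mscal N k (c xs (us @ y # vs) m)"
    and "\<And>xs ys m m'. c xs ys (m + m') = c xs ys m + c xs ys m'"
    and "\<And>xs ys k m. c xs ys (mscal M k m) = mscal N k (c xs ys m)"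
    and "\<And>a x xs ys m. c (amul A a x # xs) ys m = lact N a (c (x # xs) ys m)"
    and "\<And>xs y b ys m. c xs (amul B y b # ys) m = ract N (c xs (y # ys) m) b"
    and "\<And>xs x a ys m. c (xs @ [amul A x a]) ys m = c (xs @ [x]) ys (lact M a m)"
    and "\<And>xs ys b y m. c xs (ys @ [amul B b y]) m = c xs (ys @ [y]) (ract M m b)"
  shows "c \<in> tri_maps A B M N"
  using assms by (simp add: tri_maps_def multilinear_iff)

lemma tri_maps_zero: "0 \<in> tri_maps A B M N"
  by (rule tri_mapsI) (simp_all add: N.act_zero)

lemma tri_maps_add: "c \<in> tri_maps A B M N \<Longrightarrow> c' \<in> tri_maps A B M N \<Longrightarrow> c + c' \<in> tri_maps A B M N"
  by (rule tri_mapsI) (simp_all add: tri_mapsD N.mscal_add N.lact_add N.ract_add)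

lemma tri_maps_uminus: "c \<in> tri_maps A B M N \<Longrightarrow> - c \<in> tri_maps A B M N"
  by (rule tri_mapsI) (simp_all add: tri_mapsD N.act_uminus)

lemma tri_maps_scal: "c \<in> tri_maps A B M N \<Longrightarrow> (\<lambda>xs ys m. mscal N k (c xs ys m)) \<in> tri_maps A B M N"
  by (rule tri_mapsI)
    (simp_all add: tri_mapsD N.mscal_add N.lact_scal N.ract_scal N.mscal_commute[of k])

lemma tri_maps_diff:
  assumes c: "c \<in> tri_maps A B M N"
  shows "tri_diff A B c \<in> tri_maps A B M N"
proof (rule tri_mapsI)
  note D = tri_mapsD[OF c]
  fix us vs :: "'a list" and x x' a and us' vs' :: "'b list" and y y' b and xs ys and m m' :: 'm and k
  have mA: "multilinear (ascal A) (mscal N) (\<lambda>xs. c xs ys m)" for ys m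
    by (simp add: multilinear_iff D)
  have mB: "multilinear (ascal (opp B)) (mscal N) (\<lambda>ys. c xs ys m)" for xs m
    by (simp add: multilinear_iff D)
  note bA = M.A.multilinear_bar_diff[OF mA N.mscal_add, unfolded multilinear_iff]
  note bB = opp.multilinear_bar_diff[OF mB N.mscal_add, unfolded multilinear_iff]
  show "tri_diff A B c (us @ (x + x') # vs) ys m = tri_diff A B c (us @ x # vs) ys m + tri_diff A B c (us @ x' # vs) ys m"
    using bA by (simp add: tri_diff_def D bar_diff_add altsign_add algebra_simps)
  show "tri_diff A B c (us @ ascal A k x # vs) ys m = mscal N k (tri_diff A B c (us @ x # vs) ys m)"
    using bA by (simp add: tri_diff_def D bar_diff_additive[of "mscal N k", OF N.mscal_add] N.mscal_add N.act_altsign)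
  show "tri_diff A B c xs (us' @ (y + y') # vs') m = tri_diff A B c xs (us' @ y # vs') m + tri_diff A B c xs (us' @ y' # vs') m"
    using bB by (simp add: tri_diff_def D bar_diff_add altsign_add algebra_simps)
  show "tri_diff A B c xs (us' @ ascal B k y # vs') m = mscal N k (tri_diff A B c xs (us' @ y # vs') m)"
    using bB by (simp add: tri_diff_def D bar_diff_additive[of "mscal N k", OF N.mscal_add] N.mscal_add N.act_altsign)
  show "tri_diff A B c xs ys (m + m') = tri_diff A B c xs ys m + tri_diff A B c xs ys m'"
    by (simp add: tri_diff_def D bar_diff_add altsign_add algebra_simps)
  show "tri_diff A B c xs ys (mscal M k m) = mscal N k (tri_diff A B c xs ys m)"
    by (simp add: tri_diff_def D bar_diff_additive[of "mscal N k", OF N.mscal_add] N.mscal_add N.act_altsign)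
  have "bar_diff A (\<lambda>xs. c xs ys m) (amul A a x # xs) = lact N a (bar_diff A (\<lambda>xs. c xs ys m) (x # xs))"
    by (rule M.A.left_linear_bar_diff) (rule D N.lact_add)+
  then show "tri_diff A B c (amul A a x # xs) ys m = lact N a (tri_diff A B c (x # xs) ys m)"
    by (simp add: tri_diff_def D bar_diff_additive[of "lact N a", OF N.lact_add] N.lact_add N.act_altsign)
  have "bar_diff (opp B) (\<lambda>ys. c xs ys m) (amul (opp B) b y # ys) = ract N (bar_diff (opp B) (\<lambda>ys. c xs ys m) (y # ys)) b"
    by (rule opp.left_linear_bar_diff) (simp_all add: D N.ract_add)
  then show "tri_diff A B c xs (amul B y b # ys) m = ract N (tri_diff A B c xs (y # ys) m) b"
    by (simp add: tri_diff_def D bar_diff_additive[of "\<lambda>v. ract N v b", OF N.ract_add] N.ract_add N.act_altsign)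
  \<comment> \<open>Balancing moves \<open>a\<close> into the argument \<open>m\<close>. The
    linearity lemma is therefore applied to the function-valued cochain, with precomposition by the
    action in the role of \<open>h\<close>.\<close>
  have "bar_diff A (\<lambda>xs. c xs ys) (xs @ [amul A x a]) = (\<lambda>m. bar_diff A (\<lambda>xs. c xs ys) (xs @ [x]) (lact M a m))"
    by (rule M.A.right_linear_bar_diff) (simp_all add: D fun_eq_iff)
  then have "bar_diff A (\<lambda>xs. c xs ys m) (xs @ [amul A x a]) = bar_diff A (\<lambda>xs. c xs ys (lact M a m)) (xs @ [x])"
    using bar_diff_apply[of A "\<lambda>xs. c xs ys" "xs @ [amul A x a]" m]
      bar_diff_apply[of A "\<lambda>xs. c xs ys" "xs @ [x]" "lact M a m"] by simp
  then show "tri_diff A B c (xs @ [amul A x a]) ys m = tri_diff A B c (xs @ [x]) ys (lact M a m)"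
    by (simp add: tri_diff_def D)
  have "bar_diff (opp B) (c xs) (ys @ [amul (opp B) y b]) = (\<lambda>m. bar_diff (opp B) (c xs) (ys @ [y]) (ract M m b))"
    by (rule opp.right_linear_bar_diff) (simp_all add: D fun_eq_iff)
  then have "bar_diff (opp B) (\<lambda>ys. c xs ys m) (ys @ [amul B b y]) = bar_diff (opp B) (\<lambda>ys. c xs ys (ract M m b)) (ys @ [y])"
    using bar_diff_apply[of "opp B" "c xs" "ys @ [amul B b y]" m]
      bar_diff_apply[of "opp B" "c xs" "ys @ [y]" "ract M m b"] by simp
  then show "tri_diff A B c xs (ys @ [amul B b y]) m = tri_diff A B c xs (ys @ [y]) (ract M m b)"
    by (simp add: tri_diff_def D)
qed

lemma tri_diff_tri_diff: "tri_diff A B (tri_diff A B c) = 0"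
proof (intro ext)
  fix xs ys m
  \<comment> \<open>After a merge in \<open>xs\<close> the list is one shorter, so the sign of the
    inner second differential is opposite to that of the outer one, and the two mixed terms
    cancel.\<close>
  have 1: "bar_diff A (\<lambda>xs'. altsign (length xs' + 1) (bar_diff (opp B) (\<lambda>ys'. c xs' ys' m) ys)) xs =
      altsign (length xs) (bar_diff A (\<lambda>xs'. bar_diff (opp B) (\<lambda>ys'. c xs' ys' m) ys) xs)"
    by (simp only: bar_diff_altsign[symmetric]) (rule bar_diff_cong, simp)
  have 2: "bar_diff A (\<lambda>xs'. bar_diff A (\<lambda>xs'. c xs' ys m) xs') xs = 0"
    by (rule M.A.bar_diff_squared)
  have 3: "bar_diff (opp B) (\<lambda>ys'. bar_diff (opp B) (\<lambda>ys'. c xs ys' m) ys') ys = 0"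
    by (rule opp.bar_diff_squared)
  show "tri_diff A B (tri_diff A B c) xs ys m = 0 xs ys m"
    unfolding tri_diff_def bar_diff_add 1 2 bar_diff_altsign 3
    by (simp add: altsign_Suc bar_diff_commute[of A "opp B"])
qed

text \<open>The triangular complex and the complex for \<open>Ext\<close> consist of the same kind
  of maps with the same differential; they differ only in the pairs of lengths where a cochain may
  be nonzero. Such a support condition must survive lengthening either list by one when the degree
  goes up.\<close>

lemma cochain_complex_supported:
  assumes S: "\<And>n i j. S n i j \<Longrightarrow> S (n + 1) (Suc i) j" "\<And>n i j. S n i j \<Longrightarrow> S (n + 1) i (Suc j)"
  shows "cochain_complex \<lparr>cochains = (\<lambda>n. {c \<in> tri_maps A B M N. \<forall>xs ys. \<not> S n (length xs) (length ys) \<longrightarrow> c xs ys = 0}),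
      diff = tri_diff A B, cscal = (\<lambda>k c xs ys m. mscal N k (c xs ys m))\<rparr>"
    (is "cochain_complex ?X")
proof
  fix n c assume c: "c \<in> cochains ?X n"
  have "tri_diff A B c xs ys m = 0" if "\<not> S (n + 1) (length xs) (length ys)" for xs ys m
  proof -
    have z: "\<not> S n (length xs) (length ys) \<Longrightarrow> c xs ys = 0" for xs ys
      using c by simp
    have "bar_diff A (\<lambda>xs'. c xs' ys m) xs = bar_diff A (\<lambda>_. 0) xs"
    proof (rule bar_diff_cong)
      fix xs' :: "'a list" assume "Suc (length xs') = length xs"
      then show "c xs' ys m = 0"
        using S(1)[of n "length xs'" "length ys"] that z[of xs' ys] by (metis zero_fun_def)
    qed
    moreover have "bar_diff (opp B) (\<lambda>ys'. c xs ys' m) ys = bar_diff (opp B) (\<lambda>_. 0) ys"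
    proof (rule bar_diff_cong)
      fix ys' :: "'b list" assume "Suc (length ys') = length ys"
      then show "c xs ys' m = 0"
        using S(2)[of n "length xs" "length ys'"] that z[of xs ys'] by (metis zero_fun_def)
    qed
    ultimately show ?thesis by (simp add: tri_diff_def bar_diff_zero)
  qed
  then show "diff ?X c \<in> cochains ?X (n + 1)"
    using c tri_maps_diff by (auto simp: fun_eq_iff)
  show "diff ?X (diff ?X c) = 0"
    by (simp add: tri_diff_tri_diff)
  show "cscal ?X k c \<in> cochains ?X n" for k
    using c tri_maps_scal by (auto simp: fun_eq_iff N.act_zero)
  show "diff ?X (cscal ?X k c) = cscal ?X k (diff ?X c)" for k
    by (simp add: fun_eq_iff tri_diff_def bar_diff_additive[of "mscal N k", OF N.mscal_add] N.mscal_add N.act_altsign)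
  show "- c \<in> cochains ?X n"
    using c tri_maps_uminus by (auto simp: fun_eq_iff)
  fix c' assume c': "c' \<in> cochains ?X n"
  show "c + c' \<in> cochains ?X n"
    using c c' tri_maps_add by (auto simp: fun_eq_iff)
  show "diff ?X (c + c') = diff ?X c + diff ?X c'"
    by (simp add: fun_eq_iff tri_diff_def bar_diff_add altsign_add)
  show "cscal ?X k (c + c') = cscal ?X k c + cscal ?X k c'" for k
    by (simp add: fun_eq_iff N.mscal_add)
qed (simp add: tri_maps_zero)

lemma cochain_complex_tri: "cochain_complex TC"
  unfolding tri_complex_def
  by (rule cochain_complex_supported[of "\<lambda>n i j. 0 \<le> n \<and> 1 \<le> i \<and> 1 \<le> j \<and> int i + int j = n + 3"]) auto

lemma cochain_complex_ext: "cochain_complex (ext_complex A B M N)"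
  unfolding ext_complex_def
  by (rule cochain_complex_supported[of "\<lambda>n i j. 2 \<le> i \<and> 2 \<le> j \<and> int i + int j = n + 4"]) auto

section \<open>The restrictions \<open>i\<close> and their sections\<close>

lemma hoch_coeff_homR: "hoch_coeff A (homR M N) (homR_bimod M N)"
  by unfold_locales
    (auto simp: homR_def homR_bimod_def fun_eq_iff N.act_zero N.ract_add N.act_uminus N.mscal_add
      N.ract_scal N.lact_add N.lact_scal N.mscal_commute)

lemma hoch_coeff_homL: "hoch_coeff B (homL M N) (homL_bimod M N)"
  by unfold_locales
    (auto simp: homL_def homL_bimod_def fun_eq_iff N.act_zero N.ract_add N.act_uminus N.mscal_add
      N.ract_scal N.lact_add N.lact_scal N.mscal_commute)

lemmas cochain_complex_homR = hoch_coeff.cochain_complex_hochschild[OF hoch_coeff_homR]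
lemmas cochain_complex_homL = hoch_coeff.cochain_complex_hochschild[OF hoch_coeff_homL]
lemmas cochain_complex_hom = cochain_complex_cprod[OF cochain_complex_homR cochain_complex_homL]

lemma iB_revsign: "iB A c bs m = altsign (revsign (length bs)) (c [aone A] (rev bs) m)"
  by (simp add: iB_def revsign_def)

lemma tri_cochainD:
  assumes "c \<in> cochains TC n"
  shows "c \<in> tri_maps A B M N"
    and "\<not> (0 \<le> n \<and> 1 \<le> length xs \<and> 1 \<le> length ys \<and> int (length xs) + int (length ys) = n + 3) \<Longrightarrow> c xs ys = 0"
  using assms by (auto simp: tri_complex_def)

lemma homR_cochainD:
  assumes "u \<in> cochains HR n"
  shows "\<not> (0 \<le> n \<and> int (length xs) = n + 2) \<Longrightarrow> u xs m = 0"
    and "u xs (m + m') = u xs m + u xs m'"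
    and "u xs (ract M m b) = ract N (u xs m) b"
    and "u xs (mscal M k m) = mscal N k (u xs m)"
    and "u (us @ (x + y) # vs) m = u (us @ x # vs) m + u (us @ y # vs) m"
    and "u (us @ ascal A k x # vs) m = mscal N k (u (us @ x # vs) m)"
    and "u (amul A a x # xs) m = lact N a (u (x # xs) m)"
    and "u (xs @ [amul A x a]) m = u (xs @ [x]) (lact M a m)"
proof -
  have u: "u xs \<in> homR M N" for xs
    using assms by (simp add: hochschild_def hoch_cochains_def)
  show "u xs (m + m') = u xs m + u xs m'" and r: "u xs (ract M m b) = ract N (u xs m) b" for b
    using u by (simp_all add: homR_def)
  \<comment> \<open>\<open>homR\<close> asks for additivity and \<open>B\<close>-linearity only; a
    scalar is recovered as the action of the corresponding multiple of the unit of
    \<open>B\<close>.\<close>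
  show "u xs (mscal M k m) = mscal N k (u xs m)"
    using r[of "ascal B k (aone B)"]
    by (simp add: M.ract_scal_right N.ract_scal_right M.ract_one N.ract_one)
qed (use assms in \<open>auto simp: hochschild_def hoch_cochains_def multilinear_iff homR_bimod_def\<close>)

lemma homL_cochainD:
  assumes "v \<in> cochains HL n"
  shows "\<not> (0 \<le> n \<and> int (length xs) = n + 2) \<Longrightarrow> v xs m = 0"
    and "v xs (m + m') = v xs m + v xs m'"
    and "v xs (lact M a m) = lact N a (v xs m)"
    and "v xs (mscal M k m) = mscal N k (v xs m)"
    and "v (us @ (x + y) # vs) m = v (us @ x # vs) m + v (us @ y # vs) m"
    and "v (us @ ascal B k x # vs) m = mscal N k (v (us @ x # vs) m)"
    and "v (amul B b x # xs) m = v (x # xs) (ract M m b)"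
    and "v (xs @ [amul B x b]) m = ract N (v (xs @ [x]) m) b"
proof -
  have v: "v xs \<in> homL M N" for xs
    using assms by (simp add: hochschild_def hoch_cochains_def)
  show "v xs (m + m') = v xs m + v xs m'" and r: "v xs (lact M a m) = lact N a (v xs m)" for a
    using v by (simp_all add: homL_def)
  show "v xs (mscal M k m) = mscal N k (v xs m)"
    using r[of "ascal A k (aone A)"]
    by (simp add: M.lact_scal_left N.lact_scal_left M.lact_one N.lact_one)
qed (use assms in \<open>auto simp: hochschild_def hoch_cochains_def multilinear_iff homL_bimod_def\<close>)

lemma chain_map_iA: "chain_map TC HR (iA B)"
  unfolding chain_map_def graded_map_def
proof (intro conjI allI ballI)
  fix n
  show "iA B ` cochains TC n \<subseteq> cochains HR (n + 0)"
  proof (rule image_subsetI)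
    fix c assume c: "c \<in> cochains TC n"
    note D = tri_mapsD[OF tri_cochainD(1)[OF c]] and Z = tri_cochainD(2)[OF c]
    \<comment> \<open>The entry of a one-entry list is at once first and last, so it can be pulled
      out of the value or balanced onto \<open>m\<close>.\<close>
    have r: "c xs [aone B] (ract M m b) = ract N (c xs [aone B] m) b" for xs m b
      using D(10)[of xs "[]" b "aone B" m] D(8)[of xs "aone B" b "[]" m] by (simp add: M.B.amul_one)
    show "iA B c \<in> cochains HR (n + 0)"
      by (auto simp: hochschild_def hoch_cochains_def multilinear_iff iA_def homR_def homR_bimod_def D r Z fun_eq_iff)
  qed
next
  fix n c assume "c \<in> cochains TC n"
  show "iA B (diff TC c) = diff HR (iA B c)"
  proof (intro ext)
    fix xs m
    show "iA B (diff TC c) xs m = diff HR (iA B c) xs m"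
      using bar_diff_apply[of A "iA B c" xs m]
      by (simp add: iA_def tri_complex_def hochschild_def tri_diff_def)
  qed
qed (simp_all add: iA_def fun_eq_iff tri_complex_def hochschild_def homR_bimod_def)

lemma chain_map_iB: "chain_map TC HL (iB A)"
  unfolding chain_map_def graded_map_def
proof (intro conjI allI ballI)
  fix n
  show "iB A ` cochains TC n \<subseteq> cochains HL (n + 0)"
  proof (rule image_subsetI)
    fix c assume c: "c \<in> cochains TC n"
    note D = tri_mapsD[OF tri_cochainD(1)[OF c]] and Z = tri_cochainD(2)[OF c]
    have r: "c [aone A] xs (lact M a m) = lact N a (c [aone A] xs m)" for xs m a
      using D(9)[of "[]" "aone A" a xs m] D(7)[of a "aone A" "[]" xs m] by (simp add: M.A.amul_one)
    show "iB A c \<in> cochains HL (n + 0)"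
      by (auto simp: hochschild_def hoch_cochains_def multilinear_iff iB_revsign homL_def homL_bimod_def D r Z fun_eq_iff
          altsign_add N.act_altsign)
  qed
next
  fix n c assume "c \<in> cochains TC n"
  show "iB A (diff TC c) = diff HL (iB A c)"
  proof (intro ext)
    fix bs m
    let ?f = "\<lambda>bs. c [aone A] (rev bs) m"
    have 1: "bar_diff (opp B) (\<lambda>ys. c [aone A] ys m) (rev bs) = altsign (length bs) (bar_diff B ?f bs)"
      using bar_diff_rev[of B ?f "rev bs"] by simp
    have 2: "bar_diff B (iB A c) bs m = altsign (revsign (length bs - 1)) (bar_diff B ?f bs)"
      unfolding bar_diff_apply
      by (simp only: bar_diff_altsign[symmetric]) (rule bar_diff_cong, auto simp: iB_revsign dest!: sym[of "Suc _"])
    have 3: "altsign (revsign (length bs)) (altsign (length bs) (bar_diff B ?f bs)) =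
        altsign (revsign (length bs - 1)) (bar_diff B ?f bs)"
    \<comment> \<open>\<open>altsign_revsign_Suc\<close> starts at length 1; on shorter lists than
      those treated by it the bar differential is 0.\<close>
    proof (cases "length bs \<ge> 2")
      case True
      then have "Suc (length bs - 1) = length bs" "1 \<le> length bs - 1" by auto
      then show ?thesis using altsign_revsign_Suc[of "length bs - 1" "bar_diff B ?f bs"] by metis
    next
      case False
      then have "bar_diff B ?f bs = 0" by (cases bs rule: remdups_adj.cases) auto
      then show ?thesis by simp
    qed
    show "iB A (diff TC c) bs m = diff HL (iB A c) bs m"
      by (simp add: tri_complex_def hochschild_def iB_revsign tri_diff_def altsign_two 1 2 3)
  qed
qed (simp_all add: iB_revsign fun_eq_iff tri_complex_def hochschild_def homL_bimod_def altsign_add N.act_altsign)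

text \<open>On the edge of one-entry lists \<open>[b]\<close> a triangular cochain is determined,
  through \<open>B\<close>-linearity, by its values at the unit, which are what \<open>iA\<close>
  records. The formula extends from there and by 0 off the edge.\<close>

definition sectionA :: "('a list \<Rightarrow> 'm \<Rightarrow> 'n) \<Rightarrow> 'a list \<Rightarrow> 'b list \<Rightarrow> 'm \<Rightarrow> 'n" where
  "sectionA u xs ys m = (case ys of [b] \<Rightarrow> ract N (u xs m) b | _ \<Rightarrow> 0)"

definition sectionB :: "('b list \<Rightarrow> 'm \<Rightarrow> 'n) \<Rightarrow> 'a list \<Rightarrow> 'b list \<Rightarrow> 'm \<Rightarrow> 'n" where
  "sectionB v xs ys m = (case xs of [a] \<Rightarrow> altsign (revsign (length ys)) (lact N a (v (rev ys) m)) | _ \<Rightarrow> 0)"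

lemma sectionA_tri:
  assumes u: "u \<in> cochains HR n"
  shows "sectionA u \<in> cochains TC n"
proof -
  note D = homR_cochainD[OF u]
  have "sectionA u \<in> tri_maps A B M N"
    by (rule tri_mapsI)
      (auto simp: sectionA_def D N.act_zero N.ract_add N.ract_add_right N.ract_scal N.ract_scal_right N.ract_mul
        N.ract_lact append_eq_Cons_conv Cons_eq_append_conv split: list.split)
  then show ?thesis
    by (auto simp: tri_complex_def sectionA_def fun_eq_iff D N.act_zero split: list.split)
qed

lemma sectionB_tri:
  assumes v: "v \<in> cochains HL n"
  shows "sectionB v \<in> cochains TC n"
proof -
  note D = homL_cochainD[OF v]
  have "sectionB v \<in> tri_maps A B M N"
    by (rule tri_mapsI)
      (auto simp: sectionB_def D N.act_zero N.lact_add N.lact_add_left N.lact_scal N.lact_scal_left N.lact_mul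
        N.ract_lact N.act_altsign altsign_add append_eq_Cons_conv Cons_eq_append_conv split: list.split)
  then show ?thesis
    by (auto simp: tri_complex_def sectionB_def fun_eq_iff D N.act_zero split: list.split)
qed

definition edge_section :: "('a list \<Rightarrow> 'm \<Rightarrow> 'n) \<times> ('b list \<Rightarrow> 'm \<Rightarrow> 'n) \<Rightarrow> 'a list \<Rightarrow> 'b list \<Rightarrow> 'm \<Rightarrow> 'n" where
  "edge_section = (\<lambda>(u, v). sectionA u + sectionB v)"

lemma section_graded: "graded_map HC TC 0 edge_section"
  unfolding graded_map_def
proof (intro conjI allI ballI)
  fix n
  show "edge_section ` cochains HC n \<subseteq> cochains TC (n + 0)"
    using sectionA_tri sectionB_tri cochain_complex.add_cochain[OF cochain_complex_tri]
    by (auto simp: edge_section_def cprod_def)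
qed (auto simp: edge_section_def sectionA_def sectionB_def cprod_def hochschild_def tri_complex_def
    homR_bimod_def homL_bimod_def fun_eq_iff N.ract_add N.lact_add altsign_add N.ract_scal N.lact_scal
    N.mscal_add N.act_altsign N.act_zero split: list.split)

lemma i_section:
  assumes "(u, v) \<in> cochains HC n"
  shows "iA B (edge_section (u, v)) = u" "iB A (edge_section (u, v)) = v"
proof -
  have u: "u \<in> cochains HR n"
    and v: "v \<in> cochains HL n"
    using assms by (auto simp: cprod_def)
  \<comment> \<open>The edges meet in the pairs of one-entry lists, the discarded degree -1.
    Hochschild cochains vanish on one-entry lists, so each section is invisible to the other
    restriction.\<close>
  have 0: "u [a] m = 0" "v [b] m = 0" for a b m
    using homR_cochainD(1)[OF u, of "[a]" m] homL_cochainD(1)[OF v, of "[b]" m] by auto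
  show "iA B (edge_section (u, v)) = u"
    by (auto simp: fun_eq_iff iA_def edge_section_def sectionA_def sectionB_def 0 N.act_zero N.ract_one split: list.split)
  show "iB A (edge_section (u, v)) = v"
  proof (intro ext)
    fix bs m
    have "sectionA u [aone A] (rev bs) m = 0"
      by (auto simp: sectionA_def 0 N.act_zero split: list.split)
    then show "iB A (edge_section (u, v)) bs m = v bs m"
      by (simp add: iB_revsign edge_section_def sectionB_def N.lact_one altsign_twice)
  qed
qed

lemma split_Sigma:
  "split_chain_map TC HC (\<lambda>c. (iA B c, iB A c)) edge_section"
proof -
  interpret tri: cochain_complex "TC" by (rule cochain_complex_tri)
  interpret hom: cochain_complex "HC" by (rule cochain_complex_hom)
  show ?thesis
  proof
    show "chain_map TC HC (\<lambda>c. (iA B c, iB A c))"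
      using chain_map_iA chain_map_iB
      by (auto simp: chain_map_def graded_map_def cprod_def image_subset_iff)
    show "graded_map HC TC 0 edge_section"
      by (rule section_graded)
  qed (use i_section in force)
qed

end

section \<open>The cone of one bimodule and a section of its defining map\<close>

context bimod_over begin

sublocale self: bimod_pair A B M M by unfold_locales

abbreviation "HA \<equiv> hochschild_self A"
abbreviation "HB \<equiv> hochschild_self B"

lemma hoch_coeff_regular: "kalg T \<Longrightarrow> hoch_coeff T UNIV (regular T)"
  unfolding hoch_coeff_def hoch_coeff_axioms_def regular_def
  by (simp add: kalg.amul_add_left kalg.amul_add_right kalg.ascal_add kalg.amul_scal_left
      kalg.amul_scal_right kalg.ascal_commute)

lemmas cochain_complex_A = hoch_coeff.cochain_complex_hochschild[OF hoch_coeff_regular[OF A.kalg_axioms]]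
lemmas cochain_complex_B = hoch_coeff.cochain_complex_hochschild[OF hoch_coeff_regular[OF B.kalg_axioms]]

lemma chain_map_alpha: "chain_map HA self.HR (alphaM M)"
  unfolding chain_map_def graded_map_def
proof (intro conjI allI ballI)
  fix n
  show "alphaM M ` cochains HA n \<subseteq> cochains self.HR (n + 0)"
    by (auto simp: hochschild_def hoch_cochains_def alphaM_def fun_eq_iff act_zero homR_def lact_add ract_lact
        multilinear_iff lact_add_left regular_def homR_bimod_def lact_scal_left lact_mul)
next
  fix n f
  show "alphaM M (diff HA f) = diff self.HR (alphaM M f)"
  proof (intro ext)
    fix xs m
    show "alphaM M (diff HA f) xs m = diff self.HR (alphaM M f) xs m"
      using bar_diff_additive[of "\<lambda>a. lact M a m" A f xs, OF lact_add_left]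
      by (simp add: hochschild_def bar_diff_apply[of A "alphaM M f"] alphaM_def)
  qed
qed (auto simp: hochschild_def alphaM_def fun_eq_iff lact_add_left regular_def homR_bimod_def lact_scal_left)

lemma chain_map_beta: "chain_map HB self.HL (betaM M)"
  unfolding chain_map_def graded_map_def
proof (intro conjI allI ballI)
  fix n
  show "betaM M ` cochains HB n \<subseteq> cochains self.HL (n + 0)"
    by (auto simp: hochschild_def hoch_cochains_def betaM_def fun_eq_iff act_zero homL_def ract_add ract_lact
        multilinear_iff ract_add_right regular_def homL_bimod_def ract_scal_right ract_mul)
next
  fix n f
  show "betaM M (diff HB f) = diff self.HL (betaM M f)"
  proof (intro ext)
    fix xs m
    show "betaM M (diff HB f) xs m = diff self.HL (betaM M f) xs m"
      using bar_diff_additive[of "\<lambda>a. ract M m a" B f xs, OF ract_add_right]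
      by (simp add: hochschild_def bar_diff_apply[of B "betaM M f"] betaM_def)
  qed
qed (auto simp: hochschild_def betaM_def fun_eq_iff ract_add_right regular_def homL_bimod_def ract_scal_right)

abbreviation "C_source \<equiv> HA \<times>\<^sub>c self.TC \<times>\<^sub>c HB"
abbreviation "lam \<equiv> \<lambda>(f, c, g). (alphaM M f + iA B c, betaM M g + iB A c)"

text \<open>The two restrictions already reach every pair of edge cochains, so the section can live
  in the triangular factor alone. The retraction then leaves the Hochschild components of
  \<open>A\<close> and \<open>B\<close> unchanged, which is needed for the kernel of the projection
  to \<open>N\<close>.\<close>

lemma split_C:
  "split_chain_map C_source self.HC lam (\<lambda>w. (0, self.edge_section w, 0))"
proof -
  interpret S: split_chain_map "self.TC" "self.HC" "\<lambda>c. (iA B c, iB A c)" self.edge_section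
    by (rule self.split_Sigma)
  interpret src: cochain_complex C_source
    by (intro cochain_complex_cprod cochain_complex_A cochain_complex_B S.X.cochain_complex_axioms)
  interpret R: cochain_complex "self.HR" by (rule self.cochain_complex_homR)
  interpret L: cochain_complex "self.HL" by (rule self.cochain_complex_homL)
  interpret A':  cochain_complex "HA" by (rule cochain_complex_A)
  interpret B':  cochain_complex "HB" by (rule cochain_complex_B)
  have a: "alphaM M f \<in> cochains self.HR n"
    "alphaM M (f + f') = alphaM M f + alphaM M f'"
    "alphaM M (cscal HA k f) = cscal self.HR k (alphaM M f)"
    "alphaM M (diff HA f) = diff self.HR (alphaM M f)"
    if "f \<in> cochains HA n" "f' \<in> cochains HA n" for f f' n k
    using chain_map_alpha that by (auto simp: chain_map_def graded_map_def)
  have b: "betaM M g \<in> cochains self.HL n"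
    "betaM M (g + g') = betaM M g + betaM M g'"
    "betaM M (cscal HB k g) = cscal self.HL k (betaM M g)"
    "betaM M (diff HB g) = diff self.HL (betaM M g)"
    if "g \<in> cochains HB n" "g' \<in> cochains HB n" for g g' n k
    using chain_map_beta that by (auto simp: chain_map_def graded_map_def)
  have i: "iA B c \<in> cochains self.HR n"
    "iA B (c + c') = iA B c + iA B c'"
    "iA B (cscal self.TC k c) = cscal self.HR k (iA B c)"
    "iA B (diff self.TC c) = diff self.HR (iA B c)"
    "iB A c \<in> cochains self.HL n"
    "iB A (c + c') = iB A c + iB A c'"
    "iB A (cscal self.TC k c) = cscal self.HL k (iB A c)"
    "iB A (diff self.TC c) = diff self.HL (iB A c)"
    if "c \<in> cochains self.TC n" "c' \<in> cochains self.TC n" for c c' n k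
    using self.chain_map_iA self.chain_map_iB that
    by (auto simp: chain_map_def graded_map_def image_subset_iff)
  show ?thesis
  proof
    show "chain_map C_source self.HC lam"
      unfolding chain_map_def graded_map_def
    proof (intro conjI allI ballI)
      fix n show "lam ` cochains C_source n \<subseteq> cochains self.HC (n + 0)"
        using a b i R.add_cochain L.add_cochain by (auto simp: cprod_def)
    next
      fix n x y assume "x \<in> cochains C_source n" "y \<in> cochains C_source n"
      then show "lam (x + y) = lam x + lam y"
        by (auto simp: cprod_def a[where n=n] b[where n=n] i[where n=n])
    next
      fix n k x assume "x \<in> cochains C_source n"
      then show "lam (cscal C_source k x) = cscal self.HC k (lam x)"
        by (auto simp: cprod_def a[where n=n] b[where n=n] i[where n=n] R.scal_add[where n=n] L.scal_add[where n=n])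
    next
      fix n x assume "x \<in> cochains C_source n"
      then show "lam (diff C_source x) = diff self.HC (lam x)"
        by (auto simp: cprod_def a[where n=n] b[where n=n] i[where n=n] R.diff_add[where n=n] L.diff_add[where n=n])
    qed
    show "graded_map self.HC C_source 0 (\<lambda>w. (0, self.edge_section w, 0))"
      using self.section_graded A'.zero_cochain B'.zero_cochain A'.scal_zero B'.scal_zero
      unfolding graded_map_def by (auto simp: cprod_def image_subset_iff)
  next
    fix n y assume "y \<in> cochains self.HC n"
    moreover have "alphaM M 0 = 0" "betaM M 0 = 0"
      by (auto simp: alphaM_def betaM_def fun_eq_iff act_zero)
    ultimately show "lam (0, self.edge_section y, 0) = y"
      using self.i_section by (cases y) simp
  qed
qed

sublocale C: split_chain_map C_source "self.HC" lam "\<lambda>w. (0, self.edge_section w, 0)"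
  by (rule split_C)

lemma C_complex_cone: "C_complex A B M = cone C_source self.HC lam"
  by (simp add: C_complex_def)

lemma cochain_complex_C: "cochain_complex (C_complex A B M)"
  unfolding C_complex_def
  by (rule cochain_complex_cone[OF C.X.cochain_complex_axioms C.Y.cochain_complex_axioms C.chain])

end

section \<open>The Hochschild complex of the triangular algebra\<close>

lemma bar_diff_map:
  assumes "\<And>x y. amul S (\<phi> x) (\<phi> y) = \<phi> (amul T x y)"
  shows "bar_diff S F (map \<phi> xs) = bar_diff T (\<lambda>xs. F (map \<phi> xs)) xs"
  by (induction xs arbitrary: F rule: induct_list012) (auto simp: assms)

text \<open>\<open>splits w ts\<close> is the sum of \<open>w us t vs\<close> over all decompositions \<open>ts = us @ t # vs\<close>.\<close>

fun splits :: "('t list \<Rightarrow> 't \<Rightarrow> 't list \<Rightarrow> 'v::ab_group_add) \<Rightarrow> 't list \<Rightarrow> 'v" where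
  "splits w [] = 0"
| "splits w (t # ts) = w [] t ts + splits (\<lambda>us. w (t # us)) ts"

lemma splits_cong:
  assumes "\<And>us t vs. ts = us @ t # vs \<Longrightarrow> w us t vs = w' us t vs"
  shows "splits w ts = splits w' ts"
  using assms
proof (induction ts arbitrary: w w')
  case (Cons t ts)
  have "splits (\<lambda>us. w (t # us)) ts = splits (\<lambda>us. w' (t # us)) ts"
    by (rule Cons.IH) (simp add: Cons.prems)
  then show ?case using Cons.prems[of "[]"] by simp
qed simp

lemma splits_append:
  "splits w (us @ vs) = splits (\<lambda>a t b. w a t (b @ vs)) us + splits (\<lambda>a. w (us @ a)) vs"
  by (induction us arbitrary: w) (auto simp: add.assoc)

lemma splits_map: "splits w (map \<phi> ts) = splits (\<lambda>us t vs. w (map \<phi> us) (\<phi> t) (map \<phi> vs)) ts"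
  by (induction ts arbitrary: w) auto

lemma splits_add: "splits (\<lambda>us t vs. w us t vs + w' us t vs) ts = splits w ts + splits w' ts"
  by (induction ts arbitrary: w w') (auto simp: algebra_simps)

lemma splits_zero: "splits (\<lambda>us t vs. 0) ts = 0"
  by (induction ts) auto

lemma splits_additive:
  fixes h :: "'v::ab_group_add \<Rightarrow> 'w::ab_group_add"
  assumes h: "\<And>x y. h (x + y) = h x + h y"
  shows "splits (\<lambda>us t vs. h (w us t vs)) ts = h (splits w ts)"
  by (induction ts arbitrary: w) (auto simp: additive_zero[of h, OF h] h)

context bimod_over begin

abbreviation "CM \<equiv> C_complex A B M"
abbreviation "Tri \<equiv> triang A M B"

sublocale Tri: hoch_coeff Tri UNIV "regular Tri"
  by (rule hoch_coeff_regular, rule kalg.intro, rule kalgebra_triang)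
    (rule A.alg B.alg bimod)+

definition tA :: "'a \<Rightarrow> 'a \<times> 'm \<times> 'b" where "tA a = (a, 0, 0)"
definition tM :: "'m \<Rightarrow> 'a \<times> 'm \<times> 'b" where "tM m = (0, m, 0)"
definition tB :: "'b \<Rightarrow> 'a \<times> 'm \<times> 'b" where "tB b = (0, 0, b)"

abbreviation pM :: "'a \<times> 'm \<times> 'b \<Rightarrow> 'm" where "pM t \<equiv> fst (snd t)"
abbreviation pB :: "'a \<times> 'm \<times> 'b \<Rightarrow> 'b" where "pB t \<equiv> snd (snd t)"

lemma amul_Tri: "amul Tri t t' = (amul A (fst t) (fst t'), lact M (fst t) (pM t') + ract M (pM t) (pB t'), amul B (pB t) (pB t'))"
  by (simp add: triang_def split_beta)

lemma ascal_Tri: "ascal Tri k t = (ascal A k (fst t), mscal M k (pM t), ascal B k (pB t))"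
  by (simp add: triang_def split_beta)

lemma amul_sel: "fst (amul Tri t t') = amul A (fst t) (fst t')"
  "pM (amul Tri t t') = lact M (fst t) (pM t') + ract M (pM t) (pB t')"
  "pB (amul Tri t t') = amul B (pB t) (pB t')"
  and ascal_sel: "fst (ascal Tri k t) = ascal A k (fst t)" "pM (ascal Tri k t) = mscal M k (pM t)"
  "pB (ascal Tri k t) = ascal B k (pB t)"
  by (simp_all add: amul_Tri ascal_Tri)

lemma aone_Tri: "aone Tri = (aone A, 0, aone B)"
  by (simp add: triang_def)

lemmas zeros = A.amul_zero B.amul_zero act_zero A.ascal_zero B.ascal_zero

lemma t_sel [simp]: "fst (tA a) = a" "pM (tA a) = 0" "pB (tA a) = 0" "fst (tM m) = 0" "pM (tM m) = m" "pB (tM m) = 0"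
  "fst (tB b) = 0" "pM (tB b) = 0" "pB (tB b) = b"
  by (simp_all add: tA_def tM_def tB_def)

lemma t_add: "tA (a + a') = tA a + tA a'" "tM (m + m') = tM m + tM m'" "tB (b + b') = tB b + tB b'"
  by (simp_all add: tA_def tM_def tB_def)

lemma t_scal: "tA (ascal A k a) = ascal Tri k (tA a)" "tM (mscal M k m) = ascal Tri k (tM m)"
  "tB (ascal B k b) = ascal Tri k (tB b)"
  by (simp_all add: tA_def tM_def tB_def ascal_Tri zeros)

lemma t_mul: "amul Tri (tA a) (tA a') = tA (amul A a a')" "amul Tri (tA a) (tM m) = tM (lact M a m)"
  "amul Tri (tM m) (tB b) = tM (ract M m b)" "amul Tri (tB b) (tB b') = tB (amul B b b')"
  by (simp_all add: tA_def tM_def tB_def amul_Tri zeros)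

abbreviation "eA \<equiv> tA (aone A)"
abbreviation "eB \<equiv> tB (aone B)"

lemma idempotents: "amul Tri eA eA = eA" "amul Tri eB eB = eB" "eA + eB = aone Tri"
  by (simp_all add: t_mul A.amul_one B.amul_one) (simp add: tA_def tB_def aone_Tri)

lemma relative_zero: "relative T e f x (\<lambda>_. 0) ts = 0"
  by (induction ts arbitrary: x rule: induct_list012) auto

text \<open>Nothing leads from \<open>eB\<close> back to \<open>eA\<close>: the lower left corner of
  the triangular algebra is zero, so one of the two summands dies at every gap.\<close>

lemma relative_B:
  assumes "multiadditive F"
  shows "relative Tri eA eB eB F (t # ts) = F (map (\<lambda>t. tB (pB t)) (t # ts))"
  using assms
proof (induction ts arbitrary: t F)
  case Nil
  have "amul Tri eB t = tB (pB t)"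
    by (simp add: amul_Tri zeros B.amul_one tB_def)
  then show ?case by simp
next
  case (Cons t' ts)
  have "amul Tri (amul Tri eB t) eA = 0" "amul Tri (amul Tri eB t) eB = tB (pB t)"
    by (simp_all add: amul_Tri zeros B.amul_one tB_def zero_prod_def)
  moreover have "F (0 # ys) = 0" for ys
    using multiadditive_zero[OF Cons.prems, of "[]"] by simp
  ultimately show ?case
    using Cons.IH[OF multiadditive_Cons[OF Cons.prems]] by (simp add: relative_zero)
qed

text \<open>From \<open>eA\<close> each gap either stays with \<open>eA\<close>, giving a diagonal
  entry of \<open>A\<close>, or passes to \<open>eB\<close> through an entry of \<open>M\<close>,
  after which only \<open>B\<close> remains. \<open>splits\<close> sums over the place of this
  passage.\<close>

lemma relative_A:
  assumes "multiadditive F"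
  shows "relative Tri eA eB eA F (t # ts) = F (map (\<lambda>t. tA (fst t)) (t # ts)) +
    splits (\<lambda>us t vs. F (map (\<lambda>t. tA (fst t)) us @ tM (pM t) # map (\<lambda>t. tB (pB t)) vs)) (t # ts)"
  using assms
proof (induction ts arbitrary: t F)
  case Nil
  have "amul Tri eA t = tA (fst t) + tM (pM t)"
    by (simp add: amul_Tri zeros A.amul_one lact_one tA_def tM_def)
  then show ?case by (simp add: multiadditive_hd[OF Nil])
next
  case (Cons t' ts)
  have "amul Tri (amul Tri eA t) eA = tA (fst t)" "amul Tri (amul Tri eA t) eB = tM (pM t)"
    by (simp_all add: amul_Tri zeros A.amul_one lact_one ract_one tA_def tM_def)
  then show ?case
    using Cons.IH[OF multiadditive_Cons[OF Cons.prems]] relative_B[OF multiadditive_Cons[OF Cons.prems]]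
    by (simp add: algebra_simps)
qed

lemma relative_one:
  assumes F: "multiadditive F"
  shows "relative Tri eA eB (aone Tri) F (t # ts) = F (map (\<lambda>t. tA (fst t)) (t # ts)) +
    splits (\<lambda>us t vs. F (map (\<lambda>t. tA (fst t)) us @ tM (pM t) # map (\<lambda>t. tB (pB t)) vs)) (t # ts) +
    F (map (\<lambda>t. tB (pB t)) (t # ts))"
proof (cases ts)
  case Nil
  have "amul Tri (aone Tri) t = tA (fst t) + tM (pM t) + tB (pB t)"
    by (simp add: Tri.amul_one tA_def tM_def tB_def)
  then show ?thesis by (simp add: Nil multiadditive_hd[OF F])
next
  case (Cons t' ts')
  \<comment> \<open>The first entry is cut on the right only. Its part before \<open>eB\<close> has
    a corner and a \<open>B\<close> summand: they begin the decomposition at the first place and the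
    term purely over \<open>B\<close>.\<close>
  have "amul Tri (amul Tri (aone Tri) t) eA = tA (fst t)"
    "amul Tri (amul Tri (aone Tri) t) eB = tM (pM t) + tB (pB t)"
    unfolding Tri.amul_one
    by (simp_all add: amul_Tri zeros A.amul_one B.amul_one lact_one ract_one tA_def tM_def tB_def)
  then show ?thesis
    unfolding Cons
    using relative_A[OF multiadditive_Cons[OF F, of "tA (fst t)"], of t' ts']
      relative_B[OF multiadditive_Cons[OF F, of "tM (pM t) + tB (pB t)"], of t' ts']
    by (simp add: multiadditive_hd[OF F] algebra_simps)
qed

subsection \<open>Restriction to the relative complex\<close>

definition restrA :: "(('a \<times> 'm \<times> 'b) list \<Rightarrow> 'a \<times> 'm \<times> 'b) \<Rightarrow> 'a list \<Rightarrow> 'a" where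
  "restrA F as = fst (F (map tA as))"

definition restrB :: "(('a \<times> 'm \<times> 'b) list \<Rightarrow> 'a \<times> 'm \<times> 'b) \<Rightarrow> 'b list \<Rightarrow> 'b" where
  "restrB F bs = pB (F (map tB bs))"

text \<open>The reversal of the second list carries the sign of \<open>iB\<close>; the additional sign puts the restriction of a
  Hochschild cochain into the kernel of the map whose cone is \<open>\<C>{M}\<close>.\<close>

definition restrM :: "(('a \<times> 'm \<times> 'b) list \<Rightarrow> 'a \<times> 'm \<times> 'b) \<Rightarrow> 'a list \<Rightarrow> 'b list \<Rightarrow> 'm \<Rightarrow> 'm" where
  "restrM F xs ys m = (if xs = [] \<or> ys = [] then 0 else - altsign (revsign (length ys))
     (pM (F (map tA (butlast xs) @ tM (ract M (lact M (last xs) m) (last ys)) # map tB (rev (butlast ys))))))"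

definition "restr F = (restrA F, restrM F, restrB F)"

abbreviation "HT \<equiv> hochschild_self Tri"

lemmas cochain_complex_HT = Tri.cochain_complex_hochschild

sublocale HT: cochain_complex HT by (rule cochain_complex_HT)

lemma HT_D:
  assumes "F \<in> cochains HT n"
  shows "\<not> (0 \<le> n \<and> int (length ts) = n + 2) \<Longrightarrow> F ts = 0"
    and "F (us @ (x + y) # vs) = F (us @ x # vs) + F (us @ y # vs)"
    and "F (us @ ascal Tri k x # vs) = ascal Tri k (F (us @ x # vs))"
    and "F (amul Tri t x # ts) = amul Tri t (F (x # ts))"
    and "F (ts @ [amul Tri x t]) = amul Tri (F (ts @ [x])) t"
    and "multiadditive F"
  using assms
  by (simp_all add: hochschild_def hoch_cochains_def multilinear_iff multiadditive_def regular_def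
      del: split_paired_All)

text \<open>By balancedness the last entries of both lists act on \<open>m\<close>, so the three
  form a single corner entry: two lists with n + 3 entries in all give one list with n + 2.\<close>

lemma restrM_snoc:
  "restrM F (us @ [a]) (vs @ [b]) m = - altsign (revsign (Suc (length vs)))
     (pM (F (map tA us @ tM (ract M (lact M a m) b) # map tB (rev vs))))"
  by (simp add: restrM_def)

lemma restrM_tri:
  assumes F: "F \<in> cochains HT n"
  shows "restrM F \<in> cochains self.TC n"
proof -
  note D = HT_D[OF F]
  have "restrM F \<in> tri_maps A B M M"
  proof (rule self.tri_mapsI)
    fix us vs xs :: "'a list" and us' vs' ys :: "'b list" and x x' a :: 'a and y y' b :: 'b and m m' :: 'm and k :: 'k
    \<comment> \<open>The slot is either an entry of its own or the last one, which sits inside the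
      corner entry; the same distinction recurs for the other slots.\<close>
    show "restrM F (us @ (x + x') # vs) ys m = restrM F (us @ x # vs) ys m + restrM F (us @ x' # vs) ys m"
      by (cases vs rule: rev_cases)
        (simp_all add: restrM_def butlast_append lact_add_left ract_add t_add D(2) altsign_add)
    show "restrM F (us @ ascal A k x # vs) ys m = mscal M k (restrM F (us @ x # vs) ys m)"
      by (cases vs rule: rev_cases)
        (simp_all add: restrM_def butlast_append lact_scal_left ract_scal t_scal D(3) ascal_sel act_altsign act_uminus zeros)
    show "restrM F xs (us' @ (y + y') # vs') m = restrM F xs (us' @ y # vs') m + restrM F xs (us' @ y' # vs') m"
    proof (cases vs' rule: rev_cases)
      case (snoc vs'' z)
      show ?thesis
        using D(2)[of "map tA (butlast xs) @ tM (ract M (lact M (last xs) m) z) # map tB (rev vs'')" "tB y" "tB y'" "map tB (rev us')"]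
        by (simp add: snoc restrM_def butlast_append t_add altsign_add)
    qed (simp add: restrM_def butlast_append ract_add_right t_add D(2) altsign_add)
    show "restrM F xs (us' @ ascal B k y # vs') m = mscal M k (restrM F xs (us' @ y # vs') m)"
    proof (cases vs' rule: rev_cases)
      case (snoc vs'' z)
      show ?thesis
        using D(3)[of "map tA (butlast xs) @ tM (ract M (lact M (last xs) m) z) # map tB (rev vs'')" k "tB y" "map tB (rev us')"]
        by (simp add: snoc restrM_def butlast_append t_scal ascal_sel act_altsign act_uminus zeros)
    qed (simp add: restrM_def butlast_append ract_scal_right t_scal D(3) ascal_sel act_altsign act_uminus zeros)
    show "restrM F xs ys (m + m') = restrM F xs ys m + restrM F xs ys m'"
      by (simp add: restrM_def lact_add ract_add t_add D(2) altsign_add)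
    show "restrM F xs ys (mscal M k m) = mscal M k (restrM F xs ys m)"
      by (simp add: restrM_def lact_scal ract_scal t_scal D(3) ascal_sel act_altsign act_uminus zeros)
    show "restrM F (amul A a x # xs) ys m = lact M a (restrM F (x # xs) ys m)"
      by (cases xs rule: rev_cases)
        (simp_all add: restrM_def butlast_append lact_mul ract_lact t_mul(1,2)[symmetric] D(4) amul_sel act_altsign act_uminus zeros)
    show "restrM F xs (amul B y b # ys) m = ract M (restrM F xs (y # ys) m) b"
    proof (cases ys rule: rev_cases)
      case Nil
      then show ?thesis
        by (simp add: restrM_def ract_mul t_mul(3)[symmetric] D(5) amul_sel act_altsign act_uminus zeros)
    next
      case (snoc vs z)
      show ?thesis
        using D(5)[of "map tA (butlast xs) @ tM (ract M (lact M (last xs) m) z) # map tB (rev vs)" "tB y" "tB b"]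
        by (simp add: snoc restrM_def butlast_append t_mul amul_sel act_altsign act_uminus zeros)
    qed
    show "restrM F (xs @ [amul A x a]) ys m = restrM F (xs @ [x]) ys (lact M a m)"
      by (simp add: restrM_def lact_mul)
    show "restrM F xs (ys @ [amul B b y]) m = restrM F xs (ys @ [y]) (ract M m b)"
      by (simp add: restrM_def ract_mul ract_lact)
  qed
  moreover have "restrM F xs ys = 0"
    if "\<not> (0 \<le> n \<and> 1 \<le> length xs \<and> 1 \<le> length ys \<and> int (length xs) + int (length ys) = n + 3)" for xs ys
  proof (cases "xs = [] \<or> ys = []")
    case False
    then obtain us a vs b where xs: "xs = us @ [a]" "ys = vs @ [b]" by (metis rev_exhaust)
    have "F (map tA us @ tM w # map tB (rev vs)) = 0" for w
      by (rule D(1)) (use that in \<open>auto simp: xs\<close>)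
    then show ?thesis by (simp add: fun_eq_iff xs restrM_snoc)
  qed (auto simp: fun_eq_iff restrM_def)
  ultimately show ?thesis by (simp add: tri_complex_def)
qed

lemma restrA_cochain:
  assumes F: "F \<in> cochains HT n"
  shows "restrA F \<in> cochains HA n"
proof -
  note D = HT_D[OF F]
  show ?thesis
    unfolding hochschild_def hoch_cochains_def multilinear_iff regular_def
    by (simp add: restrA_def t_add t_scal t_mul(1)[symmetric] amul_sel ascal_sel D)
qed

lemma restrB_cochain:
  assumes F: "F \<in> cochains HT n"
  shows "restrB F \<in> cochains HB n"
proof -
  note D = HT_D[OF F]
  show ?thesis
    unfolding hochschild_def hoch_cochains_def multilinear_iff regular_def
    by (simp add: restrB_def t_add t_scal t_mul(4)[symmetric] amul_sel ascal_sel D)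
qed

lemma restr_cochain: "F \<in> cochains HT n \<Longrightarrow> restr F \<in> cochains C_source n"
  by (simp add: restr_def cprod_def restrA_cochain restrB_cochain restrM_tri)

text \<open>If the corner entry is the last one, right linearity over the triangular algebra pulls
  \<open>tM m\<close> out of \<open>F\<close>, leaving the value of \<open>F\<close> on a list over
  \<open>A\<close> acting on \<open>m\<close>; the extra sign in \<open>restrM\<close> makes this
  cancel \<open>alphaM\<close>. If the corner entry comes first, the mirror argument cancels
  \<open>betaM\<close>.\<close>

lemma lam_restr:
  assumes F: "F \<in> cochains HT n"
  shows "lam (restr F) = 0"
proof -
  note D = HT_D[OF F]
  have "alphaM M (restrA F) xs m + iA B (restrM F) xs m = 0" for xs m
  proof (cases xs rule: rev_cases)
    case (snoc us x)
    show ?thesis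
      using D(5)[of "map tA us" "tA x" "tM m"]
      by (simp add: snoc alphaM_def restrA_def iA_def restrM_def ract_one t_mul amul_sel zeros altsign_def)
  qed (simp add: alphaM_def restrA_def iA_def restrM_def D(1) zeros)
  moreover have "betaM M (restrB F) bs m + iB A (restrM F) bs m = 0" for bs m
  proof (cases bs)
    case (Cons b bs')
    show ?thesis
      using D(4)[of "tM m" "tB b" "map tB bs'"]
      by (simp add: Cons betaM_def restrB_def self.iB_revsign restrM_def lact_one t_mul amul_sel zeros altsign_minus altsign_twice)
  qed (simp add: betaM_def restrB_def self.iB_revsign restrM_def D(1) zeros)
  ultimately show ?thesis
    by (simp add: restr_def zero_prod_def fun_eq_iff)
qed

text \<open>Merging the corner entry with its left neighbour amounts to merging the last two entries
  over \<open>A\<close> before the last one is absorbed. This lemma and its mirror image identify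
  the two halves of the bar differential around the corner entry with the two differentials of the
  triangular complex.\<close>

lemma bar_diff_A_M:
  "bar_diff Tri G (map tA us @ [tM (lact M a m)]) =
     bar_diff A (\<lambda>xs. G (map tA (butlast xs) @ [tM (lact M (last xs) m)])) (us @ [a])"
proof (induction us arbitrary: G)
  case (Cons u us)
  show ?case
  proof (cases us)
    case Nil
    then show ?thesis by (simp add: t_mul lact_mul)
  next
    case (Cons u' us')
    have "bar_diff A (\<lambda>ys. G (map tA (butlast (u # ys)) @ [tM (lact M (last (u # ys)) m)])) (us @ [a]) =
        bar_diff A (\<lambda>ys. G (tA u # map tA (butlast ys) @ [tM (lact M (last ys) m)])) (us @ [a])"
      by (rule bar_diff_cong) simp
    then show ?thesis
      using Cons.IH[of "\<lambda>ys. G (tA u # ys)"] Cons by (simp add: t_mul del: butlast.simps last.simps) simp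
  qed
qed simp

lemma bar_diff_M_B:
  "bar_diff Tri G (tM (ract M m b) # map tB bs) =
     bar_diff B (\<lambda>bs. G (tM (ract M m (hd bs)) # map tB (tl bs))) (b # bs)"
  using bar_diff_map[of Tri tB B "\<lambda>ys. G (tM (ract M m b) # ys)" bs]
  by (cases bs) (auto simp: t_mul ract_mul)

lemma restr_diff:
  assumes F: "F \<in> cochains HT n"
  shows "restr (diff HT F) = diff C_source (restr F)"
proof -
  have "restrA (bar_diff Tri F) = bar_diff A (restrA F)"
    by (simp add: fun_eq_iff restrA_def[abs_def] bar_diff_map[of Tri tA A, OF t_mul(1)]
        bar_diff_additive[of fst, symmetric])
  moreover have "restrB (bar_diff Tri F) = bar_diff B (restrB F)"
    by (simp add: fun_eq_iff restrB_def[abs_def] bar_diff_map[of Tri tB B, OF t_mul(4)]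
        bar_diff_additive[of "\<lambda>x. pB x", symmetric])
  moreover have "restrM (bar_diff Tri F) xs ys m = tri_diff A B (restrM F) xs ys m" for xs ys m
  proof (cases "xs = [] \<or> ys = []")
    case True
    then show ?thesis
      by (auto simp: restrM_def tri_diff_def bar_diff_zero)
  next
    case False
    then obtain us a vs b where xs: "xs = us @ [a]" and ys: "ys = vs @ [b]" by (metis rev_exhaust)
    have padd: "pM (s + t) = pM s + pM t" for s t by simp
    let ?s = "altsign (revsign (length ys))"
    let ?g = "\<lambda>bs. F (map tA us @ tM (ract M (lact M a m) (hd bs)) # map tB (tl bs))"
    let ?G = "\<lambda>xs. F (map tA (butlast xs) @ tM (lact M (last xs) (ract M m b)) # map tB (rev vs))"
    have split: "bar_diff Tri F (map tA us @ tM (ract M (lact M a m) b) # map tB (rev vs)) =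
        bar_diff A ?G xs + altsign (length us) (bar_diff B ?g (rev ys))"
      unfolding bar_diff_append[of Tri F "map tA us" "tM (ract M (lact M a m) b)"] bar_diff_M_B
      by (simp add: ract_lact bar_diff_A_M xs ys)
    have 1: "bar_diff A (\<lambda>xs'. restrM F xs' ys m) xs = - ?s (pM (bar_diff A ?G xs))"
    proof -
      have "bar_diff A (\<lambda>xs'. restrM F xs' ys m) xs = bar_diff A (\<lambda>xs'. - ?s (pM (?G xs'))) xs"
        by (rule bar_diff_cong) (simp add: restrM_def ys ract_lact)
      then show ?thesis
        by (simp add: bar_diff_uminus bar_diff_altsign bar_diff_additive[of "\<lambda>x. pM x", OF padd])
    qed
    have "bar_diff (opp B) (\<lambda>ys'. restrM F xs ys' m) ys =
        bar_diff (opp B) (\<lambda>ys'. - altsign (revsign (length ys - 1)) (pM (?g (rev ys')))) ys"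
    proof (rule bar_diff_cong)
      fix ys' :: "'b list" assume l: "Suc (length ys') = length ys" and "ys' \<noteq> []"
      then obtain vs' b' where "ys' = vs' @ [b']" by (metis rev_exhaust)
      then show "restrM F xs ys' m = - altsign (revsign (length ys - 1)) (pM (?g (rev ys')))"
        by (simp add: l[symmetric] restrM_def xs)
    qed
    also have "\<dots> = - altsign (revsign (length ys - 1)) (altsign (length ys) (pM (bar_diff B ?g (rev ys))))"
      unfolding bar_diff_uminus bar_diff_altsign
      by (subst bar_diff_rev[of B "\<lambda>ys. pM (?g ys)"])
        (simp only: bar_diff_additive[of "\<lambda>x. pM x", OF padd])
    also have "\<dots> = - ?s (pM (bar_diff B ?g (rev ys)))"
    \<comment> \<open>A single entry leaves nothing to merge; otherwise
      \<open>altsign_revsign_Suc\<close> trades the sign for the shorter list against the sign from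
      reversal.\<close>
    proof (cases vs)
      case Nil
      then show ?thesis by (simp add: ys)
    next
      case (Cons v vs')
      then show ?thesis
        using altsign_revsign_Suc[of "length vs" "altsign (length ys) (pM (bar_diff B ?g (rev ys)))"]
        by (simp add: ys altsign_twice)
    qed
    finally have 2: "bar_diff (opp B) (\<lambda>ys'. restrM F xs ys' m) ys = - ?s (pM (bar_diff B ?g (rev ys)))" .
    have "restrM (bar_diff Tri F) xs ys m =
        - ?s (pM (bar_diff Tri F (map tA us @ tM (ract M (lact M a m) b) # map tB (rev vs))))"
      by (simp add: xs ys restrM_def)
    also have "\<dots> = - ?s (pM (bar_diff A ?G xs)) - ?s (altsign (length us) (pM (bar_diff B ?g (rev ys))))"
      unfolding split by (simp add: altsign_add altsign_additive[of "\<lambda>x. pM x", OF padd])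
    \<comment> \<open>\<open>length us\<close> and \<open>length xs + 1\<close> have the same
      parity.\<close>
    also have "\<dots> = tri_diff A B (restrM F) xs ys m"
      unfolding tri_diff_def 1 2 by (simp add: xs altsign_def)
    finally show ?thesis .
  qed
  ultimately show ?thesis
    by (simp add: restr_def hochschild_def cprod_def tri_complex_def fun_eq_iff)
qed

lemma restr_add: "restr (F + G) = restr F + restr G"
  by (simp add: restr_def restrA_def restrM_def restrB_def fun_eq_iff altsign_add)

lemma restr_scal: "restr (cscal HT k F) = cscal C_source k (restr F)"
  by (simp add: restr_def restrA_def restrM_def restrB_def fun_eq_iff hochschild_def tri_complex_def
      regular_def cprod_def ascal_sel act_altsign act_uminus zeros)

subsection \<open>Inflation from the relative complex\<close>

text \<open>Inverts \<open>restrM\<close> at one decomposition of the list: the appended units stand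
  for the last entries that the corner entry has absorbed.\<close>

definition infl_term :: "('a list \<Rightarrow> 'b list \<Rightarrow> 'm \<Rightarrow> 'm) \<Rightarrow> ('a \<times> 'm \<times> 'b) list \<Rightarrow> 'a \<times> 'm \<times> 'b \<Rightarrow> ('a \<times> 'm \<times> 'b) list \<Rightarrow> 'm" where
  "infl_term c us t vs = - altsign (revsign (Suc (length vs)))
     (c (map fst us @ [aone A]) (rev (map (\<lambda>t. pB t) vs) @ [aone B]) (pM t))"

definition infl :: "('a list \<Rightarrow> 'a) \<times> ('a list \<Rightarrow> 'b list \<Rightarrow> 'm \<Rightarrow> 'm) \<times> ('b list \<Rightarrow> 'b)
    \<Rightarrow> ('a \<times> 'm \<times> 'b) list \<Rightarrow> 'a \<times> 'm \<times> 'b" where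
  "infl = (\<lambda>(f, c, g) ts. (f (map fst ts), splits (infl_term c) ts, g (map (\<lambda>t. pB t) ts)))"

lemma infl_add: "infl (x + y) = infl x + infl y"
  by (cases x; cases y)
    (simp add: infl_def fun_eq_iff splits_add[symmetric] infl_term_def[abs_def] altsign_add)

lemma infl_zero: "infl 0 = 0"
  by (rule additive_zero[of infl, OF infl_add])

lemma infl_minus: "infl (x - y) = infl x - infl y"
  by (rule additive_minus[of infl, OF infl_add])

lemma infl_scal: "infl (cscal C_source k x) = cscal HT k (infl x)"
proof -
  obtain f c g where x: "x = (f, c, g)" by (cases x)
  show ?thesis
    by (simp add: x infl_def fun_eq_iff cprod_def hochschild_def tri_complex_def regular_def ascal_Tri
        splits_additive[of "mscal M k", OF mscal_add, symmetric] infl_term_def[abs_def] act_altsign act_uminus)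
qed

lemma infl_cochain:
  assumes x: "x \<in> cochains C_source n" and k: "lam x = 0"
  shows "infl x \<in> cochains HT n"
proof -
  obtain f c g where X: "x = (f, c, g)" by (cases x)
  have f: "f \<in> cochains HA n" and c: "c \<in> cochains self.TC n"
    and g: "g \<in> cochains HB n"
    using x by (auto simp: X cprod_def)
  have fD: "\<And>xs. \<not> (0 \<le> n \<and> int (length xs) = n + 2) \<Longrightarrow> f xs = 0"
    "\<And>us x y vs. f (us @ (x + y) # vs) = f (us @ x # vs) + f (us @ y # vs)"
    "\<And>us k x vs. f (us @ ascal A k x # vs) = ascal A k (f (us @ x # vs))"
    "\<And>t x xs. f (amul A t x # xs) = amul A t (f (x # xs))"
    "\<And>t x xs. f (xs @ [amul A x t]) = amul A (f (xs @ [x])) t"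
    using f by (auto simp: hochschild_def hoch_cochains_def multilinear_iff regular_def)
  have gD: "\<And>xs. \<not> (0 \<le> n \<and> int (length xs) = n + 2) \<Longrightarrow> g xs = 0"
    "\<And>us x y vs. g (us @ (x + y) # vs) = g (us @ x # vs) + g (us @ y # vs)"
    "\<And>us k x vs. g (us @ ascal B k x # vs) = ascal B k (g (us @ x # vs))"
    "\<And>t x xs. g (amul B t x # xs) = amul B t (g (x # xs))"
    "\<And>t x xs. g (xs @ [amul B x t]) = amul B (g (xs @ [x])) t"
    using g by (auto simp: hochschild_def hoch_cochains_def multilinear_iff regular_def)
  note D = self.tri_mapsD[OF self.tri_cochainD(1)[OF c]] and Z = self.tri_cochainD(2)[OF c]
  have kA: "c xs [aone B] m = - lact M (f xs) m" for xs m
    \<comment> \<open>The kernel condition read on the two edges: up to the sign of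
      \<open>iB\<close>, \<open>c\<close> is there the negative of the action of \<open>f\<close>,
      respectively of \<open>g\<close>.\<close>
    using fun_cong[OF fun_cong[OF arg_cong[OF k, of fst]], of xs m]
    by (simp add: X alphaM_def iA_def minus_unique add_eq_0_iff2)
  have kB: "altsign (revsign (length bs)) (c [aone A] (rev bs) m) = - ract M m (g bs)" for bs m
    using fun_cong[OF fun_cong[OF arg_cong[OF k, of snd]], of bs m]
    by (simp add: X betaM_def self.iB_revsign minus_unique add_eq_0_iff2)
  have balA: "c (us @ [aone A]) ys (lact M a m) = c (us @ [a]) ys m" for us ys a m
    using D(9)[of us "aone A" a ys m] by (simp add: A.amul_one)
  have balB: "c xs (vs @ [aone B]) (ract M m b) = c xs (vs @ [b]) m" for xs vs b m
    using D(10)[of xs vs b "aone B" m] by (simp add: B.amul_one)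
  have oneA: "c [aone A] ys (lact M a m) = lact M a (c [aone A] ys m)" for ys a m
    using balA[of "[]" ys a m] D(7)[of a "aone A" "[]" ys m] by (simp add: A.amul_one)
  have oneB: "c xs [aone B] (ract M m b) = ract M (c xs [aone B] m) b" for xs b m
    using balB[of xs "[]" m b] D(8)[of xs "aone B" b "[]" m] by (simp add: B.amul_one)
  let ?w = "infl_term c"
  have t0: "splits ?w ts = 0" if "\<not> (0 \<le> n \<and> int (length ts) = n + 2)" for ts
  proof -
    have "splits ?w ts = splits (\<lambda>us t vs. 0) ts"
    proof (rule splits_cong)
      fix us t vs assume "ts = us @ t # vs"
      then have "c (map fst us @ [aone A]) (rev (map (\<lambda>t. pB t) vs) @ [aone B]) = 0"
        by (intro Z) (use that in auto)
      then show "?w us t vs = 0" by (simp add: infl_term_def)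
    qed
    then show ?thesis by (simp add: splits_zero)
  qed
  have add: "splits ?w (us @ (x + y) # vs) = splits ?w (us @ x # vs) + splits ?w (us @ y # vs)" for us x y vs
  proof -
    have "?w a t (b @ (x + y) # vs) = ?w a t (b @ x # vs) + ?w a t (b @ y # vs)" for a t b
      by (simp add: infl_term_def D altsign_add)
    moreover have "?w us (x + y) vs = ?w us x vs + ?w us y vs"
      by (simp add: infl_term_def D altsign_add)
    moreover have "?w (us @ (x + y) # a) = (\<lambda>t b. ?w (us @ x # a) t b + ?w (us @ y # a) t b)" for a
      by (simp add: fun_eq_iff infl_term_def D altsign_add)
    ultimately show ?thesis
      by (simp add: splits_append splits_add)
  qed
  have scal: "splits ?w (us @ ascal Tri k x # vs) = mscal M k (splits ?w (us @ x # vs))" for us k x vs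
  proof -
    have "?w a t (b @ ascal Tri k x # vs) = mscal M k (?w a t (b @ x # vs))" for a t b
      by (simp add: infl_term_def D act_altsign act_uminus ascal_sel)
    moreover have "?w us (ascal Tri k x) vs = mscal M k (?w us x vs)"
      by (simp add: infl_term_def D act_altsign act_uminus ascal_sel)
    moreover have "?w (us @ ascal Tri k x # a) = (\<lambda>t b. mscal M k (?w (us @ x # a) t b))" for a
      by (simp add: fun_eq_iff infl_term_def D act_altsign act_uminus ascal_sel)
    ultimately show ?thesis
      by (simp add: splits_append splits_additive[of "mscal M k", OF mscal_add] mscal_add)
  qed
  \<comment> \<open>Only the decomposition with the first entry in the corner yields a new term: the
    corner of the product contains \<open>pM t\<close> times the \<open>B\<close>-part of
    \<open>x\<close>, where \<open>kB\<close> expresses \<open>c\<close> by \<open>g\<close>. This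
    is how the kernel condition makes inflation linear over the triangular algebra.\<close>
  have left: "splits ?w (amul Tri t x # xs) = lact M (fst t) (splits ?w (x # xs)) + ract M (pM t) (g (map (\<lambda>t. pB t) (x # xs)))" for t x xs
  proof -
    have "?w (amul Tri t x # us) = (\<lambda>s vs. lact M (fst t) (?w (x # us) s vs))" for us
      by (simp add: fun_eq_iff infl_term_def D act_altsign act_uminus amul_sel)
    moreover have "?w [] (amul Tri t x) xs = lact M (fst t) (?w [] x xs) + ract M (pM t) (g (map (\<lambda>t. pB t) (x # xs)))"
      using kB[of "map (\<lambda>t. pB t) (x # xs)" "pM t"]
      by (simp add: infl_term_def D amul_sel balB oneA altsign_add act_altsign act_uminus)
    ultimately show ?thesis
      by (simp add: splits_additive[of "lact M (fst t)", OF lact_add] lact_add)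
  qed
  have right: "splits ?w (xs @ [amul Tri x t]) = lact M (f (map fst (xs @ [x]))) (pM t) + ract M (splits ?w (xs @ [x])) (pB t)" for t x xs
  proof -
    have "?w us s (vs @ [amul Tri x t]) = ract M (?w us s (vs @ [x])) (pB t)" for us s vs
      by (simp add: infl_term_def D act_altsign act_uminus amul_sel)
    moreover have "?w xs (amul Tri x t) [] = ract M (?w xs x []) (pB t) + lact M (f (map fst (xs @ [x]))) (pM t)"
      using kA[of "map fst xs @ [fst x]" "pM t"]
      by (simp add: infl_term_def D amul_sel balA oneB altsign_def act_uminus)
    ultimately show ?thesis
      by (simp add: splits_append splits_additive[of "\<lambda>v. ract M v (pB t)", OF ract_add] ract_add)
  qed
  show ?thesis
    unfolding X infl_def hochschild_def hoch_cochains_def regular_def multilinear_iff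
    using t0 add scal left right
    by (simp add: fD gD prod_eq_iff ascal_sel amul_sel del: splits.simps split_paired_All)
qed

lemma restr_infl:
  assumes x: "x \<in> cochains C_source n"
  shows "restr (infl x) = x"
proof -
  obtain f c g where X: "x = (f, c, g)" by (cases x)
  have c: "c \<in> cochains self.TC n"
    using x by (auto simp: X cprod_def)
  note D = self.tri_mapsD[OF self.tri_cochainD(1)[OF c]] and Z = self.tri_cochainD(2)[OF c]
  have bal: "c (us @ [aone A]) (vs @ [aone B]) (ract M (lact M a m) b) = c (us @ [a]) (vs @ [b]) m" for us vs a b m
    using D(9)[of us "aone A" a "vs @ [b]" m] D(10)[of "us @ [aone A]" vs b "aone B" "lact M a m"]
    by (simp add: A.amul_one B.amul_one)
  have c0: "c xs ys 0 = 0" for xs ys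
    using D(5)[of xs ys 0 0] by simp
  have sel: "map fst (map tA us) = us" "map (\<lambda>t. pB t) (map tB vs) = vs" for us vs
    by (simp_all add: comp_def)
  \<comment> \<open>On a list with one corner entry and diagonal entries elsewhere, every other
    decomposition would feed 0 into the corner argument.\<close>
  have "infl_term c us' (tA a) vs' = 0" "infl_term c us' (tB b) vs' = 0" for us' vs' a b
    by (simp_all add: infl_term_def c0)
  then have w: "splits (infl_term c) (map tA us @ tM m # map tB vs) = infl_term c (map tA us) (tM m) (map tB vs)" for us m vs
    by (simp add: splits_append splits_map splits_zero)
  have "restrM (infl x) xs ys m = c xs ys m" for xs ys m
  proof (cases "xs = [] \<or> ys = []")
    case True
    then have "c xs ys = 0" by (intro Z) auto
    with True show ?thesis by (simp add: restrM_def)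
  next
    case False
    then obtain us a vs b where xs: "xs = us @ [a]" and ys: "ys = vs @ [b]" by (metis rev_exhaust)
    show ?thesis
      by (simp add: xs ys restrM_snoc X infl_def w)
        (simp add: infl_term_def sel[unfolded map_map] bal altsign_minus altsign_twice rev_map)
  qed
  then show ?thesis
    by (simp add: restr_def restrA_def restrB_def fun_eq_iff X infl_def comp_def)
qed

section \<open>The homotopy equivalence between the cone and the Hochschild complex\<close>

abbreviation "Rel \<equiv> relative Tri eA eB (aone Tri)"
abbreviation "Hom \<equiv> rel_homotopy Tri eA eB (aone Tri)"

lemma infl_restr:
  assumes F: "F \<in> cochains HT n"
  shows "infl (restr F) = Rel F"
proof
  fix ts
  note D = HT_D[OF F]
  show "infl (restr F) ts = Rel F ts"
  proof (cases ts)
    case Nil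
    then show ?thesis
      by (simp add: infl_def restr_def restrA_def restrB_def D(1) zero_prod_def)
  next
    case (Cons t ts')
    let ?A = "map (\<lambda>t. tA (fst t))" and ?B = "map (\<lambda>t. tB (pB t))"
    have left: "F (amul Tri eA x # xs) = (fst (F (x # xs)), pM (F (x # xs)), 0)" for x xs
      unfolding D(4) by (simp add: amul_Tri A.amul_one lact_one zeros)
    have right: "F (xs @ [amul Tri x eB]) = (0, pM (F (xs @ [x])), pB (F (xs @ [x])))" for x xs
      unfolding D(5) by (simp add: amul_Tri B.amul_one ract_one zeros)
    \<comment> \<open>The last entry of such a list absorbs \<open>eA\<close>; pulled out on the
      right, \<open>eA\<close> leaves only the \<open>A\<close>-component. For lists over
      \<open>B\<close>, \<open>eB\<close> is pulled out on the left.\<close>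
    have a: "F (?A ts) = tA (restrA F (map fst ts))"
    proof -
      obtain us x where ts: "ts = us @ [x]" using Cons by (metis list.distinct(1) rev_exhaust)
      have "F (?A us @ [amul Tri (tA (fst x)) eA]) = tA (fst (F (?A ts)))"
        unfolding D(5) ts by (simp add: amul_Tri A.amul_one zeros tA_def)
      then show ?thesis
        by (simp add: t_mul A.amul_one restrA_def ts comp_def)
    qed
    have b: "F (?B ts) = tB (restrB F (map (\<lambda>t. pB t) ts))"
    proof -
      have "F (amul Tri eB (tB (pB t)) # ?B ts') = tB (pB (F (?B ts)))"
        unfolding D(4) Cons by (simp add: amul_Tri B.amul_one zeros tB_def)
      then show ?thesis
        by (simp add: t_mul B.amul_one restrB_def Cons comp_def)
    qed
    \<comment> \<open>Pulling \<open>eA\<close> out on the left and \<open>eB\<close> out on the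
      right leaves only the corner component.\<close>
    have m: "F (?A us @ tM (pM s) # ?B vs) = tM (infl_term (restrM F) us s vs)" for us s vs
    proof -
      let ?L = "?A us @ tM (pM s) # ?B vs"
      have "fst (F ?L) = 0"
      proof (cases vs rule: rev_cases)
        case Nil
        then show ?thesis using arg_cong[OF right[of "?A us" "tM (pM s)"], of fst] by (simp add: t_mul ract_one)
      next
        case (snoc vs' v)
        then show ?thesis using arg_cong[OF right[of "?A us @ tM (pM s) # ?B vs'" "tB (pB v)"], of fst] by (simp add: t_mul B.amul_one)
      qed
      moreover have "pB (F ?L) = 0"
      proof (cases us)
        case Nil
        then show ?thesis using arg_cong[OF left[of "tM (pM s)" "?B vs"], of "\<lambda>x. pB x"] by (simp add: t_mul lact_one)
      next
        case (Cons u us')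
        then show ?thesis using arg_cong[OF left[of "tA (fst u)" "?A us' @ tM (pM s) # ?B vs"], of "\<lambda>x. pB x"] by (simp add: t_mul A.amul_one)
      qed
      ultimately have "F ?L = tM (pM (F ?L))"
        by (simp add: tM_def prod_eq_iff)
      then show ?thesis
        by (simp add: infl_term_def restrM_def lact_one ract_one altsign_minus altsign_twice comp_def rev_map)
    qed
    have "Rel F ts = F (?A ts) + splits (\<lambda>us t vs. F (?A us @ tM (pM t) # ?B vs)) ts + F (?B ts)"
      unfolding Cons by (rule relative_one[OF D(6)])
    also have "\<dots> = tA (restrA F (map fst ts)) + tM (splits (infl_term (restrM F)) ts) + tB (restrB F (map (\<lambda>t. pB t) ts))"
      by (simp only: a b m splits_additive[of tM, OF t_add(2)])
    finally show ?thesis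
      by (simp add: infl_def restr_def tA_def tM_def tB_def)
  qed
qed

lemma Rel_homotopy:
  assumes F: "F \<in> cochains HT n"
  shows "Rel F = F - (diff HT (Hom F) + Hom (diff HT F))"
proof
  fix ts
  note D = HT_D[OF F]
  show "Rel F ts = (F - (diff HT (Hom F) + Hom (diff HT F))) ts"
  proof (cases ts)
    case (Cons t ts')
    then show ?thesis
      using Tri.rel_homotopy_bar_diff[OF D(6) idempotents, of "aone Tri" t ts']
      by (simp add: hochschild_def Tri.amul_one)
  qed (simp add: D(1) hochschild_def)
qed

lemma Hom_cochain: "F \<in> cochains HT n \<Longrightarrow> Hom F \<in> cochains HT (n - 1)"
  using Tri.rel_homotopy_graded[of eA eB] unfolding graded_map_def by auto

lemma Hom_add: "Hom (F + G) = Hom F + Hom G"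
  by (simp add: fun_eq_iff rel_homotopy_add[symmetric] plus_fun_def)

lemma Hom_zero: "Hom 0 = 0"
  by (rule additive_zero[of Hom, OF Hom_add])

text \<open>
  Commutation with the differentials comes for free: the restriction is a chain map, hence it kills the
  defect, and it is injective on the image of \<open>Rel\<close>, which contains the defect.
\<close>

lemma infl_diff:
  assumes x: "x \<in> cochains C_source n" and k: "lam x = 0"
  shows "infl (diff C_source x) = diff HT (infl x)"
proof -
  have i: "infl x \<in> cochains HT n" by (rule infl_cochain[OF x k])
  have dx: "diff C_source x \<in> cochains C_source (n + 1)" by (rule C.X.diff_cochain[OF x])
  have "lam (diff C_source x) = 0"
    using C.F_diff[OF x] k C.Y.diff_zero by simp
  then have id: "infl (diff C_source x) \<in> cochains HT (n + 1)" by (rule infl_cochain[OF dx])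
  let ?z = "infl (diff C_source x) - diff HT (infl x)"
  have di: "diff HT (infl x) \<in> cochains HT (n + 1)" by (rule HT.diff_cochain[OF i])
  have z: "?z \<in> cochains HT (n + 1)" by (rule HT.sub_cochain[OF id di])
  have "restr ?z = restr (infl (diff C_source x)) - restr (diff HT (infl x))"
    by (rule additive_minus[of restr, OF restr_add])
  also have "\<dots> = 0"
    by (simp add: restr_infl[OF dx] restr_diff[OF i] restr_infl[OF x])
  finally have "Rel ?z = 0"
    using infl_restr[OF z] by (simp add: infl_zero)
  moreover have "Rel ?z = ?z"
  proof -
    have "Rel (infl (diff C_source x)) = infl (diff C_source x)" and Ri: "Rel (infl x) = infl x"
      by (simp_all add: infl_restr[OF id, symmetric] infl_restr[OF i, symmetric] restr_infl[OF dx] restr_infl[OF x])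
    moreover have "Rel (diff HT (infl x)) = diff HT (infl x)"
    proof -
      \<comment> \<open>\<open>Rel\<close> fixes \<open>infl x\<close>, so the homotopy term
        vanishes there; applying the differential to this equation shows that \<open>Rel\<close>
        fixes \<open>diff HT (infl x)\<close> too.\<close>
      have h: "diff HT (Hom (infl x)) + Hom (diff HT (infl x)) = 0"
        using Rel_homotopy[OF i] unfolding Ri by (simp only: eq_diff_eq add_cancel_left_right)
      have "Hom (infl x) \<in> cochains HT (n - 1)" "Hom (diff HT (infl x)) \<in> cochains HT n"
        using Hom_cochain[OF i] Hom_cochain[OF di] by auto
      then have "diff HT (Hom (diff HT (infl x))) = 0"
        using HT.diff_add[of "diff HT (Hom (infl x))" n "Hom (diff HT (infl x))"] h
          HT.diff_diff[of "Hom (infl x)" "n - 1"] HT.diff_cochain[of "Hom (infl x)" "n - 1"]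
        by (simp add: HT.diff_zero)
      then show ?thesis
        using Rel_homotopy[OF di] HT.diff_diff[OF i] by (simp add: Hom_zero)
    qed
    moreover have "Rel ?z = Rel (infl (diff C_source x)) - Rel (diff HT (infl x))"
      unfolding infl_restr[OF z, symmetric] infl_restr[OF id, symmetric] infl_restr[OF di, symmetric]
      by (simp add: infl_minus[symmetric] additive_minus[of restr, OF restr_add])
    ultimately show ?thesis by simp
  qed
  ultimately show ?thesis by simp
qed

text \<open>The cone is retracted onto the kernel and then inflated; the inverse restricts into the
  kernel and adds a zero second component. Both homotopies are the known ones with the sign changed,
  because \<open>homotopic\<close> takes composite minus identity, while
  \<open>retract_homotopy\<close> and \<open>Rel_homotopy\<close> subtract from the
  identity.\<close>

lemma homotopy_equiv_BG: "homotopy_equiv CM HT (\<lambda>z. infl (C.ret z))"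
  unfolding homotopy_equiv_def
proof (intro conjI exI)
  note CC = C_complex_cone
  have rc: "C.ret z \<in> cochains C_source n" "lam (C.ret z) = 0" if "z \<in> cochains CM n" for z n
    using C.retract_cochain C.F_retract that by (auto simp: CC)
  show "chain_map CM HT (\<lambda>z. infl (C.ret z))"
    unfolding chain_map_def
  proof (intro conjI allI ballI)
    show "graded_map CM HT 0 (\<lambda>z. infl (C.ret z))"
      using C.retract_graded infl_cochain[OF rc] unfolding graded_map_def CC
      by (auto simp: infl_add infl_scal image_subset_iff simp del: split_paired_All)
    show "infl (C.ret (diff CM z)) = diff HT (infl (C.ret z))" if "z \<in> cochains CM n" for n z
      using C.retract_diff[of z n] that infl_diff rc[OF that] by (simp add: CC)
  qed
  have Y0: "diff self.HC 0 = 0" "cscal self.HC k 0 = 0" for k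
    by (rule C.Y.diff_zero, rule C.Y.scal_zero)
  show "chain_map HT CM (\<lambda>F. (restr F, 0))"
    unfolding chain_map_def graded_map_def
    using restr_cochain lam_restr C.Y.zero_cochain Y0
    by (auto simp: CC cone_def restr_add restr_scal restr_diff)
  let ?h = "\<lambda>(x, y). ((- (0, self.edge_section y, 0), 0) :: ('a, 'b, 'm) C_cochain)"
  show "homotopic CM CM ((\<lambda>F. (restr F, 0)) \<circ> (\<lambda>z. infl (C.ret z))) id"
    unfolding homotopic_def
  proof (intro exI[of _ ?h] conjI allI ballI)
    have sX: "- (0, self.edge_section y, 0) \<in> cochains C_source n" if "y \<in> cochains self.HC n" for y n
      using C.X.minus_cochain[OF C.s_cochain[OF that]] by simp
    show "graded_map CM CM (-1) ?h"
      unfolding graded_map_def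
    proof (intro conjI allI ballI)
      fix n
      show "?h ` cochains CM n \<subseteq> cochains CM (n + - 1)"
        using sX C.Y.zero_cochain by (auto simp: CC cone_def)
    next
      fix n z w assume "z \<in> cochains CM n" "w \<in> cochains CM n"
      then show "?h (z + w) = ?h z + ?h w"
        using C.s_add[of "snd z" "n - 1" "snd w"] by (auto simp: CC cone_def split_beta)
    next
      fix n k z assume z: "z \<in> cochains CM n"
      then have "snd z \<in> cochains self.HC (n - 1)"
        by (auto simp: CC cone_def)
      moreover from this have "cscal C_source k (- (0, self.edge_section (snd z), 0)) =
          - cscal C_source k (0, self.edge_section (snd z), 0)"
        by (intro C.X.additive_minus[of "n - 1"]) (auto intro: C.X.scal_add C.s_cochain)
      ultimately show "?h (cscal CM k z) = cscal CM k (?h z)"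
        using C.s_scal[of "snd z" "n - 1" k, symmetric] Y0 by (simp add: CC cone_def split_beta)
    qed
    fix n z assume z: "z \<in> cochains CM n"
    then obtain x y where xy: "z = (x, y)" "x \<in> cochains C_source n" "y \<in> cochains self.HC (n - 1)"
      by (auto simp: CC cone_def)
    have "diff CM (- (0, self.edge_section y, 0), 0) = - diff CM ((0, self.edge_section y, 0), 0)"
      using cochain_complex.diff_minus[OF cochain_complex_C, of "((0, self.edge_section y, 0), 0)" "n - 1"]
        C.s_cochain[OF xy(3)] C.Y.zero_cochain by (simp add: CC cone_def)
    moreover have "(C.ret (x, y), 0) = (x, y) - diff CM ((0, self.edge_section y, 0), 0)
        - ((0, self.edge_section (snd (diff CM (x, y))), 0), 0)"
      using C.retract_homotopy[of x y n] z by (simp add: CC xy)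
    moreover have "restr (infl (C.ret (x, y))) = C.ret (x, y)"
      using restr_infl rc[OF z] xy by blast
    ultimately show "((\<lambda>F. (restr F, 0)) \<circ> (\<lambda>z. infl (C.ret z))) z - id z =
        diff CM (?h z) + ?h (diff CM z)"
      by (simp add: xy split_beta)
  qed
  show "homotopic HT HT ((\<lambda>z. infl (C.ret z)) \<circ> (\<lambda>F. (restr F, 0))) id"
    unfolding homotopic_def
  proof (intro exI[of _ "\<lambda>F. - Hom F"] conjI allI ballI)
    show "graded_map HT HT (-1) (\<lambda>F. - Hom F)"
      unfolding graded_map_def
    proof (intro conjI allI ballI)
      fix n show "(\<lambda>F. - Hom F) ` cochains HT n \<subseteq> cochains HT (n + - 1)"
        using Hom_cochain HT.minus_cochain by auto
    next
      fix n k F assume F: "F \<in> cochains HT n"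
      then show "- Hom (cscal HT k F) = cscal HT k (- Hom F)"
        using Tri.rel_homotopy_graded[of eA eB] HT.additive_minus[of "n - 1" "cscal HT k" "Hom F"]
          HT.scal_add[of _ "n - 1"] Hom_cochain[OF F]
        unfolding graded_map_def by simp
    qed (simp add: Hom_add)
    fix n F assume F: "F \<in> cochains HT n"
    have "infl (C.ret (restr F, 0)) = Rel F"
      using C.retract_kernel[OF lam_restr[OF F]] infl_restr[OF F] by simp
    then show "((\<lambda>z. infl (C.ret z)) \<circ> (\<lambda>F. (restr F, 0))) F - id F = diff HT (- Hom F) + - Hom (diff HT F)"
      using Rel_homotopy[OF F] HT.diff_minus[OF Hom_cochain[OF F]] by simp
  qed
qed

text \<open>Holds for whichever equivalence \<open>SOME\<close> picks, since
  \<open>homotopy_equiv_BG\<close> provides one to pick.\<close>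

lemma BG_iso:
  "klinear_iso (coh_scal CM n) (coh CM n) (coh_scal HT n) (HH Tri n) (BG_ident A B M n)"
proof -
  have "homotopy_equiv CM HT (BG_equiv A B M)"
    unfolding BG_equiv_def by (rule someI[of "homotopy_equiv CM HT", OF homotopy_equiv_BG])
  then show ?thesis
    unfolding BG_ident_def HH_def by (rule homotopy_equiv_coh_iso[OF cochain_complex_C cochain_complex_HT])
qed

end

section \<open>Functoriality in the bimodules\<close>

definition bimod_hom :: "('k, 'a, 'b, 'm::ab_group_add) bimod \<Rightarrow> ('k, 'a, 'b, 'n::ab_group_add) bimod \<Rightarrow> ('m \<Rightarrow> 'n) \<Rightarrow> bool" where
  "bimod_hom M N h \<longleftrightarrow> (\<forall>x y. h (x + y) = h x + h y) \<and> (\<forall>a x. h (lact M a x) = lact N a (h x)) \<and>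
     (\<forall>x b. h (ract M x b) = ract N (h x) b) \<and> (\<forall>k x. h (mscal M k x) = mscal N k (h x))"

locale bimod_change = P: bimod_pair A B M N + Q: bimod_pair A B M' N'
  for A :: "('k::{comm_ring,monoid_mult}, 'a::ab_group_add) alg"
    and B :: "('k, 'b::ab_group_add) alg"
    and M :: "('k, 'a, 'b, 'm::ab_group_add) bimod" and N :: "('k, 'a, 'b, 'n::ab_group_add) bimod"
    and M' :: "('k, 'a, 'b, 'm'::ab_group_add) bimod" and N' :: "('k, 'a, 'b, 'n'::ab_group_add) bimod" +
  fixes f :: "'m' \<Rightarrow> 'm" and g :: "'n \<Rightarrow> 'n'"
  assumes f: "bimod_hom M' M f" and g: "bimod_hom N N' g"
begin

lemma f_hom: "f (x + y) = f x + f y" "f (lact M' a x) = lact M a (f x)" "f (ract M' x b) = ract M (f x) b"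
  "f (mscal M' k x) = mscal M k (f x)"
  using f by (auto simp: bimod_hom_def)

lemma g_hom: "g (x + y) = g x + g y" "g (lact N a x) = lact N' a (g x)" "g (ract N x b) = ract N' (g x) b"
  "g (mscal N k x) = mscal N' k (g x)"
  using g by (auto simp: bimod_hom_def)

lemma g_zero: "g 0 = 0"
  by (rule additive_zero[of g, OF g_hom(1)])

lemma g_altsign: "g (altsign n x) = altsign n (g x)"
  by (rule altsign_additive[of g, OF g_hom(1)])

lemma tri_funct_maps:
  assumes "c \<in> tri_maps A B M N" shows "tri_funct f g c \<in> tri_maps A B M' N'"
  by (rule Q.tri_mapsI) (simp_all add: tri_funct_def P.tri_mapsD[OF assms] f_hom g_hom)

lemma tri_funct_diff: "tri_funct f g (tri_diff A B c) = tri_diff A B (tri_funct f g c)"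
  by (simp add: fun_eq_iff tri_funct_def tri_diff_def g_hom(1) g_altsign bar_diff_additive[of g, OF g_hom(1)])

lemma tri_funct_add: "tri_funct f g (c + c') = tri_funct f g c + tri_funct f g c'"
  by (simp add: fun_eq_iff tri_funct_def g_hom)

lemma chain_map_tri: "chain_map (tri_complex A B M N) (tri_complex A B M' N') (tri_funct f g)"
  unfolding chain_map_def graded_map_def
  by (auto simp: tri_complex_def tri_funct_maps tri_funct_diff tri_funct_add)
    (auto simp: tri_funct_def fun_eq_iff g_zero g_hom)

lemma chain_map_ext: "chain_map (ext_complex A B M N) (ext_complex A B M' N') (tri_funct f g)"
  unfolding chain_map_def graded_map_def
  by (auto simp: ext_complex_def tri_funct_maps tri_funct_diff tri_funct_add)
    (auto simp: tri_funct_def fun_eq_iff g_zero g_hom)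

definition hom_funct :: "('t list \<Rightarrow> 'm \<Rightarrow> 'n) \<Rightarrow> 't list \<Rightarrow> 'm' \<Rightarrow> 'n'" where
  "hom_funct u xs = g \<circ> u xs \<circ> f"

lemma hom_funct_bar_diff: "hom_funct (bar_diff T u) = bar_diff T (hom_funct u)"
proof (intro ext)
  fix xs x
  show "hom_funct (bar_diff T u) xs x = bar_diff T (hom_funct u) xs x"
    unfolding hom_funct_def comp_def bar_diff_apply[of T u] bar_diff_apply[of T "\<lambda>xs x. g (u xs (f x))"]
    by (simp add: bar_diff_additive[of g, OF g_hom(1)])
qed

lemma chain_map_homR:
  "chain_map P.HR Q.HR hom_funct"
  unfolding chain_map_def graded_map_def
  by (auto simp: hochschild_def hom_funct_bar_diff)
    (auto simp: hoch_cochains_def multilinear_iff homR_bimod_def homR_def hom_funct_def fun_eq_iff f_hom g_hom g_zero)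

lemma chain_map_homL:
  "chain_map P.HL Q.HL hom_funct"
  unfolding chain_map_def graded_map_def
  by (auto simp: hochschild_def hom_funct_bar_diff)
    (auto simp: hoch_cochains_def multilinear_iff homL_bimod_def homL_def hom_funct_def fun_eq_iff f_hom g_hom g_zero)

lemma iA_tri_funct: "iA B (tri_funct f g c) = hom_funct (iA B c)"
  by (simp add: fun_eq_iff iA_def tri_funct_def hom_funct_def)

lemma iB_tri_funct: "iB A (tri_funct f g c) = hom_funct (iB A c)"
  by (simp add: fun_eq_iff iB_def tri_funct_def hom_funct_def g_altsign)

text \<open>Naturality of the section in the bimodules. It keeps the homotopy of the cone inside the
  kernel of the projection to a summand.\<close>

lemma edge_section_tri_funct:
  "tri_funct f g (P.edge_section (u, v)) = Q.edge_section (hom_funct u, hom_funct v)"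
  by (auto simp: fun_eq_iff tri_funct_def P.edge_section_def Q.edge_section_def hom_funct_def P.sectionA_def
      Q.sectionA_def P.sectionB_def Q.sectionB_def g_hom g_altsign g_zero split: list.split)

end

locale bimod_compress = bimod_change A B X X Y Y \<iota> \<pi>
  for A :: "('k::{comm_ring,monoid_mult}, 'a::ab_group_add) alg"
    and B :: "('k, 'b::ab_group_add) alg"
    and X :: "('k, 'a, 'b, 'x::ab_group_add) bimod" and Y :: "('k, 'a, 'b, 'y::ab_group_add) bimod"
    and \<iota> :: "'y \<Rightarrow> 'x" and \<pi> :: "'x \<Rightarrow> 'y"
begin

lemma C_compress_hom_funct:
  "C_compress \<pi> \<iota> ((f', c, g'), (u, v)) = ((f', tri_funct \<iota> \<pi> c, g'), (hom_funct u, hom_funct v))"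
  by (simp add: C_compress_def hom_funct_def fun_eq_iff)

text \<open>Stated for arbitrary bimodule maps: with projection and inclusion exchanged it yields
  the degreewise splitting, which need not be a chain map.\<close>

lemma C_compress_graded: "graded_map (C_complex A B X) (C_complex A B Y) 0 (C_compress \<pi> \<iota>)"
  using chain_map_tri chain_map_homR chain_map_homL
  unfolding chain_map_def graded_map_def C_complex_def cone_def cprod_def
  by (auto simp: C_compress_hom_funct image_subset_iff)

text \<open>Compressing the action of \<open>a\<close> gives the action of \<open>a\<close> composed
  with \<open>\<pi> \<circ> \<iota>\<close>, so the assumption is what makes compression compatible
  with \<open>alphaM\<close> and \<open>betaM\<close> in the cone differential.\<close>

lemma chain_map_C_compress:
  assumes "\<And>y. \<pi> (\<iota> y) = y"
  shows "chain_map (C_complex A B X) (C_complex A B Y) (C_compress \<pi> \<iota>)"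
proof -
  have a: "hom_funct (alphaM X f') = alphaM Y f'" "hom_funct (betaM X g') = betaM Y g'" for f' g'
    by (simp_all add: fun_eq_iff hom_funct_def alphaM_def betaM_def g_hom assms)
  have h: "hom_funct (u + u') = hom_funct u + hom_funct u'" "hom_funct (u - u') = hom_funct u - hom_funct u'"
    for u u' :: "'t list \<Rightarrow> 'x \<Rightarrow> 'x"
    by (simp_all add: fun_eq_iff hom_funct_def g_hom additive_minus[of \<pi>, OF g_hom(1)])
  show ?thesis
    unfolding chain_map_def
    using C_compress_graded
    by (auto simp: C_complex_def cone_def cprod_def tri_complex_def hochschild_def C_compress_hom_funct h a
        tri_funct_diff iA_tri_funct iB_tri_funct hom_funct_bar_diff)
qed

end

lemma bimod_hom_fst: "bimod_hom (M \<oplus>\<^sub>m N) M fst"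
  and bimod_hom_snd: "bimod_hom (M \<oplus>\<^sub>m N) N snd"
  by (auto simp: bimod_hom_def dsum_def)

lemma bimod_hom_inl: "bimod_over A B N \<Longrightarrow> bimod_hom M (M \<oplus>\<^sub>m N) (\<lambda>x. (x, 0))"
  and bimod_hom_inr: "bimod_over A B M \<Longrightarrow> bimod_hom N (M \<oplus>\<^sub>m N) (\<lambda>y. (0, y))"
  by (auto simp: bimod_hom_def dsum_def bimod_over.act_zero)

section \<open>Compression on Hochschild cohomology and its composition\<close>

lemma C_compress_comp:
  "C_compress \<pi>' \<iota>' (C_compress \<pi> \<iota> z) = C_compress (\<pi>' \<circ> \<pi>) (\<iota> \<circ> \<iota>') z"
  by (auto simp: C_compress_def tri_funct_def fun_eq_iff split: prod.split)

lemma bimod_overI: "kalgebra A \<Longrightarrow> kalgebra B \<Longrightarrow> bimodule A B M \<Longrightarrow> bimod_over A B M"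
  by (simp add: bimod_over_def bimod_over_axioms_def kalg_def)

lemma bimod_over_dsum: "bimod_over A B M \<Longrightarrow> bimod_over A B N \<Longrightarrow> bimod_over A B (M \<oplus>\<^sub>m N)"
  by (simp add: bimod_over_def bimod_over_axioms_def bimodule_dsum)

lemma bimod_compressI:
  "bimod_over A B X \<Longrightarrow> bimod_over A B Y \<Longrightarrow> bimod_hom X Y \<pi> \<Longrightarrow> bimod_hom Y X \<iota> \<Longrightarrow> bimod_compress A B X Y \<iota> \<pi>"
  by (simp add: bimod_compress_def bimod_change_def bimod_change_axioms_def bimod_pair_def)

text \<open>The inverse of \<open>BG_ident\<close> inside \<open>HH_compress\<close> cancels on
  images of \<open>BG_ident\<close>, and by \<open>HH_carrier\<close> every class is such an image.
  Compression is thus computed on cocycles of the cones, for any choice of the equivalences.\<close>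

lemma HH_compress_BG:
  assumes "bimod_compress A B X Y \<iota> \<pi>" "\<And>y. \<pi> (\<iota> y) = y"
    and x: "x \<in> cochains (C_complex A B X) n" "diff (C_complex A B X) x = 0"
  shows "HH_compress A B X Y \<pi> \<iota> n (BG_ident A B X n (coh_class (C_complex A B X) n x)) =
    BG_ident A B Y n (coh_class (C_complex A B Y) n (C_compress \<pi> \<iota> x))"
    and "C_compress \<pi> \<iota> x \<in> cochains (C_complex A B Y) n" "diff (C_complex A B Y) (C_compress \<pi> \<iota> x) = 0"
proof -
  interpret bimod_compress A B X Y \<iota> \<pi> by fact
  have i: "induces_coh_map (C_complex A B X) n (C_complex A B Y) n (C_compress \<pi> \<iota>)"
    by (rule chain_map_induces[OF P.M.cochain_complex_C Q.M.cochain_complex_C chain_map_C_compress[OF assms(2)]])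
  then show "C_compress \<pi> \<iota> x \<in> cochains (C_complex A B Y) n" "diff (C_complex A B Y) (C_compress \<pi> \<iota> x) = 0"
    using x by (auto simp: induces_coh_map_def)
  have "bij_betw (BG_ident A B X n) (carrier (coh (C_complex A B X) n)) (carrier (HH (triang A X B) n))"
    using P.M.BG_iso unfolding klinear_iso_def by blast
  then show "HH_compress A B X Y \<pi> \<iota> n (BG_ident A B X n (coh_class (C_complex A B X) n x)) =
    BG_ident A B Y n (coh_class (C_complex A B Y) n (C_compress \<pi> \<iota> x))"
    unfolding HH_compress_def
    by (simp add: bij_betw_inv_into_left cochain_complex.coh_class_carrier[OF P.M.cochain_complex_C] x
        coh_map_class[OF P.M.cochain_complex_C Q.M.cochain_complex_C i])
qed

lemma HH_carrier:
  assumes "bimod_over A B X" "z \<in> carrier (HH (triang A X B) n)"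
  obtains x where "x \<in> cochains (C_complex A B X) n" "diff (C_complex A B X) x = 0"
    "z = BG_ident A B X n (coh_class (C_complex A B X) n x)"
proof -
  interpret bimod_over A B X by fact
  have "carrier (HH (triang A X B) n) = BG_ident A B X n ` carrier (coh (C_complex A B X) n)"
    using BG_iso unfolding klinear_iso_def bij_betw_def by blast
  then show ?thesis
    using assms(2) that by (auto simp: cochain_complex.carrier_coh[OF cochain_complex_C])
qed

lemma HH_compress_comp:
  assumes "bimod_compress A B X Y \<iota> \<pi>" "\<And>y. \<pi> (\<iota> y) = y"
    and "bimod_compress A B Y W \<iota>' \<pi>'" "\<And>w. \<pi>' (\<iota>' w) = w"
    and x: "x \<in> cochains (C_complex A B X) n" "diff (C_complex A B X) x = 0"
  shows "HH_compress A B Y W \<pi>' \<iota>' n (HH_compress A B X Y \<pi> \<iota> n (BG_ident A B X n (coh_class (C_complex A B X) n x))) =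
    BG_ident A B W n (coh_class (C_complex A B W) n (C_compress (\<pi>' \<circ> \<pi>) (\<iota> \<circ> \<iota>') x))"
  using HH_compress_BG[OF assms(1,2) x] HH_compress_BG(1)[OF assms(3,4)] by (simp add: C_compress_comp)

text \<open>Reassociation leaves the last summand alone, so both sides compress along the projection
  of the threefold sum onto \<open>L\<close> and the inclusion of \<open>L\<close>.\<close>

lemma r_map_comp:
  assumes M: "bimod_over A B M" and N: "bimod_over A B N" and L: "bimod_over A B L"
    and z: "z \<in> carrier (HH (triang A (M \<oplus>\<^sub>m N \<oplus>\<^sub>m L) B) n)"
  shows "r_map A B L N n (r_map A B (N \<oplus>\<^sub>m L) M n z) = r_map A B L (N \<oplus>\<^sub>m M) n (HH_reassoc A B M N L n z)"
proof -
  note ds = bimod_over_dsum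
  obtain x where x: "x \<in> cochains (C_complex A B (M \<oplus>\<^sub>m N \<oplus>\<^sub>m L)) n" "diff (C_complex A B (M \<oplus>\<^sub>m N \<oplus>\<^sub>m L)) x = 0"
    and zx: "z = BG_ident A B (M \<oplus>\<^sub>m N \<oplus>\<^sub>m L) n (coh_class (C_complex A B (M \<oplus>\<^sub>m N \<oplus>\<^sub>m L)) n x)"
    using HH_carrier[OF ds[OF M ds[OF N L]] z] by blast
  have proj: "bimod_compress A B (X \<oplus>\<^sub>m Y) Y (\<lambda>y. (0, y)) snd"
    if "bimod_over A B X" "bimod_over A B Y"
    for X :: "('a, 'b, 'c, 'x::ab_group_add) bimod" and Y :: "('a, 'b, 'c, 'y::ab_group_add) bimod"
    by (rule bimod_compressI[OF ds[OF that] that(2) bimod_hom_snd bimod_hom_inr[OF that(1)]])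
  have re: "bimod_compress A B (M \<oplus>\<^sub>m N \<oplus>\<^sub>m L) ((N \<oplus>\<^sub>m M) \<oplus>\<^sub>m L) (\<lambda>((y, x), z). (x, y, z)) (\<lambda>(x, y, z). ((y, x), z))"
    by (rule bimod_compressI[OF ds[OF M ds[OF N L]] ds[OF ds[OF N M] L]])
      (auto simp: bimod_hom_def dsum_def)
  have 1: "r_map A B L N n (r_map A B (N \<oplus>\<^sub>m L) M n z) = BG_ident A B L n
      (coh_class (C_complex A B L) n (C_compress (snd \<circ> snd) ((\<lambda>y. (0, y)) \<circ> (\<lambda>y. (0, y))) x))"
    unfolding r_map_def zx
    by (rule HH_compress_comp[OF proj[OF M ds[OF N L]] _ proj[OF N L] _ x]) simp_all
  have 2: "r_map A B L (N \<oplus>\<^sub>m M) n (HH_reassoc A B M N L n z) = BG_ident A B L n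
      (coh_class (C_complex A B L) n (C_compress (snd \<circ> (\<lambda>(x, y, z). ((y, x), z))) ((\<lambda>((y, x), z). (x, y, z)) \<circ> (\<lambda>y. (0, y))) x))"
    unfolding r_map_def HH_reassoc_def zx
    by (rule HH_compress_comp[OF re _ proj[OF ds[OF N M] L] _ x]) auto
  show ?thesis
    unfolding 1 2 by (simp add: comp_def split_beta)
qed

section \<open>The long exact sequence\<close>

context bimod_pair begin

lemma ext_cochain_tri: "c \<in> cochains (ext_complex A B M N) n \<Longrightarrow> c \<in> cochains (tri_complex A B M N) (n + 1)"
  by (auto simp: ext_complex_def tri_complex_def)

lemma ext_cochain_i:
  assumes "c \<in> cochains (ext_complex A B M N) n"
  shows "iA B c = 0" "iB A c = 0"
  using assms by (auto simp: ext_complex_def iA_def iB_revsign fun_eq_iff)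

text \<open>On the edges linearity reduces every value to one at a unit, which the restrictions see;
  if these vanish, \<open>c\<close> lives on pairs of lists with at least two entries each. The
  degree drops by one because p + q = n - 1 in degree n of the triangular complex.\<close>

lemma tri_cochain_ext:
  assumes c: "c \<in> cochains (tri_complex A B M N) n" and i: "iA B c = 0" "iB A c = 0"
  shows "c \<in> cochains (ext_complex A B M N) (n - 1)"
proof -
  note D = tri_mapsD[OF tri_cochainD(1)[OF c]] and Z = tri_cochainD(2)[OF c]
  have "c xs ys m = 0" if nz: "\<not> (2 \<le> length xs \<and> 2 \<le> length ys \<and> int (length xs) + int (length ys) = n - 1 + 4)" for xs ys m
  proof -
    consider b where "ys = [b]" | a where "xs = [a]" | "\<not> (0 \<le> n \<and> 1 \<le> length xs \<and> 1 \<le> length ys \<and> int (length xs) + int (length ys) = n + 3)"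
      using nz that by (cases xs rule: remdups_adj.cases; cases ys rule: remdups_adj.cases) auto
    then show ?thesis
    proof cases
      case 1
      have "c xs [aone B] m = 0"
        using fun_cong[OF fun_cong[OF i(1)], of xs m] by (simp add: iA_def)
      then show ?thesis
        using D(8)[of xs "aone B" b "[]" m] by (simp add: 1 M.B.amul_one N.act_zero)
    next
      case 2
      have "altsign (revsign (length ys)) (c [aone A] ys m) = 0"
        using fun_cong[OF fun_cong[OF i(2)], of "rev ys" m] by (simp add: iB_revsign)
      then have "c [aone A] ys m = 0"
        by (simp add: altsign_def split: if_splits)
      then show ?thesis
        using D(7)[of a "aone A" "[]" ys m] by (simp add: 2 M.A.amul_one N.act_zero)
    qed (simp add: Z)
  qed
  then show ?thesis
    using tri_cochainD(1)[OF c] by (auto simp: ext_complex_def fun_eq_iff)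
qed

end

locale bimod_sum = bimod_pair A B M N
  for A :: "('k::{comm_ring,monoid_mult}, 'a::ab_group_add) alg"
    and B :: "('k, 'b::ab_group_add) alg"
    and M :: "('k, 'a, 'b, 'm::ab_group_add) bimod"
    and N :: "('k, 'a, 'b, 'n::ab_group_add) bimod"
begin

abbreviation "S \<equiv> M \<oplus>\<^sub>m N"
abbreviation "CS \<equiv> C_complex A B S"
abbreviation "CN \<equiv> C_complex A B N"
abbreviation "ES \<equiv> ext_complex A B S S"
abbreviation "Z_complex \<equiv> ext_complex A B N M \<times>\<^sub>c ext_complex A B M M \<times>\<^sub>c ext_complex A B M N"

sublocale S: bimod_over A B S
  by (rule bimod_over_dsum[OF M.bimod_over_axioms N.bimod_over_axioms])

sublocale swap: bimod_pair A B N M by unfold_locales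

lemma homs: "bimod_hom S M fst" "bimod_hom S N snd" "bimod_hom M S (\<lambda>x. (x, 0))" "bimod_hom N S (\<lambda>y. (0, y))"
  by (rule bimod_hom_fst bimod_hom_snd bimod_hom_inl[OF N.bimod_over_axioms] bimod_hom_inr[OF M.bimod_over_axioms])+

sublocale NM: bimod_change A B N M S S snd "\<lambda>x. (x, 0)"
  by unfold_locales (rule homs)+
sublocale MM: bimod_change A B M M S S fst "\<lambda>x. (x, 0)"
  by unfold_locales (rule homs)+
sublocale MN: bimod_change A B M N S S fst "\<lambda>y. (0, y)"
  by unfold_locales (rule homs)+
sublocale SNM: bimod_change A B S S N M "\<lambda>y. (0, y)" fst
  by unfold_locales (rule homs)+
sublocale SMM: bimod_change A B S S M M "\<lambda>x. (x, 0)" fst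
  by unfold_locales (rule homs)+
sublocale SMN: bimod_change A B S S M N "\<lambda>x. (x, 0)" snd
  by unfold_locales (rule homs)+
sublocale SNN: bimod_compress A B S N "\<lambda>y. (0, y)" snd
  by unfold_locales (rule homs)+
sublocale NNS: bimod_compress A B N S snd "\<lambda>y. (0, y)"
  by unfold_locales (rule homs)+

text \<open>Block matrices of maps on the sum with zero (N,N) block, the block that the projection
  keeps. The blocks are ordered as in \<open>Ext3\<close>.\<close>

definition matrix :: "('a list \<Rightarrow> 'b list \<Rightarrow> 'n \<Rightarrow> 'm) \<times> ('a list \<Rightarrow> 'b list \<Rightarrow> 'm \<Rightarrow> 'm) \<times> ('a list \<Rightarrow> 'b list \<Rightarrow> 'm \<Rightarrow> 'n)
    \<Rightarrow> 'a list \<Rightarrow> 'b list \<Rightarrow> 'm \<times> 'n \<Rightarrow> 'm \<times> 'n" where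
  "matrix = (\<lambda>(u, v, w). tri_funct snd (\<lambda>x. (x, 0)) u + tri_funct fst (\<lambda>x. (x, 0)) v + tri_funct fst (\<lambda>y. (0, y)) w)"

definition entries :: "('a list \<Rightarrow> 'b list \<Rightarrow> 'm \<times> 'n \<Rightarrow> 'm \<times> 'n)
    \<Rightarrow> ('a list \<Rightarrow> 'b list \<Rightarrow> 'n \<Rightarrow> 'm) \<times> ('a list \<Rightarrow> 'b list \<Rightarrow> 'm \<Rightarrow> 'm) \<times> ('a list \<Rightarrow> 'b list \<Rightarrow> 'm \<Rightarrow> 'n)" where
  "entries c = (tri_funct (\<lambda>y. (0, y)) fst c, tri_funct (\<lambda>x. (x, 0)) fst c, tri_funct (\<lambda>x. (x, 0)) snd c)"

definition j_map :: "('a list \<Rightarrow> 'b list \<Rightarrow> 'n \<Rightarrow> 'm) \<times> ('a list \<Rightarrow> 'b list \<Rightarrow> 'm \<Rightarrow> 'm) \<times> ('a list \<Rightarrow> 'b list \<Rightarrow> 'm \<Rightarrow> 'n)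
    \<Rightarrow> ('a, 'b, 'm \<times> 'n) C_cochain" where
  "j_map z = ((0, matrix z, 0), 0)"

definition \<rho>_map :: "('a, 'b, 'm \<times> 'n) C_cochain
    \<Rightarrow> ('a list \<Rightarrow> 'b list \<Rightarrow> 'n \<Rightarrow> 'm) \<times> ('a list \<Rightarrow> 'b list \<Rightarrow> 'm \<Rightarrow> 'm) \<times> ('a list \<Rightarrow> 'b list \<Rightarrow> 'm \<Rightarrow> 'n)" where
  "\<rho>_map x = entries (fst (snd (S.C.ret x)))"

lemma cochain_complex_Z: "cochain_complex Z_complex"
  by (intro cochain_complex_cprod swap.cochain_complex_ext M.self.cochain_complex_ext cochain_complex_ext)

lemma chain_map_matrix: "chain_map Z_complex ES matrix"
proof -
  interpret E: cochain_complex "ES" by (rule S.self.cochain_complex_ext)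
  show ?thesis
    unfolding chain_map_def graded_map_def
  proof (intro conjI allI ballI)
    fix n
    show "matrix ` cochains Z_complex n \<subseteq> cochains ES (n + 0)"
      using NM.chain_map_ext MM.chain_map_ext MN.chain_map_ext
      by (auto simp: chain_map_def graded_map_def image_subset_iff matrix_def cprod_def intro!: E.add_cochain)
  next
    fix n z z'
    show "matrix (z + z') = matrix z + matrix z'"
      by (auto simp: matrix_def NM.tri_funct_add MM.tri_funct_add MN.tri_funct_add split: prod.split)
  next
    fix n k z
    show "matrix (cscal Z_complex k z) = cscal ES k (matrix z)"
      by (auto simp: matrix_def cprod_def ext_complex_def fun_eq_iff tri_funct_def dsum_def M.act_zero N.act_zero
          M.mscal_add N.mscal_add split: prod.split)
  next
    fix n z
    have "tri_diff A B (c + c') = tri_diff A B c + tri_diff A B c'" for c c' :: "'a list \<Rightarrow> 'b list \<Rightarrow> 'm \<times> 'n \<Rightarrow> 'm \<times> 'n"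
      by (simp add: fun_eq_iff tri_diff_def bar_diff_add altsign_add)
    then show "matrix (diff Z_complex z) = diff ES (matrix z)"
      by (auto simp: matrix_def cprod_def ext_complex_def NM.tri_funct_diff MM.tri_funct_diff MN.tri_funct_diff split: prod.split)
  qed
qed

lemma entries_cochain: "c \<in> cochains ES n \<Longrightarrow> entries c \<in> cochains Z_complex n"
  using SNM.chain_map_ext SMM.chain_map_ext SMN.chain_map_ext
  by (auto simp: chain_map_def graded_map_def image_subset_iff entries_def cprod_def)

lemma entries_matrix:
  assumes "z \<in> cochains Z_complex n"
  shows "entries (matrix z) = z"
proof -
  obtain u v w where z: "z = (u, v, w)" by (cases z)
  have "u \<in> tri_maps A B N M" "v \<in> tri_maps A B M M" "w \<in> tri_maps A B M N"
    using assms by (auto simp: z cprod_def ext_complex_def)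
  then have "u xs ys 0 = 0" "v xs ys 0 = 0" "w xs ys 0 = 0" for xs ys
    using swap.tri_mapsD(5)[of u xs ys 0 0] M.self.tri_mapsD(5)[of v xs ys 0 0] tri_mapsD(5)[of w xs ys 0 0] by auto
  then show ?thesis
    by (simp add: z entries_def matrix_def fun_eq_iff tri_funct_def)
qed

lemma matrix_entries:
  assumes c: "c \<in> tri_maps A B S S" and "tri_funct (\<lambda>y. (0, y)) snd c = 0"
  shows "matrix (entries c) = c"
proof (intro ext)
  fix xs ys and m :: "'m \<times> 'n"
  have "c xs ys ((fst m, 0) + (0, snd m)) = c xs ys (fst m, 0) + c xs ys (0, snd m)"
    by (rule S.self.tri_mapsD(5)[OF c])
  moreover have "snd (c xs ys (0, y)) = 0" for y
    using fun_cong[OF fun_cong[OF fun_cong[OF assms(2)]], of xs ys y] by (simp add: tri_funct_def)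
  ultimately show "matrix (entries c) xs ys m = c xs ys m"
    by (simp add: entries_def matrix_def tri_funct_def prod_eq_iff)
qed

lemma ret_fst: "fst (S.C.ret ((f, c, g), w)) = f" "snd (snd (S.C.ret ((f, c, g), w))) = g"
  using cochain_complex.diff_zero[OF S.cochain_complex_A] cochain_complex.diff_zero[OF S.cochain_complex_B]
  by (simp_all add: cone_retract_def cprod_def hochschild_def split_beta)

lemma split_sequence:
  "split_sequence Z_complex CS CN j_map (C_compress snd (\<lambda>y. (0, y)))
     (C_compress (\<lambda>y. (0, y)) snd) \<rho>_map"
proof -
  interpret Z: cochain_complex Z_complex by (rule cochain_complex_Z)
  interpret X: cochain_complex "CS" by (rule S.cochain_complex_C)
  interpret Y: cochain_complex "CN" by (rule N.cochain_complex_C)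
  let ?p = "C_compress snd (\<lambda>y. (0, y)) :: ('a, 'b, 'm \<times> 'n) C_cochain \<Rightarrow> ('a, 'b, 'n) C_cochain"
  have p: "chain_map CS CN ?p"
    by (rule SNN.chain_map_C_compress) simp
  have mat: "matrix z \<in> cochains ES n" if "z \<in> cochains Z_complex n" for z n
    using chain_map_matrix that by (auto simp: chain_map_def graded_map_def)
  have lam0: "S.lam (0, matrix z, 0) = 0" if "z \<in> cochains Z_complex n" for z n
    using S.self.ext_cochain_i[OF mat[OF that]]
    by (simp add: alphaM_def[abs_def] betaM_def[abs_def] S.act_zero fun_eq_iff zero_prod_def)
  have ret: "S.C.ret x \<in> cochains S.C_source n" "S.lam (S.C.ret x) = 0"
    if "x \<in> cochains CS n" for x n
    using S.C.retract_cochain S.C.F_retract that by (auto simp: S.C_complex_cone)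
  have a0: "alphaM S 0 = 0" "betaM S 0 = 0"
    by (auto simp: alphaM_def betaM_def fun_eq_iff S.act_zero)
  \<comment> \<open>The retraction does not touch the Hochschild components, which vanish on the
    kernel of \<open>?p\<close>. The kernel condition for \<open>S.lam\<close> then says that both
    restrictions of the remaining component vanish, so it is a cochain for
    \<open>Ext\<close>.\<close>
  have retp: "\<exists>c. S.C.ret x = (0, c, 0) \<and> c \<in> cochains ES (n - 1)"
    if x: "x \<in> cochains CS n" and px: "?p x = 0" for x n
  proof -
    obtain f c g w where X: "x = ((f, c, g), w)" by (metis prod.collapse)
    have fg: "f = 0" "g = 0"
      using px by (cases w, simp add: X C_compress_def zero_prod_def)+
    obtain c' where c': "S.C.ret x = (0, c', 0)"
      using ret_fst[of f c g w] by (cases "S.C.ret x") (simp add: X fg)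
    then show ?thesis
      using ret[OF x] S.self.tri_cochain_ext[of c' n] by (auto simp: cprod_def a0 zero_prod_def)
  qed
  show ?thesis
  proof
    show "chain_map CS CN ?p" by (rule p)
    show "graded_map CN CS 0 (C_compress (\<lambda>y. (0, y)) snd)"
      by (rule NNS.C_compress_graded)
    show "?p (C_compress (\<lambda>y. (0, y)) snd y) = y" for y
      by (cases y) (auto simp: C_compress_def tri_funct_def fun_eq_iff)
    show "graded_map Z_complex CS 1 j_map"
      unfolding graded_map_def
    proof (intro conjI allI ballI)
      fix n show "j_map ` cochains Z_complex n \<subseteq> cochains CS (n + 1)"
        using S.self.ext_cochain_tri[OF mat] S.C.Y.zero_cochain
          cochain_complex.zero_cochain[OF S.cochain_complex_A] cochain_complex.zero_cochain[OF S.cochain_complex_B]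
        by (auto simp: j_map_def C_complex_def cone_def cprod_def zero_prod_def)
    next
      fix n z z' assume "z \<in> cochains Z_complex n" "z' \<in> cochains Z_complex n"
      then show "j_map (z + z') = j_map z + j_map z'"
        using chain_map_matrix unfolding chain_map_def graded_map_def j_map_def by simp
    next
      fix n k z assume "z \<in> cochains Z_complex n"
      then have "matrix (cscal Z_complex k z) = cscal ES k (matrix z)"
        using chain_map_matrix unfolding chain_map_def graded_map_def by blast
      then show "j_map (cscal Z_complex k z) = cscal CS k (j_map z)"
        using S.C.Y.scal_zero[of k] cochain_complex.scal_zero[OF S.cochain_complex_A, of k]
          cochain_complex.scal_zero[OF S.cochain_complex_B, of k]
        by (simp add: j_map_def C_complex_def cone_def cprod_def ext_complex_def tri_complex_def)
    qed
    show "j_map (diff Z_complex z) = diff CS (j_map z)" if z: "z \<in> cochains Z_complex n" for n z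
    proof -
      have "matrix (diff Z_complex z) = diff ES (matrix z)"
        using chain_map_matrix z unfolding chain_map_def by blast
      then show ?thesis
        using S.C.Y.diff_zero cochain_complex.diff_zero[OF S.cochain_complex_A]
          cochain_complex.diff_zero[OF S.cochain_complex_B] lam0[OF z]
        by (simp add: j_map_def C_complex_def cone_def cprod_def ext_complex_def tri_complex_def)
    qed
    show "?p (j_map z) = 0" if "z \<in> cochains Z_complex n" for z n
    proof -
      obtain u v w where z: "z = (u, v, w)" by (cases z)
      have "w xs ys 0 = 0" for xs ys
        using tri_mapsD(5)[of w xs ys 0 0] that by (simp add: z cprod_def ext_complex_def)
      then show ?thesis
        by (auto simp: z j_map_def matrix_def C_compress_def tri_funct_def fun_eq_iff zero_prod_def)
    qed
    show "\<rho>_map x \<in> cochains Z_complex (n - 1)" if x: "x \<in> cochains CS n" "?p x = 0" for n x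
      using retp[OF x] entries_cochain by (auto simp: \<rho>_map_def)
    show "\<rho>_map (x + y) = \<rho>_map x + \<rho>_map y"
      if "x \<in> cochains CS n" "y \<in> cochains CS n" for n x y
    proof -
      have "S.C.ret (x + y) = S.C.ret x + S.C.ret y"
        using S.C.retract_graded that unfolding graded_map_def S.C_complex_cone by blast
      then show ?thesis
        by (simp add: \<rho>_map_def entries_def SNM.tri_funct_add SMM.tri_funct_add SMN.tri_funct_add)
    qed
    show "\<rho>_map (cscal CS k x) = cscal Z_complex k (\<rho>_map x)"
      if "x \<in> cochains CS n" for n k x
    proof -
      have "S.C.ret (cscal CS k x) = cscal S.C_source k (S.C.ret x)"
        using S.C.retract_graded that unfolding graded_map_def S.C_complex_cone by blast
      then show ?thesis
        by (simp add: \<rho>_map_def entries_def cprod_def tri_complex_def ext_complex_def split_beta fun_eq_iff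
            tri_funct_def dsum_def)
    qed
    show "\<rho>_map (diff CS x) = diff Z_complex (\<rho>_map x)"
      if "x \<in> cochains CS n" for n x
    proof -
      have "S.C.ret (diff CS x) = diff S.C_source (S.C.ret x)"
        using S.C.retract_diff that unfolding S.C_complex_cone by blast
      then show ?thesis
        by (simp add: \<rho>_map_def entries_def cprod_def tri_complex_def ext_complex_def split_beta
            SNM.tri_funct_diff SMM.tri_funct_diff SMN.tri_funct_diff)
    qed
    show "\<rho>_map (j_map z) = z" if z: "z \<in> cochains Z_complex n" for n z
      using S.C.retract_kernel[OF lam0[OF z]] entries_matrix[OF z] by (simp add: \<rho>_map_def j_map_def)
    show "\<exists>y\<in>cochains CS (n - 1). ?p y = 0 \<and> x = j_map (\<rho>_map x) + diff CS y"
      if x: "x \<in> cochains CS n" and px: "?p x = 0" and dx: "diff CS x = 0" for n x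
    proof -
      obtain a u v where X: "x = (a, (u, v))" by (metis prod.collapse)
      \<comment> \<open>The element through which the homotopy of the cone moves the cocycle
        \<open>x\<close> to its retraction; its (N,N) block vanishes by naturality of the
        section.\<close>
      let ?y = "((0, S.self.edge_section (u, v), 0), 0) :: ('a, 'b, 'm \<times> 'n) C_cochain"
      have "(u, v) \<in> cochains (hom_complexes A B S S) (n - 1)"
        using x by (simp add: X S.C_complex_cone cone_def)
      then have y: "?y \<in> cochains CS (n - 1)"
        using S.C.s_cochain S.C.Y.zero_cochain by (simp add: S.C_complex_cone cone_def)
      have uv: "SNN.hom_funct u = 0" "SNN.hom_funct v = 0"
        using px by (auto simp: X SNN.C_compress_hom_funct[of "fst a" "fst (snd a)" "snd (snd a)", simplified] zero_prod_def)
      have e0: "N.self.edge_section (0, 0) = 0"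
        by (rule N.C.s_zero[unfolded zero_prod_def prod.inject, THEN conjunct2, THEN conjunct1])
      have py: "?p ?y = 0"
        using SNN.C_compress_hom_funct[of 0 "S.self.edge_section (u, v)" 0 0 0]
        by (simp add: SNN.edge_section_tri_funct uv e0 zero_prod_def SNN.hom_funct_def fun_eq_iff)
      have h: "(S.C.ret x, 0) = x - diff CS ?y"
        using S.C.retract_homotopy[of a "(u, v)" n] x dx S.C.s_zero
        by (simp add: X S.C_complex_cone zero_prod_def[symmetric])
      obtain c where c: "S.C.ret x = (0, c, 0)" "c \<in> cochains ES (n - 1)"
        using retp[OF x px] by blast
      have dy: "diff CS ?y \<in> cochains CS n"
        using X.diff_cochain[OF y] by simp
      \<comment> \<open>The homotopy formula shows that the retraction of \<open>x\<close> again has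
        zero (N,N) block; then its three other entries determine it.\<close>
      have "?p (S.C.ret x, 0) = ?p x - ?p (diff CS ?y)"
        unfolding h by (rule X.additive_diff[OF _ x dy]) (use p in \<open>auto simp: chain_map_def graded_map_def\<close>)
      also have "?p (diff CS ?y) = diff CN (?p ?y)"
        using p y unfolding chain_map_def by blast
      finally have "?p (S.C.ret x, 0) = 0"
        unfolding px py Y.diff_zero by (simp only: diff_self)
      then have "?p ((0, c, 0), 0) = 0"
        unfolding c(1) .
      then have "tri_funct (\<lambda>y. (0, y)) snd c = 0"
        by (simp add: C_compress_def zero_prod_def)
      then have "matrix (entries c) = c"
        using c(2) by (intro matrix_entries) (auto simp: ext_complex_def)
      then have "j_map (\<rho>_map x) = (S.C.ret x, 0)"
        by (simp add: j_map_def \<rho>_map_def c(1))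
      then show ?thesis
        using h py y by (intro bexI[of _ ?y]) auto
    qed
  qed
qed

end

section \<open>Transport of the sequence to \<open>Ext\<close> and Hochschild cohomology\<close>

context bimod_sum begin

sublocale seq: split_sequence Z_complex "CS" "CN" j_map
    "C_compress snd (\<lambda>y. (0, y))" "C_compress (\<lambda>y. (0, y)) snd" \<rho>_map
  by (rule split_sequence)

definition Ext3_of where
  "Ext3_of n c = (coh_map (ext_complex A B N M) n fst c, coh_map (ext_complex A B M M) n (\<lambda>z. fst (snd z)) c,
     coh_map (ext_complex A B M N) n (\<lambda>z. snd (snd z)) c)"

lemma Ext3_of_class:
  assumes "z \<in> cochains Z_complex n" "diff Z_complex z = 0"
  shows "Ext3_of n (coh_class Z_complex n z) = (coh_class (ext_complex A B N M) n (fst z),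
    coh_class (ext_complex A B M M) n (fst (snd z)), coh_class (ext_complex A B M N) n (snd (snd z)))"
proof -
  have "chain_map Z_complex (ext_complex A B N M) fst" "chain_map Z_complex (ext_complex A B M M) (\<lambda>z. fst (snd z))"
    "chain_map Z_complex (ext_complex A B M N) (\<lambda>z. snd (snd z))"
    by (auto simp: chain_map_def graded_map_def cprod_def)
  note i = this[THEN chain_map_induces[OF cochain_complex_Z, rotated]]
  show ?thesis
    unfolding Ext3_of_def
    using coh_map_class[OF cochain_complex_Z swap.cochain_complex_ext i(1)[OF swap.cochain_complex_ext] assms]
      coh_map_class[OF cochain_complex_Z M.self.cochain_complex_ext i(2)[OF M.self.cochain_complex_ext] assms]
      coh_map_class[OF cochain_complex_Z cochain_complex_ext i(3)[OF cochain_complex_ext] assms]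
    by simp
qed

text \<open>Cocycles and coboundaries of the product complex are products of those of its factors,
  so passing to the components of a representative is bijective on classes.\<close>

lemma Ext3_iso:
  "klinear_iso (coh_scal Z_complex n) (coh Z_complex n) (Ext3_scal A B M N n) (Ext3 A B M N n) (Ext3_of n)"
proof -
  interpret E1: cochain_complex "ext_complex A B N M" by (rule swap.cochain_complex_ext)
  interpret E2: cochain_complex "ext_complex A B M M" by (rule M.self.cochain_complex_ext)
  interpret E3: cochain_complex "ext_complex A B M N" by (rule cochain_complex_ext)
  have co: "z \<in> cochains Z_complex n \<and> diff Z_complex z = 0 \<longleftrightarrow>
      (fst z \<in> cochains (ext_complex A B N M) n \<and> diff (ext_complex A B N M) (fst z) = 0) \<and>
      (fst (snd z) \<in> cochains (ext_complex A B M M) n \<and> diff (ext_complex A B M M) (fst (snd z)) = 0) \<and>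
      (snd (snd z) \<in> cochains (ext_complex A B M N) n \<and> diff (ext_complex A B M N) (snd (snd z)) = 0)" for z n
    by (cases z) (auto simp: cprod_def zero_prod_def)
  have carr: "carrier (Ext3 A B M N n) = carrier (coh (ext_complex A B N M) n) \<times>
      carrier (coh (ext_complex A B M M) n) \<times> carrier (coh (ext_complex A B M N) n)"
    by (simp add: Ext3_def Ext_def DirProd_def)
  have mult: "(c1, c2, c3) \<otimes>\<^bsub>Ext3 A B M N n\<^esub> (c1', c2', c3') = (c1 \<otimes>\<^bsub>coh (ext_complex A B N M) n\<^esub> c1',
      c2 \<otimes>\<^bsub>coh (ext_complex A B M M) n\<^esub> c2', c3 \<otimes>\<^bsub>coh (ext_complex A B M N) n\<^esub> c3')" for c1 c2 c3 c1' c2' c3'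
    by (simp add: Ext3_def Ext_def DirProd_def)
  have "Ext3_of n ` carrier (coh Z_complex n) = carrier (Ext3 A B M N n)"
  proof (intro subset_antisym subsetI)
    fix e assume "e \<in> Ext3_of n ` carrier (coh Z_complex n)"
    then obtain z where z: "z \<in> cochains Z_complex n" "diff Z_complex z = 0" and e: "e = Ext3_of n (coh_class Z_complex n z)"
      by (auto elim: seq.Z.cohE)
    show "e \<in> carrier (Ext3 A B M N n)"
      using co[of z n] z
      by (simp add: e Ext3_of_class carr E1.coh_class_carrier E2.coh_class_carrier E3.coh_class_carrier)
  next
    fix e assume "e \<in> carrier (Ext3 A B M N n)"
    then obtain u v w where "u \<in> cochains (ext_complex A B N M) n" "diff (ext_complex A B N M) u = 0"
      "v \<in> cochains (ext_complex A B M M) n" "diff (ext_complex A B M M) v = 0"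
      "w \<in> cochains (ext_complex A B M N) n" "diff (ext_complex A B M N) w = 0"
      and e: "e = (coh_class (ext_complex A B N M) n u, coh_class (ext_complex A B M M) n v, coh_class (ext_complex A B M N) n w)"
      by (auto simp: carr E1.carrier_coh E2.carrier_coh E3.carrier_coh)
    then have z: "(u, v, w) \<in> cochains Z_complex n" "diff Z_complex (u, v, w) = 0"
      using co[of "(u, v, w)" n] by auto
    then show "e \<in> Ext3_of n ` carrier (coh Z_complex n)"
      using Ext3_of_class[OF z] seq.Z.coh_class_carrier[OF z] e by force
  qed
  moreover have "inj_on (Ext3_of n) (carrier (coh Z_complex n))"
  proof (rule inj_onI)
    fix c c' assume c: "c \<in> carrier (coh Z_complex n)" "c' \<in> carrier (coh Z_complex n)" "Ext3_of n c = Ext3_of n c'"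
    obtain z where "z \<in> cochains Z_complex n" "diff Z_complex z = 0" "c = coh_class Z_complex n z"
      using c(1) by (rule seq.Z.cohE)
    moreover obtain z' where "z' \<in> cochains Z_complex n" "diff Z_complex z' = 0" "c' = coh_class Z_complex n z'"
      using c(2) by (rule seq.Z.cohE)
    ultimately show "c = c'"
      using c(3)
      by (cases z; cases z') (simp add: Ext3_of_class seq.Z.coh_class_eq_iff E1.coh_class_eq_iff E2.coh_class_eq_iff
        E3.coh_class_eq_iff coboundaries_cprod)
  qed
  moreover have "Ext3_of n (c \<otimes>\<^bsub>coh Z_complex n\<^esub> c') = Ext3_of n c \<otimes>\<^bsub>Ext3 A B M N n\<^esub> Ext3_of n c'"
    if cc: "c \<in> carrier (coh Z_complex n)" "c' \<in> carrier (coh Z_complex n)" for c c'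
  proof -
    obtain z where z: "z \<in> cochains Z_complex n" "diff Z_complex z = 0" "c = coh_class Z_complex n z"
      using cc(1) by (rule seq.Z.cohE)
    obtain z' where z': "z' \<in> cochains Z_complex n" "diff Z_complex z' = 0" "c' = coh_class Z_complex n z'"
      using cc(2) by (rule seq.Z.cohE)
    have "diff Z_complex (z + z') = 0"
      using seq.Z.diff_add[OF z(1) z'(1)] z z' by simp
    then show ?thesis
      using seq.Z.add_cochain[OF z(1) z'(1)] z z'
      by (simp add: seq.Z.mult_coh Ext3_of_class mult E1.mult_coh E2.mult_coh E3.mult_coh)
  qed
  moreover have "Ext3_of n (coh_scal Z_complex n k c) = Ext3_scal A B M N n k (Ext3_of n c)"
    if c: "c \<in> carrier (coh Z_complex n)" for k c
  proof -
    obtain z where z: "z \<in> cochains Z_complex n" "diff Z_complex z = 0" "c = coh_class Z_complex n z"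
      using c by (rule seq.Z.cohE)
    have "cscal Z_complex k z \<in> cochains Z_complex n" "diff Z_complex (cscal Z_complex k z) = 0"
      using seq.Z.scal_cochain[OF z(1)] seq.Z.diff_scal[OF z(1)] z(2) seq.Z.scal_zero by auto
    moreover have "cscal Z_complex k z = (cscal (ext_complex A B N M) k (fst z), cscal (ext_complex A B M M) k (fst (snd z)),
        cscal (ext_complex A B M N) k (snd (snd z)))"
      by (simp add: cprod_def split_beta)
    ultimately show ?thesis
      using co[of z n] z
      by (simp add: coh_scal_class[OF cochain_complex_Z] Ext3_of_class Ext3_scal_def
        coh_scal_class[OF E1.cochain_complex_axioms] coh_scal_class[OF E2.cochain_complex_axioms]
        coh_scal_class[OF E3.cochain_complex_axioms])
  qed
  ultimately show ?thesis
    by (auto simp: klinear_iso_def klinear_hom_def hom_def bij_betw_def)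
qed

text \<open>Both the identification of \<open>Ext\<close> with the cohomology of
  \<open>Sigma_complex\<close> and the inclusion into the cone are given on cochains. The former
  respects differentials because an \<open>Ext\<close> cochain is killed by both restrictions, the
  latter because the actions of zero Hochschild cochains vanish.\<close>

lemma l_one_class:
  assumes c: "c \<in> cochains ES (n - 1)" "diff ES c = 0"
  shows "l_one A B S n (coh_class ES (n - 1) c) =
    BG_ident A B S n (coh_class CS n ((0, c, 0), 0))"
proof -
  interpret \<Sigma>: split_chain_map "tri_complex A B S S" "hom_complexes A B S S" "\<lambda>c. (iA B c, iB A c)" S.self.edge_section
    by (rule S.self.split_Sigma)
  have \<Sigma>: "cochain_complex (Sigma_complex A B S S)"
    unfolding Sigma_complex_def
    by (rule cochain_complex_cone[OF S.self.cochain_complex_tri S.self.cochain_complex_hom \<Sigma>.chain])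
  note Y0 = S.C.Y.diff_zero S.C.Y.zero_cochain S.C.Y.scal_zero
  have "graded_map ES (Sigma_complex A B S S) 1 (\<lambda>c. (c, 0))"
    unfolding graded_map_def
    using Y0 S.self.ext_cochain_tri
    by (auto simp: Sigma_complex_def cone_def image_subset_iff)
      (simp_all add: ext_complex_def tri_complex_def)
  moreover have "(diff ES x, 0) = diff (Sigma_complex A B S S) (x, 0)"
    if "x \<in> cochains ES m" for x m
    using Y0 S.self.ext_cochain_i[OF that]
    by (simp add: Sigma_complex_def cone_def ext_complex_def tri_complex_def zero_prod_def)
  ultimately have i1: "induces_coh_map ES (n - 1) (Sigma_complex A B S S) n (\<lambda>c. (c, 0))"
    by (intro graded_map_induces[OF S.self.cochain_complex_ext \<Sigma>]) auto
  have A0: "diff (hochschild_self A) 0 = 0" "\<And>n. 0 \<in> cochains (hochschild_self A) n" "\<And>k. cscal (hochschild_self A) k 0 = 0"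
    using cochain_complex.diff_zero[OF S.cochain_complex_A] cochain_complex.zero_cochain[OF S.cochain_complex_A]
      cochain_complex.scal_zero[OF S.cochain_complex_A] by auto
  have B0: "diff (hochschild_self B) 0 = 0" "\<And>n. 0 \<in> cochains (hochschild_self B) n" "\<And>k. cscal (hochschild_self B) k 0 = 0"
    using cochain_complex.diff_zero[OF S.cochain_complex_B] cochain_complex.zero_cochain[OF S.cochain_complex_B]
      cochain_complex.scal_zero[OF S.cochain_complex_B] by auto
  have a0: "alphaM S 0 = 0" "betaM S 0 = 0"
    by (auto simp: alphaM_def betaM_def fun_eq_iff S.act_zero)
  have "chain_map (Sigma_complex A B S S) CS Sigma_incl"
    unfolding chain_map_def graded_map_def
    by (auto simp: Sigma_complex_def C_complex_def cone_def cprod_def Sigma_incl_def A0 B0 a0)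
  then have i2: "induces_coh_map (Sigma_complex A B S S) n CS n Sigma_incl"
    by (rule chain_map_induces[OF \<Sigma> S.cochain_complex_C])
  have "(c, 0) \<in> cochains (Sigma_complex A B S S) n" "diff (Sigma_complex A B S S) (c, 0) = 0"
    using i1 c unfolding induces_coh_map_def by auto
  moreover have "Sigma_incl (c, 0) = ((0, c, 0), 0)"
    by (simp add: Sigma_incl_def)
  ultimately show ?thesis
    unfolding l_one_def ext_ident_def
    by (simp add: coh_map_class[OF S.self.cochain_complex_ext \<Sigma> i1 c] coh_map_class[OF \<Sigma> S.cochain_complex_C i2])
qed

lemma l_map_Ext3_of:
  assumes c: "c \<in> carrier (coh Z_complex (n - 1))"
  shows "l_map A B N M n (Ext3_of (n - 1) c) = BG_ident A B S n (seq.l n c)"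
proof -
  let ?m = "n - 1"
  from c obtain u v w where z: "(u, v, w) \<in> cochains Z_complex ?m" "diff Z_complex (u, v, w) = 0"
    and cz: "c = coh_class Z_complex ?m (u, v, w)"
    by (auto simp: seq.Z.carrier_coh)
  have uvw: "u \<in> cochains (ext_complex A B N M) ?m" "diff (ext_complex A B N M) u = 0"
    "v \<in> cochains (ext_complex A B M M) ?m" "diff (ext_complex A B M M) v = 0"
    "w \<in> cochains (ext_complex A B M N) ?m" "diff (ext_complex A B M N) w = 0"
    using z by (auto simp: cprod_def zero_prod_def)
  note E = S.self.cochain_complex_ext
  note u = coh_map_class[OF swap.cochain_complex_ext E chain_map_induces[OF swap.cochain_complex_ext E NM.chain_map_ext] uvw(1,2)]
  note v = coh_map_class[OF M.self.cochain_complex_ext E chain_map_induces[OF M.self.cochain_complex_ext E MM.chain_map_ext] uvw(3,4)]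
  note w = coh_map_class[OF cochain_complex_ext E chain_map_induces[OF cochain_complex_ext E MN.chain_map_ext] uvw(5,6)]
  have "Ext3_incl A B M N ?m (Ext3_of ?m c) = coh_class ES ?m (matrix (u, v, w))"
    unfolding cz Ext3_of_class[OF z]
    by (simp add: Ext3_incl_def Let_def Ext_def u v w cochain_complex.mult_coh[OF E] matrix_def)
  moreover have "matrix (u, v, w) \<in> cochains ES ?m" "diff ES (matrix (u, v, w)) = 0"
    using chain_map_induces[OF cochain_complex_Z E chain_map_matrix, of ?m] z by (auto simp: induces_coh_map_def)
  ultimately show ?thesis
    unfolding l_map_def
    by (simp add: l_one_class cz seq.l_class[OF z] j_map_def)
qed

lemma r_map_BG:
  assumes "c \<in> carrier (coh CS n)"
  shows "r_map A B N M n (BG_ident A B S n c) = BG_ident A B N n (seq.r n c)"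
proof -
  obtain x where x: "x \<in> cochains CS n" "diff CS x = 0"
    and c: "c = coh_class CS n x"
    using assms by (rule seq.X.cohE)
  show ?thesis
    unfolding r_map_def c seq.r_class[OF x]
    by (rule HH_compress_BG(1)[OF SNN.bimod_compress_axioms _ x]) simp
qed

theorem long_exact_sequence:
  "\<exists>d. \<forall>n.
     klinear_hom (Ext3_scal A B M N (n - 1)) (Ext3 A B M N (n - 1)) (coh_scal S.HT n) (HH S.Tri n) (l_map A B N M n) \<and>
     klinear_hom (coh_scal S.HT n) (HH S.Tri n) (coh_scal N.HT n) (HH N.Tri n) (r_map A B N M n) \<and>
     klinear_hom (coh_scal N.HT n) (HH N.Tri n) (Ext3_scal A B M N n) (Ext3 A B M N n) (d n) \<and>
     kernel (HH S.Tri n) (HH N.Tri n) (r_map A B N M n) = l_map A B N M n ` carrier (Ext3 A B M N (n - 1)) \<and>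
     kernel (HH N.Tri n) (Ext3 A B M N n) (d n) = r_map A B N M n ` carrier (HH S.Tri n) \<and>
     kernel (Ext3 A B M N (n - 1)) (HH S.Tri n) (l_map A B N M n) = d (n - 1) ` carrier (HH N.Tri (n - 1))"
proof -
  \<comment> \<open>The connecting morphism of the cones, carried over by the isomorphisms at its
    two ends; \<open>BG_ident\<close> is inverted in the same way as in
    \<open>HH_compress\<close>.\<close>
  define d where "d n z = Ext3_of n (seq.d n (inv_into (carrier (coh CN n)) (BG_ident A B N n) z))" for n z
  have carr: "carrier (HH S.Tri n) = BG_ident A B S n ` carrier (coh CS n)"
    "carrier (HH N.Tri n) = BG_ident A B N n ` carrier (coh CN n)"
    "carrier (Ext3 A B M N n) = Ext3_of n ` carrier (coh Z_complex n)" for n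
    using S.BG_iso N.BG_iso Ext3_iso by (auto simp: klinear_iso_def bij_betw_def)
  have d: "d n (BG_ident A B N n c) = Ext3_of n (seq.d n c)" if "c \<in> carrier (coh CN n)" for n c
  proof -
    have "bij_betw (BG_ident A B N n) (carrier (coh CN n)) (carrier (HH N.Tri n))"
      using N.BG_iso by (simp add: klinear_iso_def)
    then show ?thesis
      by (simp add: d_def bij_betw_inv_into_left[OF _ that])
  qed
  have closed: "seq.l n ` carrier (coh Z_complex (n - 1)) \<subseteq> carrier (coh CS n)"
    "seq.r n ` carrier (coh CS n) \<subseteq> carrier (coh CN n)"
    "seq.d n ` carrier (coh CN n) \<subseteq> carrier (coh Z_complex n)" for n
    using seq.l_klinear seq.r_klinear seq.d_klinear by (auto simp: klinear_hom_def hom_def Pi_iff)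
  have gZ: "group (Ext3 A B M N n)" for n
    unfolding Ext3_def Ext_def
    by (intro DirProd_group cochain_complex.group_coh swap.cochain_complex_ext M.self.cochain_complex_ext cochain_complex_ext)
  have gS: "group (HH S.Tri n)" and gN: "group (HH N.Tri n)" for n
    unfolding HH_def by (rule cochain_complex.group_coh, rule S.cochain_complex_HT N.cochain_complex_HT)+
  have 1: "klinear_hom (Ext3_scal A B M N (n - 1)) (Ext3 A B M N (n - 1)) (coh_scal S.HT n) (HH S.Tri n) (l_map A B N M n)" for n
    by (rule klinear_hom_transport[OF Ext3_iso S.BG_iso seq.l_klinear seq.Z.group_coh
          coh_scal_closed[OF cochain_complex_Z] l_map_Ext3_of])
  have 2: "klinear_hom (coh_scal S.HT n) (HH S.Tri n) (coh_scal N.HT n) (HH N.Tri n) (r_map A B N M n)" for n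
    by (rule klinear_hom_transport[OF S.BG_iso N.BG_iso seq.r_klinear seq.X.group_coh
          coh_scal_closed[OF S.cochain_complex_C] r_map_BG])
  have 3: "klinear_hom (coh_scal N.HT n) (HH N.Tri n) (Ext3_scal A B M N n) (Ext3 A B M N n) (d n)" for n
    by (rule klinear_hom_transport[OF N.BG_iso Ext3_iso seq.d_klinear seq.Y.group_coh
          coh_scal_closed[OF N.cochain_complex_C] d])
  have 4: "kernel (HH S.Tri n) (HH N.Tri n) (r_map A B N M n) = l_map A B N M n ` carrier (Ext3 A B M N (n - 1))" for n
  proof -
    have "kernel (HH S.Tri n) (HH N.Tri n) (r_map A B N M n) =
        BG_ident A B S n ` kernel (coh CS n) (coh CN n) (seq.r n)"
      by (rule klinear_iso_kernel[OF S.BG_iso N.BG_iso seq.Y.group_coh gN closed(2) r_map_BG])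
    also have "\<dots> = l_map A B N M n ` carrier (Ext3 A B M N (n - 1))"
      unfolding seq.exact_X carr image_image by (intro image_cong refl) (rule l_map_Ext3_of[symmetric])
    finally show ?thesis .
  qed
  have 5: "kernel (HH N.Tri n) (Ext3 A B M N n) (d n) = r_map A B N M n ` carrier (HH S.Tri n)" for n
  proof -
    have "kernel (HH N.Tri n) (Ext3 A B M N n) (d n) =
        BG_ident A B N n ` kernel (coh CN n) (coh Z_complex n) (seq.d n)"
      by (rule klinear_iso_kernel[OF N.BG_iso Ext3_iso seq.Z.group_coh gZ closed(3) d])
    also have "\<dots> = r_map A B N M n ` carrier (HH S.Tri n)"
      unfolding seq.exact_Y carr image_image by (intro image_cong refl) (rule r_map_BG[symmetric])
    finally show ?thesis .
  qed
  have 6: "kernel (Ext3 A B M N (n - 1)) (HH S.Tri n) (l_map A B N M n) = d (n - 1) ` carrier (HH N.Tri (n - 1))" for n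
  proof -
    have "kernel (Ext3 A B M N (n - 1)) (HH S.Tri n) (l_map A B N M n) =
        Ext3_of (n - 1) ` kernel (coh Z_complex (n - 1)) (coh CS n) (seq.l n)"
      by (rule klinear_iso_kernel[OF Ext3_iso S.BG_iso seq.X.group_coh gS closed(1) l_map_Ext3_of])
    also have "\<dots> = d (n - 1) ` carrier (HH N.Tri (n - 1))"
      unfolding seq.exact_Z carr image_image by (intro image_cong refl) (rule d[symmetric])
    finally show ?thesis .
  qed
  show ?thesis
    by (intro exI[of _ d] allI conjI 1 2 3 4 5 6)
qed

end

theorem mainTheorem4:
  fixes A :: "('k::{comm_ring,monoid_mult}, 'a::ab_group_add) alg"
    and B :: "('k, 'b::ab_group_add) alg"
    and M :: "('k, 'a, 'b, 'm::ab_group_add) bimod"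
    and N :: "('k, 'a, 'b, 'n::ab_group_add) bimod"
  assumes "kalgebra A" and "kalgebra B"
    and "bimodule A B M" and "bimodule A B N"
    and "kprojective (ascal A)" and "kprojective (ascal B)"
    and "kprojective (mscal M)" and "kprojective (mscal N)"
  shows
    "(let HHN = HH (triang A N B); HHMN = HH (triang A (M \<oplus>\<^sub>m N) B); E = Ext3 A B M N;
          sN = coh_scal (hochschild_self (triang A N B));
          sMN = coh_scal (hochschild_self (triang A (M \<oplus>\<^sub>m N) B));
          sE = Ext3_scal A B M N;
          l = l_map A B N M; r = r_map A B N M
      in \<exists>d. \<forall>n.
           klinear_hom (sE (n - 1)) (E (n - 1)) (sMN n) (HHMN n) (l n) \<and>
           klinear_hom (sMN n) (HHMN n) (sN n) (HHN n) (r n) \<and>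
           klinear_hom (sN n) (HHN n) (sE n) (E n) (d n) \<and>
           kernel (HHMN n) (HHN n) (r n) = l n ` carrier (E (n - 1)) \<and>
           kernel (HHN n) (E n) (d n) = r n ` carrier (HHMN n) \<and>
           kernel (E (n - 1)) (HHMN n) (l n) = d (n - 1) ` carrier (HHN (n - 1)))
     \<and> (\<forall>L :: ('k, 'a, 'b, 'l::ab_group_add) bimod.
          bimodule A B L \<longrightarrow> kprojective (mscal L) \<longrightarrow>
          (\<forall>n. \<forall>z \<in> carrier (HH (triang A (M \<oplus>\<^sub>m N \<oplus>\<^sub>m L) B) n).
          r_map A B L N n (r_map A B (N \<oplus>\<^sub>m L) M n z)
          = r_map A B L (N \<oplus>\<^sub>m M) n (HH_reassoc A B M N L n z)))"
proof -
  have M: "bimod_over A B M" and N: "bimod_over A B N"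
    using bimod_overI[OF assms(1,2)] assms(3,4) by auto
  interpret bimod_sum A B M N
    using M N by (simp add: bimod_sum_def bimod_pair_def)
  show ?thesis
    unfolding Let_def
  proof (intro conjI allI impI ballI long_exact_sequence)
    fix L :: "('k, 'a, 'b, 'l) bimod" and n z
    assume "bimodule A B L" and z: "z \<in> carrier (HH (triang A (M \<oplus>\<^sub>m N \<oplus>\<^sub>m L) B) n)"
    then have "bimod_over A B L"
      using bimod_overI[OF assms(1,2)] by blast
    then show "r_map A B L N n (r_map A B (N \<oplus>\<^sub>m L) M n z) = r_map A B L (N \<oplus>\<^sub>m M) n (HH_reassoc A B M N L n z)"
      by (rule r_map_comp[OF M N _ z])
  qed
qed

end
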